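(* Let $f:\mathbb{R}\to\mathbb{R}$ be locally Lipschitz continuous with $f(0)=0$ and $xf(x)>0$ for all $x\neq 0$. Suppose that there exists an odd function $\phi$ on $\mathbb{R}$ such that $\lim_{x\to 0} f(x)/\phi(x)=1$, that $f\in \mathrm{RV}_0(\beta)$ for some $\beta>1$, and that $\lim_{x\to 0^+} f(x)/x=0$. Let $\sigma:[0,\infty)\to\mathbb{R}$ be continuous with $\int_t^\infty \sigma^2(s)\,ds>0$ for all $t\ge0$, and let $X$ be the continuous adapted process which obeys $$dX(t)=-f(X(t))\,dt+\sigma(t)\,dB(t),\quad t\ge 0;\qquad X(0)=\xi,$$ with $\xi\in\mathbb{R}$ deterministic. (a) Suppose $\sigma\notin L^2([0,\infty);\mathbb{R})$. Then $$\mathbb{P}\left[\lim_{t\to\infty}\frac{X(t)}{F^{-1}(t)}\text{ exists and lies in }(-\infty,\infty)\right]=0.$$ (b) Suppose $\sigma\in L^2([0,\infty);\mathbb{R})$, and that there exists $\mu\in[0,\infty]$ such that $$\mu^2=\lim_{t\to\infty}\frac{2\int_t^\infty\sigma^2(s)\,ds\,\log\log\left(\frac{1}{\int_t^\infty\sigma^2(s)\,ds}\right)}{F^{-1}(t)^2}.$$ (i) If $\mu=0$, then $$\mathbb{P}\left[\lim_{t\to\infty}\frac{X(t)}{F^{-1}(t)}\text{ exists and lies in }\{-1,0,1\}\right]=1.$$ (ii) If $\mu\in(0,\infty]$, then $$\mathbb{P}\left[\lim_{t\to\infty}\frac{X(t)}{F^{-1}(t)}\text{ exists and lies in }(-\i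nfty,\infty)\right]=0.$$
   Context: $B$ is a one-dimensional standard Brownian motion on a complete probability space $(\Omega,\mathcal{F},\mathbb{P})$, with filtration $(\mathcal{F}^B(t))_{t\ge0}$ the natural filtration generated by $B$. A function $f$ which is positive and measurable on $(0,\infty)$ is regularly varying at $0$ with index $\beta\in\mathbb{R}$, written $f\in\mathrm{RV}_0(\beta)$, if $\lim_{x\to0^+} f(\lambda x)/f(x)=\lambda^\beta$ for every $\lambda>0$ (for $f$ defined on $\mathbb{R}$ this refers to its restriction to $(0,\infty)$). Define $F(x)=\int_x^1 \frac{1}{f(u)}\,du$ for $x>0$. $F$ is strictly decreasing; since $\beta>1$, $F(x)\to\infty$ as $x\to0^+$. $F^{-1}$ denotes the inverse function of $F$; $F^{-1}(t)>0$ is defined for all $t\ge 0$ and tends to $0$ as $t\to\infty$. *)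

theory Defs
  imports "HOL-Probability.Probability"
begin

section \<open>Regular variation and the function \<open>F\<close>\<close>

definition regularly_varying_at_0 :: "(real \<Rightarrow> real) \<Rightarrow> real \<Rightarrow> bool" where
  "regularly_varying_at_0 f \<beta> \<longleftrightarrow>
     (\<forall>x>0. f x > 0) \<and>
     set_borel_measurable borel {0<..} f \<and>
     (\<forall>l>0. ((\<lambda>x. f (l * x) / f x) \<longlongrightarrow> l powr \<beta>) (at_right 0))"

text \<open>The interval integral is oriented, so the value is negative for \<open>x > 1\<close>.\<close>

definition F_of :: "(real \<Rightarrow> real) \<Rightarrow> real \<Rightarrow> real" where
  "F_of f x = (LBINT u=x..1. 1 / f u)"

text \<open>The inverse is taken on the domain \<open>{0<..}\<close>; its value is meaningful only on the range
  of \<open>F_of f\<close> restricted to that domain.\<close>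

definition F_inv :: "(real \<Rightarrow> real) \<Rightarrow> real \<Rightarrow> real" where
  "F_inv f = the_inv_into {0<..} (F_of f)"


section \<open>Brownian motion\<close>

text \<open>Processes indexed by \<open>[0, \<infinity>)\<close> are functions on all of \<^typ>\<open>real\<close> of which only the
  values at nonnegative times matter.\<close>

definition natural_filtration :: "'a measure \<Rightarrow> (real \<Rightarrow> 'a \<Rightarrow> real) \<Rightarrow> real \<Rightarrow> 'a measure" where
  "natural_filtration M B t =
     sigma (space M) (\<Union>s\<in>{0..t}. {B s -` A \<inter> space M | A. A \<in> sets borel})"

text \<open>Adding the null sets makes it possible to choose adapted versions of stochastic integrals;
  a process adapted to the natural filtration is adapted to the completed one.\<close>

definition completed_natural_filtration ::
    "'a measure \<Rightarrow> (real \<Rightarrow> 'a \<Rightarrow> real) \<Rightarrow> real \<Rightarrow> 'a measure" where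
  "completed_natural_filtration M B t =
     sigma (space M) (sets (natural_filtration M B t) \<union> null_sets M)"

definition as_continuous :: "'a measure \<Rightarrow> (real \<Rightarrow> 'a \<Rightarrow> real) \<Rightarrow> bool" where
  "as_continuous M X \<longleftrightarrow> (AE \<omega> in M. continuous_on {0..} (\<lambda>t. X t \<omega>))"

definition standard_brownian_motion :: "'a measure \<Rightarrow> (real \<Rightarrow> 'a \<Rightarrow> real) \<Rightarrow> bool" where
  "standard_brownian_motion M B \<longleftrightarrow>
     (\<forall>t\<ge>0. B t \<in> borel_measurable M) \<and>
     (AE \<omega> in M. B 0 \<omega> = 0) \<and>
     as_continuous M B \<and>
     (\<forall>s t. 0 \<le> s \<and> s < t \<longrightarrow>
        distributed M lborel (\<lambda>\<omega>. B t \<omega> - B s \<omega>) (normal_density 0 (sqrt (t - s))) \<and>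
        prob_space.indep_set M (sets (natural_filtration M B s))
          {(\<lambda>\<omega>. B t \<omega> - B s \<omega>) -` A \<inter> space M | A. A \<in> sets borel})"


section \<open>Stochastic integrals of deterministic integrands\<close>

text \<open>A step function on \<open>[0, t]\<close> with values \<open>c i\<close> on \<open>(p i, p (i + 1)]\<close> for \<open>i < n\<close>.\<close>

definition partition_of :: "real \<Rightarrow> nat \<Rightarrow> (nat \<Rightarrow> real) \<Rightarrow> bool" where
  "partition_of t n p \<longleftrightarrow> 0 \<le> p 0 \<and> p n \<le> t \<and> (\<forall>i<n. p i \<le> p (Suc i))"

definition step_fun :: "nat \<Rightarrow> (nat \<Rightarrow> real) \<Rightarrow> (nat \<Rightarrow> real) \<Rightarrow> real \<Rightarrow> real" where
  "step_fun n p c s = (\<Sum>i<n. c i * indicator {p i<..p (Suc i)} s)"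

definition step_integral ::
    "(real \<Rightarrow> 'a \<Rightarrow> real) \<Rightarrow> nat \<Rightarrow> (nat \<Rightarrow> real) \<Rightarrow> (nat \<Rightarrow> real) \<Rightarrow> 'a \<Rightarrow> real" where
  "step_integral B n p c \<omega> = (\<Sum>i<n. c i * (B (p (Suc i)) \<omega> - B (p i) \<omega>))"

text \<open>\<open>Y\<close> is a version of \<open>\<integral>\<^sub>0\<^sup>t \<sigma>(s) dB(s)\<close>: the integrals of step functions that converge to \<open>\<sigma>\<close>
  in \<open>L\<^sup>2[0, t]\<close> converge to \<open>Y\<close> in \<open>L\<^sup>2\<close> of the probability space.  By the Ito isometry this
  determines \<open>Y\<close> up to almost sure equality, whatever approximating sequence is used.\<close>

definition has_stochastic_integral ::
    "'a measure \<Rightarrow> (real \<Rightarrow> 'a \<Rightarrow> real) \<Rightarrow> (real \<Rightarrow> real) \<Rightarrow> real \<Rightarrow> ('a \<Rightarrow> real) \<Rightarrow> bool" where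
  "has_stochastic_integral M B \<sigma> t Y \<longleftrightarrow>
     Y \<in> borel_measurable M \<and>
     (\<exists>(n :: nat \<Rightarrow> nat) (p :: nat \<Rightarrow> nat \<Rightarrow> real) (c :: nat \<Rightarrow> nat \<Rightarrow> real).
        (\<forall>k. partition_of t (n k) (p k)) \<and>
        ((\<lambda>k. \<integral>\<^sup>+s\<in>{0..t}. ennreal ((step_fun (n k) (p k) (c k) s - \<sigma> s)\<^sup>2) \<partial>lborel)
           \<longlonglongrightarrow> 0) \<and>
        ((\<lambda>k. \<integral>\<^sup>+\<omega>. ennreal ((step_integral B (n k) (p k) (c k) \<omega> - Y \<omega>)\<^sup>2) \<partial>M)
           \<longlonglongrightarrow> 0))"

definition stochastic_integral_process ::
    "'a measure \<Rightarrow> (real \<Rightarrow> 'a \<Rightarrow> real) \<Rightarrow> (real \<Rightarrow> real) \<Rightarrow> (real \<Rightarrow> 'a \<Rightarrow> real) \<Rightarrow> bool" where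
  "stochastic_integral_process M B \<sigma> Y \<longleftrightarrow>
     (\<forall>t\<ge>0. has_stochastic_integral M B \<sigma> t (Y t)) \<and> as_continuous M Y"


section \<open>The stochastic differential equation\<close>

text \<open>Continuous adapted solutions of \<open>dX(t) = -f(X(t)) dt + \<sigma>(t) dB(t)\<close>, \<open>X(0) = \<xi>\<close>,
  in integrated form.\<close>

definition sde_solution ::
    "'a measure \<Rightarrow> (real \<Rightarrow> 'a \<Rightarrow> real) \<Rightarrow> (real \<Rightarrow> real) \<Rightarrow> (real \<Rightarrow> real) \<Rightarrow> real \<Rightarrow>
     (real \<Rightarrow> 'a \<Rightarrow> real) \<Rightarrow> bool" where
  "sde_solution M B f \<sigma> \<xi> X \<longleftrightarrow>
     (\<forall>t\<ge>0. X t \<in> borel_measurable (completed_natural_filtration M B t)) \<and>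
     as_continuous M X \<and>
     (\<exists>Y. stochastic_integral_process M B \<sigma> Y \<and>
        (AE \<omega> in M. \<forall>t\<ge>0. X t \<omega> = \<xi> - (LBINT s:{0..t}. f (X s \<omega>)) + Y t \<omega>))"


section \<open>Asymptotic events\<close>

definition limit_in :: "'a measure \<Rightarrow> (real \<Rightarrow> 'a \<Rightarrow> real) \<Rightarrow> (real \<Rightarrow> real) \<Rightarrow> real set \<Rightarrow> 'a set"
  where
  "limit_in M X g S = {\<omega> \<in> space M. \<exists>L\<in>S. ((\<lambda>t. X t \<omega> / g t) \<longlongrightarrow> L) at_top}"

text \<open>\<open>\<integral>\<^sub>t\<^sup>\<infinity> \<sigma>\<^sup>2(s) ds\<close> for square integrable \<open>\<sigma>\<close>.\<close>

definition tail_var :: "(real \<Rightarrow> real) \<Rightarrow> real \<Rightarrow> real" where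
  "tail_var \<sigma> t = (LBINT s:{t..}. (\<sigma> s)\<^sup>2)"

end

theory Submission
  imports Defs
begin

text \<open>
  Let \<open>Y(t) = \<integral>\<^sub>0\<^sup>t \<sigma> dB\<close> be the noise, \<open>Q(t) = \<integral>\<^sub>0\<^sup>t f(X(s)) ds\<close> the accumulated drift, and
  \<open>G = F\<^sup>-\<^sup>1\<close>, the positive solution of \<open>G' = -f(G)\<close>.  Along almost every path \<open>X = \<xi> - Q + Y\<close>, and
  whether \<open>X/G\<close> converges depends only on how \<open>Y\<close> oscillates on the scale of \<open>G\<close>.

  Suppose first that \<open>X/G\<close> has a finite limit \<open>L\<close>.  By regular variation \<open>f(X)/f(G)\<close> converges, to \<open>l\<close>
  say, and since \<open>f(G) = -G'\<close> the increments of \<open>Q\<close> are \<open>l\<close> times those of \<open>-G\<close> up to \<open>o(G)\<close>.  Hence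
  \<open>Y(s) - Y(t) = (l - L) (G(t) - G(s)) + o(G(t))\<close> uniformly in \<open>s \<ge> t\<close> (\<open>noise_increments\<close>).  Two things
  follow: \<open>Y\<close> is bounded, and on the scale of \<open>G\<close> the late increments of \<open>Y\<close> all have, up to \<open>o(G)\<close>,
  the sign of \<open>l - L\<close>.  When \<open>\<sigma>\<close> is not square integrable the Gaussian process \<open>Y\<close> is almost surely
  unbounded, which proves (a).  When \<open>\<sigma>\<close> is square integrable and \<open>\<mu> > 0\<close>, consider times
  \<open>\<tau> n\<close> at which the remaining variance is \<open>c/2^n\<close>.  The increments of \<open>Y\<close> between these times are
  independent centred Gaussians, and the divergence half of the Borel-Cantelli lemma makes them
  exceed, with either sign and infinitely often, a multiple of the normalising function of the law
  of the iterated logarithm, which is at least a multiple of \<open>G(\<tau> n)\<close>.  This contradicts the constant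
  sign and proves (b)(ii).

  For \<open>\<mu> = 0\<close> the convergence half of the Borel-Cantelli lemma, with Levy's maximal inequality, bounds
  the oscillation of \<open>Y\<close> on each \<open>[\<tau> n, \<tau> (n+1)]\<close> by the same function.  The bounds decay geometrically,
  so \<open>Y\<close> converges and the remainder \<open>R = Y(\<infinity>) - Y\<close> is \<open>o(G)\<close>.  Now \<open>z = X + R\<close> solves the random
  ordinary differential equation \<open>z' = -f(z - R)\<close>, and \<open>w = z/G\<close> satisfies
  \<open>w' = (f(G)/G) (w - f(X)/f(G))\<close>, where \<open>f(X)/f(G)\<close> is close to \<open>\<bar>w\<bar>^\<beta> sgn w\<close>.  In the clock
  \<open>-ln G\<close>, which runs to infinity, this is a small perturbation of \<open>w' = w - \<bar>w\<bar>^\<beta> sgn w\<close>.  Since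
  \<open>\<beta> > 1\<close>, the equilibria \<open>1\<close> and \<open>-1\<close> attract and \<open>0\<close> repels; so \<open>w\<close> tends to \<open>1\<close> or \<open>-1\<close> as soon as it
  stays away from \<open>0\<close> at arbitrarily late times, and to \<open>0\<close> otherwise
  (\<open>perturbed_solution_trichotomy\<close>).  This is (b)(i).

  Two tools carry this out.  The uniform convergence theorem for regularly varying functions is
  obtained from the Baire category theorem, as \<open>f\<close> is continuous.  The Gaussian structure of \<open>Y\<close> is
  read off from characteristic functions: for \<open>A\<close> in the completed filtration at time \<open>s\<close>, the
  expectation of \<open>exp (i u (Y(t) - Y(s)))\<close> over \<open>A\<close> is \<open>exp (- u\<^sup>2 v / 2) P(A)\<close> with
  \<open>v = \<integral>\<^sub>s\<^sup>t \<sigma>\<^sup>2\<close>.  By uniqueness of characteristic functions this one identity gives both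
  the law of the increment and its independence of the past.
\<close>

section \<open>Regular variation\<close>

text \<open>The additive form of the uniform convergence theorem.  For fixed \<open>\<epsilon>\<close> the closed sets of all \<open>l\<close> for
which the estimate holds from \<open>x = n\<close> on cover the line, so by Baire one of them contains an interval.
Subtracting the estimate at the centre of that interval turns it into a uniform estimate on an interval
\<open>[0, r]\<close>, and finitely many translates of \<open>[0, r]\<close> cover \<open>[0, K]\<close>.\<close>

lemma uniform_convergence_of_translates:
  fixes g :: "real \<Rightarrow> real"
  assumes cont: "continuous_on UNIV g"
    and lim: "\<And>l. ((\<lambda>x. g (x + l) - g x) \<longlongrightarrow> \<rho> * l) at_top"
    and "\<epsilon> > 0"
  shows "\<exists>N. \<forall>x\<ge>N. \<forall>l\<in>{0..K}. \<bar>g (x + l) - g x - \<rho> * l\<bar> \<le> \<epsilon>"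
proof -
  define E where "E n e = {l. \<forall>x\<ge>real n. \<bar>g (x + l) - g x - \<rho> * l\<bar> \<le> e}" for n e
  have closed_E: "closed (E n e)" for n e
  proof -
    have "E n e = (\<Inter>x\<in>{real n..}. {l. \<bar>g (x + l) - g x - \<rho> * l\<bar> \<le> e})"
      by (auto simp: E_def)
    moreover have "closed {l. \<bar>g (x + l) - g x - \<rho> * l\<bar> \<le> e}" for x
      by (intro closed_Collect_le continuous_intros continuous_on_compose2[OF cont]) auto
    ultimately show ?thesis by auto
  qed
  have cover: "\<exists>n. l \<in> E n e" if "e > 0" for l e
  proof -
    have "\<forall>\<^sub>F x in at_top. dist (g (x + l) - g x) (\<rho> * l) < e"
      using lim[of l] that by (auto simp: tendsto_iff)
    then obtain N where N: "\<And>x. x \<ge> N \<Longrightarrow> dist (g (x + l) - g x) (\<rho> * l) < e"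
      by (auto simp: eventually_at_top_linorder)
    obtain n :: nat where "real n \<ge> N" using real_arch_simple by blast
    then have "\<bar>g (x + l) - g x - \<rho> * l\<bar> \<le> e" if "x \<ge> real n" for x
      using N[of x] that by (simp add: dist_real_def)
    then have "l \<in> E n e" by (simp add: E_def)
    then show ?thesis ..
  qed
  have "\<exists>n. interior (E n (\<epsilon>/4)) \<noteq> {}"
  proof (rule ccontr)
    assume "\<not> ?thesis"
    then have int: "interior (E n (\<epsilon>/4)) = {}" for n by auto
    have "UNIV \<subseteq> closure (\<Inter>(range (\<lambda>n. - E n (\<epsilon>/4))))"
    proof (rule Baire)
      fix T assume "T \<in> range (\<lambda>n. - E n (\<epsilon>/4))"
      then obtain n where "T = - E n (\<epsilon>/4)" by auto
      then show "openin (top_of_set UNIV) T \<and> UNIV \<subseteq> closure T"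
        using closed_E[of n "\<epsilon>/4"] int[of n] by (auto simp: closure_complement open_Compl)
    qed auto
    moreover have "\<Inter>(range (\<lambda>n. - E n (\<epsilon>/4))) = {}"
      using cover[of "\<epsilon>/4"] \<open>\<epsilon> > 0\<close> by auto
    ultimately show False by simp
  qed
  then obtain n c where "c \<in> interior (E n (\<epsilon>/4))" by auto
  then obtain r where r: "r > 0" "cball c r \<subseteq> E n (\<epsilon>/4)"
    using mem_interior_cball by blast
  have short: "\<bar>g (x + l) - g x - \<rho> * l\<bar> \<le> \<epsilon>/2" if "x \<ge> real n + c" "0 \<le> l" "l \<le> r" for x l
  proof -
    have "c + l \<in> E n (\<epsilon>/4)" "c \<in> E n (\<epsilon>/4)"
      using r that by (auto simp: dist_real_def subset_iff)
    moreover have "x - c \<ge> real n" using that by simp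
    ultimately have "\<bar>g (x - c + (c + l)) - g (x - c) - \<rho> * (c + l)\<bar> \<le> \<epsilon>/4"
      "\<bar>g (x - c + c) - g (x - c) - \<rho> * c\<bar> \<le> \<epsilon>/4"
      by (auto simp: E_def)
    then have "\<bar>g (x + l) - g (x - c) - (\<rho> * c + \<rho> * l)\<bar> \<le> \<epsilon>/4"
      "\<bar>g x - g (x - c) - \<rho> * c\<bar> \<le> \<epsilon>/4"
      by (simp_all add: distrib_left)
    then show ?thesis unfolding abs_le_iff by linarith
  qed
  obtain m :: nat where m: "real m * r \<ge> K"
    using r(1) by (metis reals_Archimedean3 less_eq_real_def mult.commute)
  have "\<exists>k. \<forall>j\<le>m. real j * r \<in> E k (\<epsilon>/2)"
  proof -
    have "\<forall>j. \<exists>k. real j * r \<in> E k (\<epsilon>/2)"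
      using cover \<open>\<epsilon> > 0\<close> by auto
    then obtain k where k: "\<And>j. real j * r \<in> E (k j) (\<epsilon>/2)" by metis
    have "real j * r \<in> E (Max (k ` {..m})) (\<epsilon>/2)" if "j \<le> m" for j
    proof -
      have "k j \<le> Max (k ` {..m})" using that by auto
      then show ?thesis using k[of j] unfolding E_def mem_Collect_eq
        by (meson of_nat_mono order_trans)
    qed
    then show ?thesis by blast
  qed
  then obtain k where k: "\<And>j. j \<le> m \<Longrightarrow> real j * r \<in> E k (\<epsilon>/2)" by blast
  have "\<bar>g (x + l) - g x - \<rho> * l\<bar> \<le> \<epsilon>"
    if x: "x \<ge> max (real k) (real n + c)" and l: "l \<in> {0..K}" for x l
  proof -
    \<comment> \<open>Split \<open>l\<close> into a multiple of \<open>r\<close>, for which finitely many pointwise estimates suffice, and a rest in \<open>[0, r]\<close>.\<close>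
    define j where "j = nat \<lfloor>l / r\<rfloor>"
    have j: "real j = of_int \<lfloor>l / r\<rfloor>" using l r by (simp add: j_def)
    have j1: "real j * r \<le> l" "l \<le> real j * r + r"
      using r(1) floor_divide_lower[of r l] floor_divide_upper[of r l]
      by (auto simp: j algebra_simps)
    have "l / r \<le> real m"
      using m l r(1) by (auto simp: field_simps)
    then have "real j \<le> real m" unfolding j by linarith
    then have "real j * r \<in> E k (\<epsilon>/2)" using k by simp
    then have 1: "\<bar>g (x + real j * r) - g x - \<rho> * (real j * r)\<bar> \<le> \<epsilon>/2"
      using x by (auto simp: E_def)
    have "x + real j * r \<ge> real n + c" using x r(1) by (smt (verit) of_nat_0_le_iff mult_nonneg_nonneg max.cobounded2)
    from short[OF this, of "l - real j * r"] j1
    have 2: "\<bar>g (x + l) - g (x + real j * r) - \<rho> * (l - real j * r)\<bar> \<le> \<epsilon>/2" by auto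
    show ?thesis using 1 2 unfolding right_diff_distrib abs_le_iff by linarith
  qed
  then show ?thesis by blast
qed

locale regularly_varying =
  fixes f :: "real \<Rightarrow> real" and \<beta> :: real
  assumes pos: "x > 0 \<Longrightarrow> f x > 0"
    and cont: "continuous_on {0<..} f"
    and rv: "l > 0 \<Longrightarrow> ((\<lambda>x. f (l * x) / f x) \<longlongrightarrow> l powr \<beta>) (at_right 0)"
    and index_gt_1: "\<beta> > 1"
begin

text \<open>The substitution \<open>g(y) = ln f(exp(-y))\<close> turns regular variation at \<open>0\<close> into convergence of translates at
infinity.  Since the additive theorem covers nonnegative shifts only, the shift by \<open>-ln l\<close> is taken
relative to the shift by \<open>-ln b\<close>.\<close>

lemma log_ratio_uniform:
  assumes "a > 0" "\<epsilon> > 0"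
  shows "\<exists>x0>0. \<forall>x\<in>{0<..x0}. \<forall>l\<in>{a..b}. \<bar>ln (f (l * x) / f x) - \<beta> * ln l\<bar> \<le> \<epsilon>"
proof (cases "a \<le> b")
  case True
  define g where "g y = ln (f (exp (- y)))" for y
  have g: "continuous_on UNIV g"
    unfolding g_def by (intro continuous_intros continuous_on_compose2[OF cont]) (use pos in \<open>auto simp: less_imp_neq[THEN not_sym]\<close>)
  have glim: "((\<lambda>x. g (x + l) - g x) \<longlongrightarrow> (- \<beta>) * l) at_top" for l
  proof -
    have "((\<lambda>x. f (exp (- l) * x) / f x) \<longlongrightarrow> exp (- l) powr \<beta>) (at_right 0)"
      by (rule rv) auto
    moreover have "filterlim (\<lambda>y. exp (- y)) (at_right 0) (at_top :: real filter)"
      by (auto simp: filterlim_at intro!: filterlim_compose[OF exp_at_bot] filterlim_uminus_at_bot_at_top)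
    ultimately have "((\<lambda>y. f (exp (- l) * exp (- y)) / f (exp (- y))) \<longlongrightarrow> exp (- l) powr \<beta>) at_top"
      by (rule filterlim_compose)
    then have "((\<lambda>y. ln (f (exp (- l) * exp (- y)) / f (exp (- y)))) \<longlongrightarrow> ln (exp (- l) powr \<beta>)) at_top"
      by (rule tendsto_ln) auto
    moreover have "ln (f (exp (- l) * exp (- y)) / f (exp (- y))) = g (y + l) - g y" for y
      using pos[of "exp (- l) * exp (- y)"] pos[of "exp (- y)"]
      by (simp add: g_def ln_div exp_add[symmetric] add.commute)
    ultimately show ?thesis by (simp add: ln_powr)
  qed
  have "\<epsilon>/2 > 0" using \<open>\<epsilon> > 0\<close> by simp
  from uniform_convergence_of_translates[OF g glim this, of "ln b - ln a"]
  obtain N where N: "\<And>y l. y \<ge> N \<Longrightarrow> l \<in> {0..ln b - ln a} \<Longrightarrow> \<bar>g (y + l) - g y - (- \<beta>) * l\<bar> \<le> \<epsilon>/2"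
    by blast
  have "\<forall>\<^sub>F x in at_top. dist (g (x + (- ln b)) - g x) ((- \<beta>) * (- ln b)) < \<epsilon>/2"
    using glim \<open>\<epsilon>/2 > 0\<close> by (auto simp only: tendsto_iff)
  then obtain N' where N': "\<And>y. y \<ge> N' \<Longrightarrow> \<bar>g (y - ln b) - g y - \<beta> * ln b\<bar> < \<epsilon>/2"
    by (auto simp: eventually_at_top_linorder dist_real_def)
  define x0 where "x0 = exp (- max (N + ln b) N')"
  have "\<bar>ln (f (l * x) / f x) - \<beta> * ln l\<bar> \<le> \<epsilon>" if x: "x \<in> {0<..x0}" and l: "l \<in> {a..b}" for x l
  proof -
    define y where "y = - ln x"
    have l0: "l > 0" using l \<open>a > 0\<close> by auto
    have "ln x \<le> ln x0" using x by auto
    then have y: "y \<ge> N + ln b" "y \<ge> N'" by (auto simp: y_def x0_def)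
    have "ln b - ln l \<in> {0..ln b - ln a}" using l l0 \<open>a > 0\<close> by auto
    from N[OF _ this, of "y - ln b"] y
    have "\<bar>g (y - ln l) - g (y - ln b) + \<beta> * (ln b - ln l)\<bar> \<le> \<epsilon>/2" by simp
    then have "\<bar>g (y - ln l) - g y - \<beta> * ln l\<bar> \<le> \<epsilon>"
      using N'[of y] y(2) unfolding right_diff_distrib by linarith
    moreover have "ln (f (l * x) / f x) = g (y - ln l) - g y"
      using pos[of "l * x"] pos[of x] x l0 by (simp add: g_def y_def ln_div exp_add)
    ultimately show ?thesis by simp
  qed
  then show ?thesis by (intro exI[of _ x0]) (auto simp: x0_def)
qed (auto intro: exI[of _ 1])

lemma ratio_uniform:
  assumes "a > 0" "\<epsilon> > 0" "\<epsilon> < 1"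
  shows "\<exists>x0>0. \<forall>x\<in>{0<..x0}. \<forall>l\<in>{a..b}.
           (1 - \<epsilon>) * l powr \<beta> * f x \<le> f (l * x) \<and> f (l * x) \<le> (1 + \<epsilon>) * l powr \<beta> * f x"
proof -
  define \<delta> where "\<delta> = min (ln (1 + \<epsilon>)) (- ln (1 - \<epsilon>))"
  have "\<delta> > 0" using assms by (auto simp: \<delta>_def)
  from log_ratio_uniform[OF \<open>a > 0\<close> this, of b] obtain x0 where "x0 > 0"
    and *: "\<And>x l. x \<in> {0<..x0} \<Longrightarrow> l \<in> {a..b} \<Longrightarrow> \<bar>ln (f (l * x) / f x) - \<beta> * ln l\<bar> \<le> \<delta>" by blast
  have "(1 - \<epsilon>) * l powr \<beta> * f x \<le> f (l * x) \<and> f (l * x) \<le> (1 + \<epsilon>) * l powr \<beta> * f x"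
    if "x \<in> {0<..x0}" "l \<in> {a..b}" for x l
  proof -
    have l0: "l > 0" "x > 0" using that assms by auto
    then have p: "f (l * x) > 0" "f x > 0" by (auto intro: pos)
    have "ln (1 - \<epsilon>) + \<beta> * ln l \<le> ln (f (l * x) / f x)" "ln (f (l * x) / f x) \<le> ln (1 + \<epsilon>) + \<beta> * ln l"
      using *[OF that] by (auto simp: \<delta>_def)
    then have "exp (ln (1 - \<epsilon>) + \<beta> * ln l) \<le> exp (ln (f (l * x) / f x))"
      "exp (ln (f (l * x) / f x)) \<le> exp (ln (1 + \<epsilon>) + \<beta> * ln l)"
      by (simp_all only: exp_le_cancel_iff)
    then show ?thesis using p l0 assms
      by (simp add: exp_add powr_def field_simps)
  qed
  then show ?thesis using \<open>x0 > 0\<close> by blast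
qed

text \<open>A Potter type bound.  For \<open>l\<close> in \<open>[a, a\<^sup>2]\<close> it is uniform convergence together with
\<open>l^(\<beta>-1) \<ge> a^(\<beta>-1) > 1\<close>; any larger \<open>l\<close> is a product of factors from that interval, and the
surplus factor \<open>1 + c\<close> can be dropped at all but one of them.\<close>

lemma superlinear_growth:
  assumes "a > 1"
  shows "\<exists>c>0. \<exists>x0>0. \<forall>x>0. \<forall>l\<ge>a. l * x \<le> x0 \<longrightarrow> f (l * x) \<ge> (1 + c) * l * f x"
proof -
  define q where "q = a powr (\<beta> - 1)"
  \<comment> \<open>The constants share the excess \<open>q - 1\<close>: half is lost to uniform convergence, half remains as \<open>c\<close>.\<close>
  have "q > 1" using assms index_gt_1 by (auto simp: q_def)
  define c where "c = (q - 1) / 2"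
  define \<epsilon> where "\<epsilon> = (q - 1) / (2 * q)"
  have \<epsilon>: "\<epsilon> > 0" "\<epsilon> < 1" and c: "c > 0" "(1 - \<epsilon>) * q = 1 + c"
    using \<open>q > 1\<close> by (auto simp: \<epsilon>_def c_def field_simps)
  obtain x0 where x0: "x0 > 0" and *: "\<And>x l. x \<in> {0<..x0} \<Longrightarrow> l \<in> {a..a\<^sup>2} \<Longrightarrow> (1 - \<epsilon>) * l powr \<beta> * f x \<le> f (l * x)"
    using ratio_uniform[of a \<epsilon> "a\<^sup>2"] assms \<epsilon> by (metis less_trans zero_less_one)
  have base: "f (l * x) \<ge> (1 + c) * l * f x" if "x \<in> {0<..x0}" "l \<in> {a..a\<^sup>2}" for x l
  proof -
    have "l > 0" using that assms by auto
    have "q \<le> l powr (\<beta> - 1)" unfolding q_def using that assms index_gt_1 by (intro powr_mono2) auto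
    then have "(1 - \<epsilon>) * (q * l) \<le> (1 - \<epsilon>) * (l powr (\<beta> - 1) * l)"
      using \<epsilon> \<open>l > 0\<close> by (intro mult_left_mono mult_right_mono) auto
    also have "l powr (\<beta> - 1) * l = l powr \<beta>" using \<open>l > 0\<close> by (simp add: powr_diff)
    finally have "(1 + c) * l \<le> (1 - \<epsilon>) * l powr \<beta>" by (simp add: c(2)[symmetric] mult.assoc)
    then have "(1 + c) * l * f x \<le> (1 - \<epsilon>) * l powr \<beta> * f x"
      using pos[of x] that by (intro mult_right_mono) auto
    also have "\<dots> \<le> f (l * x)" by (rule *[OF that])
    finally show ?thesis .
  qed
  have step: "\<forall>l x. x > 0 \<longrightarrow> a \<le> l \<longrightarrow> l \<le> a ^ (n + 2) \<longrightarrow> l * x \<le> x0 \<longrightarrow> f (l * x) \<ge> (1 + c) * l * f x" for n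
  proof (induction n)
    case 0
    show ?case
    proof safe
      fix l x :: real assume H: "x > 0" "a \<le> l" "l \<le> a ^ (0 + 2)" "l * x \<le> x0"
      have "1 * x \<le> l * x" using H assms by (intro mult_right_mono) auto
      then have "x \<in> {0<..x0}" using H(1,4) unfolding greaterThanAtMost_iff by linarith
      moreover have "l \<in> {a..a\<^sup>2}" using H by (auto simp: power2_eq_square)
      ultimately show "f (l * x) \<ge> (1 + c) * l * f x" by (rule base)
    qed
  next
    case (Suc n)
    show ?case
    proof safe
      fix l x :: real assume H: "x > 0" "a \<le> l" "l \<le> a ^ (Suc n + 2)" "l * x \<le> x0"
      show "f (l * x) \<ge> (1 + c) * l * f x"
      proof (cases "l \<le> a\<^sup>2")
        case True
        have "1 * x \<le> l * x" using H assms by (intro mult_right_mono) auto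
        then have "x \<in> {0<..x0}" using H(1,4) unfolding greaterThanAtMost_iff by linarith
        then show ?thesis using H True by (intro base) auto
      next
        case False
        define m where "m = l / a"
        have m: "l = a * m" "m \<ge> a" "m \<le> a ^ (n + 2)" "m > 0" "m * x > 0"
          using False H assms by (auto simp: m_def field_simps power2_eq_square)
        have mx: "m * x \<le> x0"
        proof -
          have "1 * (m * x) \<le> a * (m * x)" using assms m by (intro mult_right_mono) auto
          also have "a * (m * x) \<le> x0" using H(4) by (simp add: m(1) mult.assoc)
          finally show ?thesis by simp
        qed
        have "a \<le> a\<^sup>2" using assms by (simp add: power2_eq_square)
        then have "f (a * (m * x)) \<ge> (1 + c) * a * f (m * x)" using m mx by (intro base) auto
        moreover have "f (m * x) \<ge> (1 + c) * m * f x" using Suc.IH m mx H by blast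
        then have "(1 + c) * a * f (m * x) \<ge> (1 + c) * a * ((1 + c) * m * f x)"
          using c assms by (intro mult_left_mono) auto
        moreover have "(1 + c) * a * ((1 + c) * m * f x) \<ge> 1 * ((1 + c) * l * f x)"
        proof -
          have "1 * ((1 + c) * l * f x) \<le> (1 + c) * ((1 + c) * l * f x)"
            using c m H pos[of x] assms by (intro mult_right_mono) auto
          then show ?thesis by (simp add: m mult_ac)
        qed
        ultimately show ?thesis by (simp add: m(1) mult.assoc)
      qed
    qed
  qed
  have "f (l * x) \<ge> (1 + c) * l * f x" if H: "x > 0" "l \<ge> a" "l * x \<le> x0" for x l
  proof -
    obtain n where "l < a ^ n" using real_arch_pow[OF assms] by blast
    also have "a ^ n \<le> a ^ (n + 2)" using assms by (intro power_increasing) auto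
    finally show ?thesis using step[of n] H by auto
  qed
  then show ?thesis using c(1) x0 by blast
qed

end

section \<open>Scalar equations with a drift towards a level\<close>

text \<open>\<open>A\<close> is a clock that runs to infinity, and in the strip between \<open>c1\<close> and \<open>c2\<close> the function \<open>\<phi>\<close> grows at
least at rate \<open>\<kappa>\<close> in that clock.  So no level in the strip can be crossed downwards, and the strip is left
in finite time, necessarily through \<open>c2\<close>.\<close>

lemma drift_reaches_level:
  fixes \<phi> A :: "real \<Rightarrow> real"
  assumes d\<phi>: "\<And>t. t \<ge> T \<Longrightarrow> (\<phi> has_real_derivative \<phi>' t) (at t)"
    and dA: "\<And>t. t \<ge> T \<Longrightarrow> (A has_real_derivative A' t) (at t)"
    and A'0: "\<And>t. t \<ge> T \<Longrightarrow> A' t \<ge> 0"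
    and drift: "\<And>t. t \<ge> T \<Longrightarrow> c1 \<le> \<phi> t \<Longrightarrow> \<phi> t \<le> c2 \<Longrightarrow> \<phi>' t \<ge> \<kappa> * A' t"
    and A: "filterlim A at_top at_top"
    and "\<kappa> > 0" "c1 < c2" "t0 \<ge> T" "\<phi> t0 > c1"
  shows "\<forall>\<^sub>F t in at_top. \<phi> t \<ge> c2"
proof -
  have cont: "isCont \<phi> t" if "t \<ge> T" for t using DERIV_isCont[OF d\<phi>[OF that]] .
  have barrier: "\<phi> t \<ge> c" if "c1 < c" "c \<le> c2" "s \<ge> T" "\<phi> s \<ge> c" "t \<ge> s" for s t c
  proof (rule ccontr)
    assume "\<not> \<phi> t \<ge> c"
    define S where "S = {u \<in> {s..t}. \<phi> u \<ge> c}"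
    have cts: "continuous_on {s..t} \<phi>"
      using cont that by (auto intro!: continuous_at_imp_continuous_on)
    have "S = {s..t} \<inter> \<phi> -` {c..}" by (auto simp: S_def)
    then have "closed S" using continuous_closed_preimage[OF cts, of "{c..}"] by simp
    moreover have "S \<noteq> {}" "bdd_above S" using that by (auto simp: S_def intro!: bdd_aboveI[of _ t])
    ultimately have "Sup S \<in> S" by (intro closed_contains_Sup)
    \<comment> \<open>The last time before \<open>t\<close> at which the level is still attained.\<close>
    define m where "m = Sup S"
    have m: "s \<le> m" "m < t" "\<phi> m \<ge> c"
      using \<open>Sup S \<in> S\<close> \<open>\<not> \<phi> t \<ge> c\<close> by (auto simp: S_def m_def order_less_le)
    have above: "\<phi> u < c" if "m < u" "u \<le> t" for u
    proof (rule ccontr)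
      assume "\<not> \<phi> u < c"
      then have "u \<in> S" using m that by (auto simp: S_def)
      then have "u \<le> m" unfolding m_def by (intro cSup_upper \<open>bdd_above S\<close>)
      with that show False by simp
    qed
    have "m \<ge> T" using m that by simp
    then have "(\<phi> \<longlongrightarrow> \<phi> m) (at m)" using cont isCont_def by blast
    then have "\<forall>\<^sub>F u in at m. \<phi> u > c1"
      using m that by (intro order_tendstoD(1)[of \<phi> "\<phi> m"]) auto
    then obtain d where d: "d > 0" "\<And>u. u \<noteq> m \<Longrightarrow> dist u m < d \<Longrightarrow> \<phi> u > c1"
      by (auto simp: eventually_at)
    define u where "u = min t (m + d / 2)"
    have u: "m < u" "u \<le> t" "u < m + d" using m d by (auto simp: u_def)
    obtain x where x: "m < x" "x < u" "\<phi> u - \<phi> m = (u - m) * \<phi>' x"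
      using MVT2[OF u(1), of \<phi> \<phi>'] d\<phi> \<open>m \<ge> T\<close> by fastforce
    have "c1 \<le> \<phi> x" using d(2)[of x] x u by (auto simp: dist_real_def)
    moreover have "\<phi> x \<le> c2" using above[of x] x u that by auto
    moreover have "x \<ge> T" using x \<open>m \<ge> T\<close> by simp
    ultimately have "\<phi>' x \<ge> 0" using drift[of x] A'0[of x] \<open>\<kappa> > 0\<close>
      by (meson mult_nonneg_nonneg less_imp_le order_trans)
    then have "\<phi> u - \<phi> m \<ge> 0" using x u by simp
    then show False using above[of u] u m by auto
  qed
  \<comment> \<open>Otherwise \<open>\<phi> - \<kappa> A\<close> would be nondecreasing while \<open>\<phi>\<close> is bounded and \<open>A\<close> is not.\<close>
  have "\<exists>t1\<ge>t0. \<phi> t1 \<ge> c2"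
  proof (rule ccontr)
    assume "\<not> ?thesis"
    then have less: "\<phi> t < c2" if "t \<ge> t0" for t using that by force
    have ge: "\<phi> t \<ge> c1" if "t \<ge> t0" for t
      using barrier[of "min (\<phi> t0) c2" t0 t] assms that by auto
    have "\<phi> t0 - \<kappa> * A t0 \<le> \<phi> t - \<kappa> * A t" if "t \<ge> t0" for t
    proof (rule DERIV_nonneg_imp_nondecreasing[OF that])
      fix x assume "t0 \<le> x" "x \<le> t"
      then have "x \<ge> T" using assms by simp
      then have "((\<lambda>x. \<phi> x - \<kappa> * A x) has_real_derivative \<phi>' x - \<kappa> * A' x) (at x)"
        by (intro derivative_intros d\<phi> dA DERIV_cmult)
      moreover have "\<phi>' x - \<kappa> * A' x \<ge> 0"
        using drift[OF \<open>x \<ge> T\<close>] ge[OF \<open>t0 \<le> x\<close>] less[OF \<open>t0 \<le> x\<close>] by auto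
      ultimately show "\<exists>y. ((\<lambda>x. \<phi> x - \<kappa> * A x) has_real_derivative y) (at x) \<and> 0 \<le> y" by blast
    qed
    then have *: "\<kappa> * (A t - A t0) \<le> c2 - \<phi> t0" if "t \<ge> t0" for t
      using that less[OF that] by (simp add: algebra_simps) (smt (verit))
    obtain t where "t \<ge> t0" "A t > A t0 + (c2 - \<phi> t0) / \<kappa>"
      using A[unfolded filterlim_at_top_dense, rule_format, of "A t0 + (c2 - \<phi> t0) / \<kappa>"]
      by (auto simp: eventually_at_top_linorder) (meson linorder_linear order_refl order_trans)
    then show False using *[of t] \<open>\<kappa> > 0\<close> by (simp add: field_simps)
  qed
  then obtain t1 where "t1 \<ge> t0" "\<phi> t1 \<ge> c2" by blast
  then show ?thesis
    using barrier[of c2 t1] assms by (auto simp: eventually_at_top_linorder intro!: exI[of _ t1])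
qed

text \<open>Once \<open>\<bar>R\<bar> < \<epsilon>/2\<close>, a solution above \<open>\<epsilon>\<close> decreases, at a speed that is bounded below because
\<open>h\<close> is positive on the compact range of \<open>z - R\<close>.\<close>

lemma perturbed_solution_eventually_le:
  fixes h z R :: "real \<Rightarrow> real"
  assumes h: "continuous_on UNIV h" "\<And>x. x > 0 \<Longrightarrow> h x > 0"
    and z: "\<And>t. t > 0 \<Longrightarrow> (z has_real_derivative - h (z t - R t)) (at t)"
    and R: "(R \<longlongrightarrow> 0) at_top" and "\<epsilon> > 0"
  shows "\<forall>\<^sub>F t in at_top. z t \<le> \<epsilon>"
proof -
  have "\<forall>\<^sub>F t in at_top. \<bar>R t\<bar> < \<epsilon>/2"
    using R \<open>\<epsilon> > 0\<close> by (auto simp: tendsto_iff dist_real_def dest: spec[of _ "\<epsilon>/2"])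
  then obtain T0 where T0: "\<And>t. t \<ge> T0 \<Longrightarrow> \<bar>R t\<bar> < \<epsilon>/2"
    by (auto simp: eventually_at_top_linorder)
  define T where "T = max T0 1"
  define K where "K = max (z T) \<epsilon> + 1"
  have "compact {\<epsilon>/2..K + \<epsilon>/2}" "{\<epsilon>/2..K + \<epsilon>/2} \<noteq> {}" using \<open>\<epsilon> > 0\<close> by (auto simp: K_def)
  from continuous_attains_inf[OF this continuous_on_subset[OF h(1)]]
  obtain m where m: "m \<in> {\<epsilon>/2..K + \<epsilon>/2}" "\<And>x. x \<in> {\<epsilon>/2..K + \<epsilon>/2} \<Longrightarrow> h m \<le> h x" by auto
  have "\<forall>\<^sub>F t in at_top. - z t \<ge> - \<epsilon>"
  proof (rule drift_reaches_level[where T=T and \<phi>'="\<lambda>t. h (z t - R t)" and A="\<lambda>t. t" and A'="\<lambda>_. 1"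
        and \<kappa>="h m" and ?c1.0="- K" and ?t0.0=T])
    fix t assume "t \<ge> T"
    then show "((\<lambda>t. - z t) has_real_derivative h (z t - R t)) (at t)"
      using DERIV_minus[OF z[of t]] by (simp add: T_def)
    assume "- K \<le> - z t" "- z t \<le> - \<epsilon>"
    then show "h m * 1 \<le> h (z t - R t)"
      using T0[of t] \<open>t \<ge> T\<close> by (simp, intro m(2)) (auto simp: T_def)
  next
    show "h m > 0" using m \<open>\<epsilon> > 0\<close> by (intro h) auto
  qed (auto simp: K_def filterlim_ident)
  then show ?thesis by simp
qed

context regularly_varying
begin

lemma asymp_bounds:
  assumes "((\<lambda>x. h x / f x) \<longlongrightarrow> 1) (at_right 0)" "\<eta> > 0"
  shows "\<exists>x1>0. \<forall>x\<in>{0<..x1}. (1 - \<eta>) * f x \<le> h x \<and> h x \<le> (1 + \<eta>) * f x"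
proof -
  have "\<forall>\<^sub>F x in at_right 0. dist (h x / f x) 1 < \<eta>"
    using assms by (auto simp: tendsto_iff)
  then obtain b where b: "b > 0" "\<And>x. 0 < x \<Longrightarrow> x < b \<Longrightarrow> \<bar>h x / f x - 1\<bar> < \<eta>"
    by (auto simp: eventually_at_right_field dist_real_def)
  have "(1 - \<eta>) * f x \<le> h x \<and> h x \<le> (1 + \<eta>) * f x" if "x \<in> {0<..b/2}" for x
  proof -
    have "1 - \<eta> < h x / f x" "h x / f x < 1 + \<eta>" using b(2)[of x] that b(1) by (auto simp: abs_if split: if_splits)
    then show ?thesis using pos[of x] that by (auto simp: field_simps)
  qed
  then show ?thesis using b(1) by (intro exI[of _ "b/2"]) auto
qed

text \<open>Here \<open>x\<close> stands for \<open>G\<close>, \<open>w\<close> for the ratio \<open>z/G\<close> and \<open>r\<close> for \<open>R/G\<close>.  The limiting statement is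
\<open>w\<^sup>\<beta> < w\<close> for \<open>0 < w < 1\<close>.  The function \<open>h\<close> is \<open>f\<close> for positive solutions and \<open>\<lambda>x. - f (- x)\<close> for
negative ones.\<close>

lemma slower_below_equilibrium:
  assumes h: "((\<lambda>x. h x / f x) \<longlongrightarrow> 1) (at_right 0)" and "\<delta> > 0" "\<epsilon> > 0" "\<epsilon> < 1"
  shows "\<exists>\<kappa>>0. \<exists>x0>0. \<exists>\<rho>>0. \<forall>x\<in>{0<..x0}. \<forall>w\<in>{\<delta>..1 - \<epsilon>}. \<forall>r\<in>{-\<rho>..\<rho>}.
           h (x * (w - r)) \<le> (w - \<kappa>) * f x"
proof -
  define q0 where "q0 = (1 - \<epsilon>/2) powr (\<beta> - 1)"
  have q0: "q0 < 1" "q0 \<ge> 0"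
    using powr_less_mono2[of "\<beta> - 1" "1 - \<epsilon>/2" 1] assms index_gt_1 by (auto simp: q0_def)
  \<comment> \<open>The slope \<open>q0 < 1\<close> is relaxed to \<open>q < 1\<close>, which leaves room for two relative errors \<open>\<eta>\<close> and a shift \<open>\<rho>\<close> of \<open>w\<close>.\<close>
  define q where "q = (1 + q0) / 2"
  define \<eta> where "\<eta> = (1 - q0) / 6"
  have \<eta>: "\<eta> > 0" "\<eta> < 1" and q: "q < 1" "q > 0" using q0 by (auto simp: \<eta>_def q_def)
  have "(1 + \<eta>) * (1 + \<eta>) \<le> 1 + 3 * \<eta>" using \<eta> by (simp add: algebra_simps)
  then have "(1 + \<eta>) * (1 + \<eta>) * q0 \<le> (1 + 3 * \<eta>) * q0" using q0 by (intro mult_right_mono) auto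
  also have "\<dots> = q0 + 3 * \<eta> * q0" by (simp add: algebra_simps)
  also have "\<dots> \<le> q0 + 3 * \<eta> * 1" using q0 \<eta> by (intro add_left_mono mult_left_mono) auto
  also have "\<dots> = q" by (simp add: \<eta>_def q_def field_simps)
  finally have qq: "(1 + \<eta>) * (1 + \<eta>) * q0 \<le> q" .
  define \<kappa> where "\<kappa> = (1 - q) * \<delta> / 2"
  define \<rho> where "\<rho> = Min {\<delta>/2, \<epsilon>/2, \<kappa>}"
  have \<kappa>: "\<kappa> > 0" using q \<open>\<delta> > 0\<close> by (simp add: \<kappa>_def)
  then have \<rho>: "\<rho> > 0" "\<rho> \<le> \<delta>/2" "\<rho> \<le> \<epsilon>/2" "\<rho> \<le> \<kappa>" using assms by (auto simp: \<rho>_def)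
  obtain x1 where x1: "x1 > 0" "\<And>x. x \<in> {0<..x1} \<Longrightarrow> h x \<le> (1 + \<eta>) * f x"
    using asymp_bounds[OF h \<eta>(1)] by blast
  obtain x2 where x2: "x2 > 0"
    "\<And>x l. x \<in> {0<..x2} \<Longrightarrow> l \<in> {\<delta>/2..1 - \<epsilon>/2} \<Longrightarrow> f (l * x) \<le> (1 + \<eta>) * l powr \<beta> * f x"
    using ratio_uniform[of "\<delta>/2" \<eta> "1 - \<epsilon>/2"] \<eta> \<open>\<delta> > 0\<close> by (metis half_gt_zero)
  have "h (x * (w - r)) \<le> (w - \<kappa>) * f x"
    if "x \<in> {0<..min x1 x2}" "w \<in> {\<delta>..1 - \<epsilon>}" "r \<in> {-\<rho>..\<rho>}" for x w r
  proof -
    define y where "y = w - r"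
    have y: "\<delta>/2 \<le> y" "y \<le> 1 - \<epsilon>/2" "y \<le> w + \<rho>" "0 < y" "0 < x"
      using that \<rho> \<open>\<delta> > 0\<close> by (auto simp: y_def)
    have fx: "f x > 0" using pos y by auto
    have "y * x \<le> 1 * x" using y assms by (intro mult_right_mono) auto
    then have "y * x \<le> x1" using that(1) by (simp only: greaterThanAtMost_iff min.bounded_iff) linarith
    then have yx: "y * x \<in> {0<..x1}" using y by simp
    have "y powr \<beta> = y powr (\<beta> - 1) * y" using y by (simp add: powr_diff)
    also have "\<dots> \<le> q0 * y" unfolding q0_def using y index_gt_1 by (intro mult_right_mono powr_mono2) auto
    finally have yb: "y powr \<beta> \<le> q0 * y" .
    have "h (y * x) \<le> (1 + \<eta>) * f (y * x)" by (rule x1(2)[OF yx])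
    also have "\<dots> \<le> (1 + \<eta>) * ((1 + \<eta>) * y powr \<beta> * f x)"
      using that y \<eta> by (intro mult_left_mono x2(2)) auto
    also have "\<dots> \<le> (1 + \<eta>) * ((1 + \<eta>) * (q0 * y) * f x)"
      using yb fx \<eta> by (intro mult_left_mono mult_right_mono) auto
    also have "\<dots> = ((1 + \<eta>) * (1 + \<eta>) * q0) * (y * f x)" by (simp add: mult_ac)
    also have "\<dots> \<le> q * (y * f x)" using qq y fx by (intro mult_right_mono) auto
    also have "\<dots> \<le> q * ((w + \<rho>) * f x)" using q y fx by (intro mult_left_mono mult_right_mono) auto
    also have "\<dots> = (q * (w + \<rho>)) * f x" by simp
    also have "\<dots> \<le> (w - \<kappa>) * f x"
    proof (rule mult_right_mono)
      have "q * (w + \<rho>) \<le> q * w + \<rho>" using q \<rho> by (simp add: distrib_left)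
      moreover have "(1 - q) * \<delta> \<le> (1 - q) * w" using that q by (intro mult_left_mono) auto
      then have "q * w \<le> w - 2 * \<kappa>" by (simp add: \<kappa>_def field_simps)
      ultimately show "q * (w + \<rho>) \<le> w - \<kappa>" using \<rho> by simp
    qed (use fx in auto)
    finally show ?thesis by (simp add: y_def mult.commute)
  qed
  then show ?thesis using \<kappa> \<rho>(1) x1(1) x2(1)
    by (intro exI[of _ \<kappa>] exI[of _ "min x1 x2"] exI[of _ \<rho>] conjI) (simp_all del: greaterThanAtMost_iff)
qed

text \<open>The counterpart for \<open>w\<close> above \<open>1\<close>.  As \<open>w\<close> ranges over an unbounded set, uniform convergence on compact
sets is not enough and the global growth bound is used; it requires only that \<open>x (w - r)\<close>, and not \<open>w\<close>,
be small.\<close>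

lemma faster_above_equilibrium:
  assumes h: "((\<lambda>x. h x / f x) \<longlongrightarrow> 1) (at_right 0)" and "\<epsilon> > 0"
  shows "\<exists>\<kappa>>0. \<exists>x0>0. \<exists>\<rho>>0. \<forall>x>0. \<forall>w\<ge>1 + \<epsilon>. \<forall>r\<in>{-\<rho>..\<rho>}. x * (w - r) \<le> x0 \<longrightarrow>
           h (x * (w - r)) \<ge> (w + \<kappa>) * f x"
proof -
  obtain c x1 where c: "c > 0" and x1: "x1 > 0"
    and growth: "\<And>x l. x > 0 \<Longrightarrow> l \<ge> 1 + \<epsilon>/2 \<Longrightarrow> l * x \<le> x1 \<Longrightarrow> f (l * x) \<ge> (1 + c) * l * f x"
    using superlinear_growth[of "1 + \<epsilon>/2"] \<open>\<epsilon> > 0\<close> by auto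
  define \<eta> where "\<eta> = c / (2 * (1 + c))"
  have \<eta>: "\<eta> > 0" "\<eta> < 1" "(1 - \<eta>) * (1 + c) = 1 + c/2" using c by (auto simp: \<eta>_def field_simps)
  define \<rho> where "\<rho> = min (\<epsilon>/2) (c / (4 + 2 * c))"
  have \<rho>: "\<rho> > 0" "\<rho> \<le> \<epsilon>/2" "(1 + c/2) * \<rho> \<le> c/4"
  proof -
    show "\<rho> \<le> \<epsilon>/2" unfolding \<rho>_def by (rule min.cobounded1)
    have "(1 + c/2) * \<rho> \<le> (1 + c/2) * (c / (4 + 2 * c))" using c by (intro mult_left_mono) (auto simp: \<rho>_def)
    also have "\<dots> = c/4" using c by (simp add: field_simps)
    finally show "(1 + c/2) * \<rho> \<le> c/4" .
  qed (use c \<open>\<epsilon> > 0\<close> in \<open>auto simp: \<rho>_def\<close>)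
  obtain x2 where x2: "x2 > 0" "\<And>x. x \<in> {0<..x2} \<Longrightarrow> (1 - \<eta>) * f x \<le> h x"
    using asymp_bounds[OF h \<eta>(1)] by blast
  have "h (x * (w - r)) \<ge> (w + c/4) * f x"
    if "x > 0" "w \<ge> 1 + \<epsilon>" "r \<in> {-\<rho>..\<rho>}" "x * (w - r) \<le> min x1 x2" for x w r
  proof -
    define y where "y = w - r"
    have y: "1 + \<epsilon>/2 \<le> y" "w - \<rho> \<le> y" "0 < y" and yx: "y * x \<le> x1" "y * x \<le> x2"
      using that \<rho> \<open>\<epsilon> > 0\<close> by (auto simp: y_def mult.commute)
    have fx: "f x > 0" using pos that by auto
    have "(w + c/4) \<le> (1 + c/2) * (w - \<rho>)"
    proof -
      have "c/2 * 1 \<le> c/2 * w" using that c \<open>\<epsilon> > 0\<close> by (intro mult_left_mono) auto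
      moreover have "(1 + c/2) * (w - \<rho>) = w + c/2 * w - (1 + c/2) * \<rho>" by (simp add: field_simps)
      ultimately show ?thesis using \<rho> by linarith
    qed
    also have "\<dots> \<le> (1 + c/2) * y" using y c by (intro mult_left_mono) auto
    finally have "(w + c/4) * f x \<le> (1 + c/2) * y * f x" using fx by (intro mult_right_mono) auto
    also have "\<dots> = (1 - \<eta>) * ((1 + c) * y * f x)" by (simp add: \<eta>(3)[symmetric] mult.assoc)
    also have "\<dots> \<le> (1 - \<eta>) * f (y * x)" using \<eta> growth[of x y] that y yx by (intro mult_left_mono) auto
    also have "\<dots> \<le> h (y * x)" using x2(2)[of "y * x"] yx y that by auto
    finally show ?thesis by (simp add: y_def mult.commute)
  qed
  then show ?thesis using c \<rho>(1) x1(1) x2(1)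
    by (intro exI[of _ "c/4"] exI[of _ "min x1 x2"] exI[of _ \<rho>] conjI) simp_all
qed

end

section \<open>Solutions with a perturbation smaller than the unperturbed solution\<close>

text \<open>\<open>G\<close> is the positive solution of \<open>G' = -f(G)\<close> against which other solutions are measured.  The assumption
\<open>odd\<close> says that \<open>\<lambda>x. - f (- x)\<close> is asymptotic to \<open>f\<close>, so that negative solutions can be reflected.\<close>

locale perturbed_equation = regularly_varying +
  fixes G :: "real \<Rightarrow> real"
  assumes f_cont: "continuous_on UNIV f"
    and f_0: "f 0 = 0"
    and sign: "x \<noteq> 0 \<Longrightarrow> x * f x > 0"
    and odd: "((\<lambda>x. - f (- x) / f x) \<longlongrightarrow> 1) (at_right 0)"
    and G_pos: "t \<ge> 0 \<Longrightarrow> G t > 0"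
    and G_deriv: "t > 0 \<Longrightarrow> (G has_real_derivative - f (G t)) (at t)"
    and G_lim: "(G \<longlongrightarrow> 0) at_top"
begin

lemma G_at_right: "filterlim G (at_right 0) at_top"
  unfolding filterlim_at using G_lim
  by (auto intro!: eventually_at_top_linorderI[of 0] simp: G_pos less_imp_neq[OF G_pos, THEN not_sym])

lemma f_self: "((\<lambda>x. f x / f x) \<longlongrightarrow> 1) (at_right 0)"
  by (rule tendsto_eventually) (auto simp: eventually_at_right_field intro!: exI[of _ 1] dest: pos)

lemma G_small:
  assumes "a > 0"
  shows "\<forall>\<^sub>F t in at_top. G t \<in> {0<..a}"
proof -
  have "\<forall>\<^sub>F t in at_top. G t < a" using G_lim assms by (intro order_tendstoD) auto
  moreover have "\<forall>\<^sub>F t in at_top. t \<ge> (0::real)" by (rule eventually_ge_at_top)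
  ultimately show ?thesis by eventually_elim (use G_pos in auto)
qed

text \<open>The ratio \<open>w = z/G\<close> satisfies \<open>w' = A' (w - h(G (w - r))/f(G))\<close> with the clock \<open>A = -ln G\<close>.  Between
\<open>\<delta>/2\<close> and \<open>1 - \<epsilon>\<close> it is driven upwards and above \<open>1 + \<epsilon>\<close> downwards, at a uniform rate in that clock.\<close>

lemma ratio_converges_to_1:
  fixes h z R :: "real \<Rightarrow> real"
  assumes h: "((\<lambda>x. h x / f x) \<longlongrightarrow> 1) (at_right 0)"
    and z: "\<And>t. t > 0 \<Longrightarrow> (z has_real_derivative - h (z t - R t)) (at t)"
    and z0: "(z \<longlongrightarrow> 0) at_top" and R: "((\<lambda>t. R t / G t) \<longlongrightarrow> 0) at_top"
    and \<delta>: "0 < \<delta>" "\<delta> < 1" and freq: "\<exists>\<^sub>F t in at_top. z t \<ge> \<delta> * G t"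
  shows "((\<lambda>t. z t / G t) \<longlongrightarrow> 1) at_top"
proof -
  define w where "w t = z t / G t" for t
  define r where "r t = R t / G t" for t
  define w' where "w' t = f (G t) / G t * (w t - h (G t * (w t - r t)) / f (G t))" for t
  define A where "A t = - ln (G t)" for t
  define A' where "A' t = f (G t) / G t" for t
  have fG: "f (G t) > 0" "A' t > 0" if "t > 0" for t
    using pos[of "G t"] G_pos[of t] that by (auto simp: A'_def)
  have zG: "z t - R t = G t * (w t - r t)" if "t > 0" for t
    using G_pos[of t] that by (simp add: w_def r_def field_simps)
  have dw: "(w has_real_derivative w' t) (at t)" if "t > 0" for t
  proof -
    have "(w has_real_derivative (- h (z t - R t) * G t - z t * (- f (G t))) / (G t * G t)) (at t)"
      unfolding w_def using G_pos[of t] that by (intro DERIV_divide z G_deriv) auto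
    moreover have "(- h (z t - R t) * G t - z t * (- f (G t))) / (G t * G t) = w' t"
      unfolding w'_def zG[OF that] using fG[OF that] G_pos[of t] that by (simp add: w_def field_simps)
    ultimately show ?thesis by simp
  qed
  have dA: "(A has_real_derivative A' t) (at t)" if "t > 0" for t
  proof -
    have "(A has_real_derivative - (1 / G t * (- f (G t)))) (at t)"
      unfolding A_def using G_pos[of t] that
      by (intro DERIV_minus DERIV_chain2[OF DERIV_ln_divide G_deriv]) auto
    then show ?thesis by (simp add: A'_def)
  qed
  have A: "filterlim A at_top at_top"
    unfolding A_def using filterlim_compose[OF ln_at_0 G_at_right] by (simp add: filterlim_uminus_at_top)
  have r_small: "\<forall>\<^sub>F t in at_top. r t \<in> {-\<rho>..\<rho>}" if "\<rho> > 0" for \<rho>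
  proof -
    have "\<forall>\<^sub>F t in at_top. dist (r t) 0 < \<rho>" using R that by (simp add: tendsto_iff r_def)
    then show ?thesis by eventually_elim auto
  qed
  have freqw: "\<exists>t0\<ge>T. w t0 \<ge> \<delta>" for T
  proof -
    have "\<exists>\<^sub>F t in at_top. z t \<ge> \<delta> * G t \<and> t \<ge> max T 0"
      using freq by (rule frequently_eventually_frequently) (rule eventually_ge_at_top)
    then obtain t where "z t \<ge> \<delta> * G t" "t \<ge> T" "t \<ge> 0" by (auto dest: frequently_ex)
    then show ?thesis using G_pos[of t] by (intro exI[of _ t]) (auto simp: w_def field_simps)
  qed
  have lower: "\<forall>\<^sub>F t in at_top. w t \<ge> 1 - \<epsilon>" if \<epsilon>: "0 < \<epsilon>" "\<epsilon> < 1/2" for \<epsilon>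
  proof -
    have "0 < \<epsilon>" "\<epsilon> < 1" "\<delta>/2 > 0" using \<epsilon> \<delta> by auto
    from slower_below_equilibrium[OF h this(3,1,2)]
    obtain \<kappa> x0 \<rho> where *: "\<kappa> > 0" "x0 > 0" "\<rho> > 0"
      and slow: "\<And>x w r. x \<in> {0<..x0} \<Longrightarrow> w \<in> {\<delta>/2..1 - \<epsilon>} \<Longrightarrow> r \<in> {-\<rho>..\<rho>} \<Longrightarrow> h (x * (w - r)) \<le> (w - \<kappa>) * f x"
      by metis
    have "\<forall>\<^sub>F t in at_top. t > 0 \<and> G t \<in> {0<..x0} \<and> r t \<in> {-\<rho>..\<rho>}"
      by (intro eventually_conj eventually_gt_at_top G_small r_small *)
    then obtain T where T: "\<And>t. t \<ge> T \<Longrightarrow> t > 0 \<and> G t \<in> {0<..x0} \<and> r t \<in> {-\<rho>..\<rho>}"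
      by (auto simp: eventually_at_top_linorder)
    obtain t0 where t0: "t0 \<ge> T" "w t0 \<ge> \<delta>" using freqw by blast
    show ?thesis
    proof (rule drift_reaches_level[where T=T and \<phi>'=w' and A=A and A'=A' and \<kappa>=\<kappa> and ?c1.0="\<delta>/2" and ?t0.0=t0])
      fix t assume t: "t \<ge> T" "\<delta>/2 \<le> w t" "w t \<le> 1 - \<epsilon>"
      have "t > 0" using T t by blast
      have "h (G t * (w t - r t)) \<le> (w t - \<kappa>) * f (G t)"
        using T t by (intro slow) auto
      then have "\<kappa> \<le> w t - h (G t * (w t - r t)) / f (G t)"
        using fG[OF \<open>t > 0\<close>] by (simp add: field_simps)
      then have "A' t * \<kappa> \<le> w' t" unfolding w'_def A'_def[symmetric]
        using fG[OF \<open>t > 0\<close>] by (intro mult_left_mono) auto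
      then show "\<kappa> * A' t \<le> w' t" by (simp add: mult.commute)
    qed (use T dw dA A fG t0 * \<delta> \<epsilon> in \<open>auto intro: less_imp_le\<close>)
  qed
  have upper: "\<forall>\<^sub>F t in at_top. - w t \<ge> - (1 + \<epsilon>)" if \<epsilon>: "0 < \<epsilon>" for \<epsilon>
  proof -
    from faster_above_equilibrium[OF h \<epsilon>]
    obtain \<kappa> x0 \<rho> where *: "\<kappa> > 0" "x0 > 0" "\<rho> > 0"
      and fast: "\<And>x w r. x > 0 \<Longrightarrow> w \<ge> 1 + \<epsilon> \<Longrightarrow> r \<in> {-\<rho>..\<rho>} \<Longrightarrow> x * (w - r) \<le> x0 \<Longrightarrow> (w + \<kappa>) * f x \<le> h (x * (w - r))"
      by metis
    have "((\<lambda>t. z t - R t / G t * G t) \<longlongrightarrow> 0 - 0 * 0) at_top"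
      by (intro tendsto_intros z0 R G_lim)
    then have "\<forall>\<^sub>F t in at_top. z t - R t / G t * G t < x0"
      using * by (intro order_tendstoD) auto
    then have "\<forall>\<^sub>F t in at_top. t > 0 \<and> z t - R t / G t * G t < x0 \<and> r t \<in> {-\<rho>..\<rho>}"
      by (intro eventually_conj eventually_gt_at_top r_small *)
    then obtain T where T: "\<And>t. t \<ge> T \<Longrightarrow> t > 0 \<and> z t - R t / G t * G t < x0 \<and> r t \<in> {-\<rho>..\<rho>}"
      by (auto simp: eventually_at_top_linorder)
    show ?thesis
    proof (rule drift_reaches_level[where T=T and \<phi>'="\<lambda>t. - w' t" and A=A and A'=A' and \<kappa>=\<kappa>
          and ?c1.0="min (- w T) (- (1 + \<epsilon>)) - 1" and ?t0.0=T])
      fix t assume t: "t \<ge> T" "- w t \<le> - (1 + \<epsilon>)"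
      have "t > 0" using T t by blast
      have "G t * (w t - r t) \<le> x0"
        using T[OF t(1)] zG[OF \<open>t > 0\<close>] G_pos[of t] by simp
      then have "(w t + \<kappa>) * f (G t) \<le> h (G t * (w t - r t))"
        using T t G_pos[of t] \<open>t > 0\<close> by (intro fast) auto
      then have "\<kappa> \<le> - (w t - h (G t * (w t - r t)) / f (G t))"
        using fG[OF \<open>t > 0\<close>] by (simp add: field_simps)
      then have "A' t * \<kappa> \<le> A' t * - (w t - h (G t * (w t - r t)) / f (G t))"
        using fG[OF \<open>t > 0\<close>] by (intro mult_left_mono) auto
      also have "\<dots> = - w' t" unfolding w'_def A'_def mult_minus_right ..
      finally show "\<kappa> * A' t \<le> - w' t" by (simp add: mult.commute)
    qed (use T dw dA A fG * \<epsilon> in \<open>auto intro: less_imp_le intro!: DERIV_minus\<close>)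
  qed
  have "(w \<longlongrightarrow> 1) at_top"
  proof (rule tendstoI)
    fix e :: real assume "e > 0"
    then have "min (e/2) (1/4) > 0" "min (e/2) (1/4) < 1/2" by auto
    from lower[OF this] upper[OF this(1)] show "\<forall>\<^sub>F t in at_top. dist (w t) 1 < e"
      by eventually_elim (use \<open>e > 0\<close> in \<open>auto simp: dist_real_def abs_less_iff min_def split: if_splits\<close>)
  qed
  then show ?thesis by (simp add: w_def[abs_def])
qed

lemma negative_half: "((\<lambda>x. - f (- x) / f x) \<longlongrightarrow> 1) (at_right 0)" "continuous_on UNIV (\<lambda>x. - f (- x))"
  "x > 0 \<Longrightarrow> - f (- x) > 0"
  using sign[of "- x"] odd by (auto intro!: continuous_intros continuous_on_compose2[OF f_cont] simp: mult_less_0_iff zero_less_mult_iff)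

text \<open>A solution whose ratio to \<open>G\<close> is at least some \<open>\<delta> > 0\<close> at arbitrarily late times is attracted by \<open>1\<close>; the
reflected equation treats \<open>-1\<close>.  If neither happens for any \<open>\<delta>\<close>, the ratio tends to \<open>0\<close>.\<close>

theorem perturbed_solution_trichotomy:
  assumes z: "\<And>t. t > 0 \<Longrightarrow> (z has_real_derivative - f (z t - R t)) (at t)"
    and R: "((\<lambda>t. R t / G t) \<longlongrightarrow> 0) at_top"
  shows "\<exists>L\<in>{-1, 0, 1}. ((\<lambda>t. (z t - R t) / G t) \<longlongrightarrow> L) at_top"
proof -
  have z_neg: "((\<lambda>t. - z t) has_real_derivative - (- f (- ((- z t) - (- R t))))) (at t)" if "t > 0" for t
    using DERIV_minus[OF z[OF that]] by simp
  have "((\<lambda>t. R t / G t * G t) \<longlongrightarrow> 0 * 0) at_top" by (intro tendsto_intros R G_lim)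
  then have R0: "(R \<longlongrightarrow> 0) at_top"
    unfolding mult_zero_right by (rule Lim_transform_eventually) (use G_small[of 1] in \<open>auto elim!: eventually_mono\<close>)
  have Rneg: "((\<lambda>t. - R t / G t) \<longlongrightarrow> 0) at_top" "((\<lambda>t. - R t) \<longlongrightarrow> 0) at_top"
    using tendsto_minus[OF R] tendsto_minus[OF R0] by auto
  have z0: "(z \<longlongrightarrow> 0) at_top"
  proof (rule tendstoI)
    fix e :: real assume "e > 0"
    then have "e/2 > 0" by simp
    have "\<forall>\<^sub>F t in at_top. z t \<le> e/2"
      by (rule perturbed_solution_eventually_le[OF f_cont pos z R0 \<open>e/2 > 0\<close>])
    moreover have "\<forall>\<^sub>F t in at_top. - z t \<le> e/2"
      by (rule perturbed_solution_eventually_le[OF negative_half(2,3) z_neg Rneg(2) \<open>e/2 > 0\<close>])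
    ultimately show "\<forall>\<^sub>F t in at_top. dist (z t) 0 < e"
      by eventually_elim (use \<open>e > 0\<close> in \<open>auto simp: abs_less_iff\<close>)
  qed
  have zneg0: "((\<lambda>t. - z t) \<longlongrightarrow> 0) at_top" using tendsto_minus[OF z0] by simp
  have "\<exists>L\<in>{-1, 0, 1}. ((\<lambda>t. z t / G t) \<longlongrightarrow> L) at_top"
  proof (cases "\<exists>\<delta>. 0 < \<delta> \<and> \<delta> < 1 \<and> (\<exists>\<^sub>F t in at_top. z t \<ge> \<delta> * G t)")
    case True
    then have "((\<lambda>t. z t / G t) \<longlongrightarrow> 1) at_top" using ratio_converges_to_1[OF f_self z z0 R] by blast
    then show ?thesis by blast
  next
    case pos_false: False
    show ?thesis
    proof (cases "\<exists>\<delta>. 0 < \<delta> \<and> \<delta> < 1 \<and> (\<exists>\<^sub>F t in at_top. - z t \<ge> \<delta> * G t)")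
      case True
      then have "((\<lambda>t. - z t / G t) \<longlongrightarrow> 1) at_top"
        using ratio_converges_to_1[OF negative_half(1) z_neg zneg0 Rneg(1)] by blast
      from tendsto_minus[OF this] show ?thesis by auto
    next
      case False
      have "((\<lambda>t. z t / G t) \<longlongrightarrow> 0) at_top"
      proof (rule tendstoI)
        fix e :: real assume "e > 0"
        define \<delta> where "\<delta> = min e (1/2)"
        have d: "0 < \<delta>" "\<delta> < 1" "\<delta> \<le> e" using \<open>e > 0\<close> by (auto simp: \<delta>_def)
        have "\<forall>\<^sub>F t in at_top. z t < \<delta> * G t" "\<forall>\<^sub>F t in at_top. - z t < \<delta> * G t"
          using pos_false False d by (auto simp: frequently_def not_le)
        then show "\<forall>\<^sub>F t in at_top. dist (z t / G t) 0 < e" using G_small[OF zero_less_one]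
        proof eventually_elim
          case (elim t)
          have "\<bar>z t\<bar> < \<delta> * G t" using elim by (auto simp: abs_if)
          also have "\<dots> \<le> e * G t" using d elim by (intro mult_right_mono) auto
          finally show ?case using elim by (simp add: field_simps)
        qed
      qed
      then show ?thesis by blast
    qed
  qed
  then obtain L where L: "L \<in> {-1, 0, 1}" "((\<lambda>t. z t / G t) \<longlongrightarrow> L) at_top" by blast
  have "((\<lambda>t. z t / G t - R t / G t) \<longlongrightarrow> L - 0) at_top" by (intro tendsto_intros L R)
  then show ?thesis using L(1) by (intro bexI[of _ L]) (auto simp: diff_divide_distrib)
qed

text \<open>The ratio of arguments \<open>X/G\<close> varies with time, so pointwise regular variation does not suffice and uniform
convergence on \<open>[L/2, 2L]\<close> is needed.\<close>

lemma composed_ratio_tendsto: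
  assumes h: "((\<lambda>x. h x / f x) \<longlongrightarrow> 1) (at_right 0)"
    and y: "((\<lambda>t. X t / G t) \<longlongrightarrow> L) at_top" and "L > 0"
  shows "((\<lambda>t. h (X t) / f (G t)) \<longlongrightarrow> L powr \<beta>) at_top"
proof -
  define y where "y t = X t / G t" for t
  have y1: "\<forall>\<^sub>F t in at_top. y t \<in> {L/2..2*L}"
  proof -
    have "\<forall>\<^sub>F t in at_top. y t > L/2" "\<forall>\<^sub>F t in at_top. y t < 2*L"
      unfolding y_def using order_tendstoD(1)[OF y, of "L/2"] order_tendstoD(2)[OF y, of "2*L"] \<open>L > 0\<close>
      by simp_all
    then show ?thesis by eventually_elim auto
  qed
  have XG: "\<forall>\<^sub>F t in at_top. X t = y t * G t \<and> G t > 0"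
    using G_small[OF zero_less_one] by eventually_elim (auto simp: y_def)
  have "((\<lambda>t. X t / G t * G t) \<longlongrightarrow> L * 0) at_top" by (intro tendsto_intros y G_lim)
  then have "(X \<longlongrightarrow> 0) at_top"
    unfolding mult_zero_right by (rule Lim_transform_eventually) (use G_small[of 1] in \<open>auto elim!: eventually_mono\<close>)
  moreover have "\<forall>\<^sub>F t in at_top. X t > 0"
    using XG y1 by eventually_elim (use \<open>L > 0\<close> in auto)
  ultimately have "filterlim X (at_right 0) at_top"
    by (auto simp: filterlim_at elim!: eventually_mono)
  from filterlim_compose[OF h this] have 1: "((\<lambda>t. h (X t) / f (X t)) \<longlongrightarrow> 1) at_top" .
  have 2: "((\<lambda>t. f (X t) / (f (G t) * y t powr \<beta>)) \<longlongrightarrow> 1) at_top"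
  proof (rule tendstoI)
    fix e :: real assume "e > 0"
    define \<eta> where "\<eta> = min (e/2) (1/2)"
    have \<eta>: "\<eta> > 0" "\<eta> < 1" "\<eta> < e" "L/2 > 0" using \<open>e > 0\<close> \<open>L > 0\<close> by (auto simp: \<eta>_def)
    from ratio_uniform[OF \<eta>(4,1,2), of "2*L"] obtain x0 where "x0 > 0" and x0:
      "\<And>x l. x \<in> {0<..x0} \<Longrightarrow> l \<in> {L/2..2*L} \<Longrightarrow> (1 - \<eta>) * l powr \<beta> * f x \<le> f (l * x) \<and> f (l * x) \<le> (1 + \<eta>) * l powr \<beta> * f x"
      by blast
    show "\<forall>\<^sub>F t in at_top. dist (f (X t) / (f (G t) * y t powr \<beta>)) 1 < e"
      using y1 XG G_small[OF \<open>x0 > 0\<close>]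
    proof eventually_elim
      case (elim t)
      define d where "d = f (G t) * y t powr \<beta>"
      have d: "d > 0" using pos[of "G t"] elim \<open>L > 0\<close> by (auto simp: d_def)
      have "(1 - \<eta>) * d \<le> f (X t)" "f (X t) \<le> (1 + \<eta>) * d"
        using x0[of "G t" "y t"] elim by (auto simp: d_def mult_ac)
      then have "1 - \<eta> \<le> f (X t) / d" "f (X t) / d \<le> 1 + \<eta>" using d by (auto simp: field_simps)
      then show ?case using \<eta> by (auto simp: dist_real_def d_def abs_less_iff)
    qed
  qed
  have 3: "((\<lambda>t. y t powr \<beta>) \<longlongrightarrow> L powr \<beta>) at_top"
    using y \<open>L > 0\<close> by (intro tendsto_intros) (auto simp: y_def)
  have "((\<lambda>t. h (X t) / f (X t) * (f (X t) / (f (G t) * y t powr \<beta>) * y t powr \<beta>)) \<longlongrightarrow> 1 * (1 * L powr \<beta>)) at_top"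
    by (intro tendsto_intros 1 2 3)
  moreover have "\<forall>\<^sub>F t in at_top. h (X t) / f (X t) * (f (X t) / (f (G t) * y t powr \<beta>) * y t powr \<beta>) = h (X t) / f (G t)"
    using XG y1 \<open>\<forall>\<^sub>F t in at_top. X t > 0\<close>
  proof eventually_elim
    case (elim t)
    then have "f (X t) > 0" "f (G t) > 0" "y t > 0" using pos \<open>L > 0\<close> by auto
    then show ?case by (simp add: field_simps)
  qed
  ultimately show ?thesis by (auto intro: Lim_transform_eventually)
qed

text \<open>For \<open>L = 0\<close> the ratio \<open>X/G\<close> leaves every compact subset of the positive half-line.  There the growth
bound, read downwards from \<open>G\<close>, gives \<open>f(\<bar>X\<bar>)/f(G) \<le> \<bar>X\<bar>/G\<close>, and negative arguments cost a factor \<open>2\<close>.\<close>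

lemma drift_ratio_converges:
  assumes y: "((\<lambda>t. X t / G t) \<longlongrightarrow> L) at_top"
  shows "\<exists>l. ((\<lambda>t. f (X t) / f (G t)) \<longlongrightarrow> l) at_top"
proof -
  consider "L > 0" | "L < 0" | "L = 0" by linarith
  then show ?thesis
  proof cases
    case 1
    then show ?thesis using composed_ratio_tendsto[OF f_self y] by blast
  next
    case 2
    then have "((\<lambda>t. - X t / G t) \<longlongrightarrow> - L) at_top" "- L > 0" using tendsto_minus[OF y] by auto
    from tendsto_minus[OF composed_ratio_tendsto[OF odd this]] show ?thesis by auto
  next
    case 3
    obtain c x0 where c: "c > 0" "x0 > 0"
      and growth: "\<And>x l. x > 0 \<Longrightarrow> l \<ge> 2 \<Longrightarrow> l * x \<le> x0 \<Longrightarrow> f (l * x) \<ge> (1 + c) * l * f x"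
      using superlinear_growth[of 2] by auto
    obtain x1 where x1: "x1 > 0" "\<And>x. x \<in> {0<..x1} \<Longrightarrow> - f (- x) \<le> (1 + 1) * f x"
      using asymp_bounds[OF odd zero_less_one] by blast
    have "((\<lambda>t. f (X t) / f (G t)) \<longlongrightarrow> 0) at_top"
    proof (rule Lim_null_comparison)
      have "((\<lambda>t. 2 * \<bar>X t / G t\<bar>) \<longlongrightarrow> 2 * \<bar>0\<bar>) at_top" using y 3 by (intro tendsto_intros) auto
      then show "((\<lambda>t. 2 * \<bar>X t / G t\<bar>) \<longlongrightarrow> 0) at_top" by simp
      have "\<forall>\<^sub>F t in at_top. dist (X t / G t) 0 < 1/2"
        using y 3 by (auto simp: tendsto_iff dest: spec[of _ "1/2"])
      then show "\<forall>\<^sub>F t in at_top. norm (f (X t) / f (G t)) \<le> 2 * \<bar>X t / G t\<bar>"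
        using G_small[OF \<open>x0 > 0\<close>] G_small[OF \<open>x1 > 0\<close>]
      proof eventually_elim
        case (elim t)
        show ?case
        proof (cases "X t = 0")
          case True
          then show ?thesis by (simp add: f_0)
        next
          case False
          define u where "u = \<bar>X t\<bar>"
          have u: "u > 0" "2 * u \<le> G t" "G t > 0" using False elim by (auto simp: u_def field_simps)
          have fp: "f u > 0" "f (G t) > 0" using pos u by auto
          have "f (G t / u * u) \<ge> (1 + c) * (G t / u) * f u"
            using u elim by (intro growth) (auto simp: field_simps)
          moreover have "(1 + c) * (G t / u) * f u \<ge> 1 * (G t / u) * f u"
            using c u fp by (intro mult_right_mono) auto
          ultimately have "f u * G t \<le> f (G t) * u" using u by (simp add: field_simps)
          moreover have "\<bar>f (X t)\<bar> \<le> 2 * f u"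
          proof (cases "X t > 0")
            case True
            then show ?thesis using pos[of "X t"] by (simp add: u_def)
          next
            case neg: False
            then have "X t < 0" using False by simp
            then have "f (X t) < 0" using sign[of "X t"] by (auto simp: zero_less_mult_iff)
            moreover have "u \<in> {0<..x1}" using u elim by auto
            ultimately show ?thesis using x1(2)[of u] \<open>X t < 0\<close> by (simp add: u_def)
          qed
          then have "\<bar>f (X t)\<bar> * G t \<le> 2 * f u * G t" using u by (intro mult_right_mono) auto
          ultimately have "\<bar>f (X t)\<bar> * G t \<le> 2 * u * f (G t)" by (simp add: mult_ac)
          then show ?thesis using fp u by (simp add: u_def field_simps)
        qed
      qed
    qed
    then show ?thesis by blast
  qed
qed

text \<open>Since \<open>f(G) = -G'\<close>, the ratio of \<open>Q'\<close> to \<open>-G'\<close> tends to \<open>l\<close>; so \<open>Q + (l - \<epsilon>) G\<close> increases and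
\<open>Q + (l + \<epsilon>) G\<close> decreases from some time on.\<close>

lemma drift_increment_bounds:
  assumes Q: "\<And>t. t > 0 \<Longrightarrow> (Q has_real_derivative f (X t)) (at t)"
    and lim: "((\<lambda>t. f (X t) / f (G t)) \<longlongrightarrow> l) at_top" and "\<epsilon> > 0"
  shows "\<exists>T. \<forall>t s. T \<le> t \<longrightarrow> t \<le> s \<longrightarrow>
           (l - \<epsilon>) * (G t - G s) \<le> Q s - Q t \<and> Q s - Q t \<le> (l + \<epsilon>) * (G t - G s)"
proof -
  have "\<forall>\<^sub>F t in at_top. t > 0 \<and> dist (f (X t) / f (G t)) l < \<epsilon>"
    using lim \<open>\<epsilon> > 0\<close> by (intro eventually_conj eventually_gt_at_top) (auto simp: tendsto_iff)
  then obtain T where T: "\<And>t. t \<ge> T \<Longrightarrow> t > 0 \<and> dist (f (X t) / f (G t)) l < \<epsilon>"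
    by (auto simp: eventually_at_top_linorder)
  have bound: "(l - \<epsilon>) * f (G t) \<le> f (X t)" "f (X t) \<le> (l + \<epsilon>) * f (G t)" if "t \<ge> T" for t
  proof -
    have "f (G t) > 0" using T[OF that] G_pos[of t] pos by auto
    moreover have "l - \<epsilon> \<le> f (X t) / f (G t)" "f (X t) / f (G t) \<le> l + \<epsilon>"
      using T[OF that] by (auto simp: dist_real_def abs_less_iff)
    ultimately show "(l - \<epsilon>) * f (G t) \<le> f (X t)" "f (X t) \<le> (l + \<epsilon>) * f (G t)"
      by (auto simp: field_simps)
  qed
  have "(l - \<epsilon>) * (G t - G s) \<le> Q s - Q t \<and> Q s - Q t \<le> (l + \<epsilon>) * (G t - G s)"
    if "T \<le> t" "t \<le> s" for t s
  proof
    have "Q t + (l - \<epsilon>) * G t \<le> Q s + (l - \<epsilon>) * G s"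
    proof (rule DERIV_nonneg_imp_nondecreasing[OF \<open>t \<le> s\<close>])
      fix x assume "t \<le> x" "x \<le> s"
      then have "x \<ge> T" "x > 0" using T[of x] that by auto
      have "((\<lambda>x. Q x + (l - \<epsilon>) * G x) has_real_derivative f (X x) + (l - \<epsilon>) * - f (G x)) (at x)"
        by (intro derivative_intros Q G_deriv DERIV_cmult \<open>x > 0\<close>)
      then show "\<exists>y. ((\<lambda>x. Q x + (l - \<epsilon>) * G x) has_real_derivative y) (at x) \<and> 0 \<le> y"
        using bound[OF \<open>x \<ge> T\<close>] by (intro exI conjI) auto
    qed
    then show "(l - \<epsilon>) * (G t - G s) \<le> Q s - Q t" by (simp add: algebra_simps)
    have "- (Q t + (l + \<epsilon>) * G t) \<le> - (Q s + (l + \<epsilon>) * G s)"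
    proof (rule DERIV_nonneg_imp_nondecreasing[OF \<open>t \<le> s\<close>])
      fix x assume "t \<le> x" "x \<le> s"
      then have "x \<ge> T" "x > 0" using T[of x] that by auto
      have "((\<lambda>x. - (Q x + (l + \<epsilon>) * G x)) has_real_derivative - (f (X x) + (l + \<epsilon>) * - f (G x))) (at x)"
        by (intro derivative_intros Q G_deriv DERIV_cmult DERIV_minus \<open>x > 0\<close>)
      then show "\<exists>y. ((\<lambda>x. - (Q x + (l + \<epsilon>) * G x)) has_real_derivative y) (at x) \<and> 0 \<le> y"
        using bound[OF \<open>x \<ge> T\<close>] by (intro exI conjI) auto
    qed
    then show "Q s - Q t \<le> (l + \<epsilon>) * (G t - G s)" by (simp add: algebra_simps)
  qed
  then show ?thesis by blast
qed

end

section \<open>The unperturbed solution \<open>F\<^sup>-\<^sup>1\<close>\<close>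

context
  fixes f :: "real \<Rightarrow> real"
  assumes pos: "\<And>x. x > 0 \<Longrightarrow> f x > 0"
    and cont: "continuous_on {0<..} f"
    and sublinear: "((\<lambda>x. f x / x) \<longlongrightarrow> 0) (at_right 0)"
begin

lemma F_of_has_derivative:
  assumes "x > 0"
  shows "(F_of f has_real_derivative - (1 / f x)) (at x)"
proof -
  define a b where "a = min x 1 / 2" and "b = max x 1 + 1"
  have ab: "0 < a" "a \<le> 1" "1 \<le> b" "a < x" "x < b" using assms by (auto simp: a_def b_def)
  have "continuous_on {a..b} (\<lambda>u. 1 / f u)"
    using ab pos by (intro continuous_intros continuous_on_subset[OF cont])
      (auto simp: less_imp_neq[OF pos, THEN not_sym])
  from interval_integral_FTC2[OF ab(2,3) this, of x] ab
  have "((\<lambda>u. LBINT y=1..u. 1 / f y) has_vector_derivative 1 / f x) (at x within {a..b})" by (simp add: one_ereal_def)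
  then have "((\<lambda>u. LBINT y=1..u. 1 / f y) has_vector_derivative 1 / f x) (at x)"
    using ab by (subst (asm) at_within_Icc_at) auto
  then have "((\<lambda>u. - (LBINT y=1..u. 1 / f y)) has_real_derivative - (1 / f x)) (at x)"
    by (intro DERIV_minus) (simp add: has_real_derivative_iff_has_vector_derivative)
  moreover have "F_of f = (\<lambda>u. - (LBINT y=1..u. 1 / f y))"
    unfolding F_of_def by (subst interval_integral_endpoints_reverse) auto
  ultimately show ?thesis by simp
qed

lemma F_of_strict_decreasing:
  assumes "0 < x" "x < y"
  shows "F_of f y < F_of f x"
proof (rule DERIV_neg_imp_decreasing[OF assms(2)])
  fix u assume "x \<le> u" "u \<le> y"
  then show "\<exists>d. (F_of f has_real_derivative d) (at u) \<and> d < 0"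
    using F_of_has_derivative[of u] pos[of u] assms by (intro exI[of _ "- (1 / f u)"]) auto
qed

lemma F_of_inj: "inj_on (F_of f) {0<..}"
proof (rule linorder_inj_onI')
  fix x y :: real assume "x \<in> {0<..}" "x < y"
  then show "F_of f x \<noteq> F_of f y" using F_of_strict_decreasing[of x y] by auto
qed

lemma F_of_1: "F_of f 1 = 0"
  by (simp add: F_of_def one_ereal_def[symmetric])

text \<open>Near \<open>0\<close> the assumption \<open>f(x)/x \<longlongrightarrow> 0\<close> gives \<open>1/f(x) \<ge> 1/x\<close>, whose integral diverges logarithmically.\<close>

lemma F_of_unbounded: "\<exists>x\<in>{0<..1}. F_of f x \<ge> t"
proof -
  have "\<forall>\<^sub>F x in at_right 0. f x / x < 1" using sublinear by (rule order_tendstoD) simp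
  then obtain b where b: "b > 0" "\<And>x. 0 < x \<Longrightarrow> x < b \<Longrightarrow> f x / x < 1"
    by (auto simp: eventually_at_right_field)
  define x0 where "x0 = b/2"
  have "x0 > 0" using b by (simp add: x0_def)
  have grow: "F_of f x0 + ln x0 \<le> F_of f x + ln x" if "0 < x" "x \<le> x0" for x
  proof (rule DERIV_nonpos_imp_nonincreasing[OF that(2)])
    fix u assume u: "x \<le> u" "u \<le> x0"
    then have "f u < u" "f u > 0" "u > 0" using b(2)[of u] that pos[of u] b(1) by (auto simp: x0_def field_simps)
    then have "- (1 / f u) + 1 / u \<le> 0" by (simp add: field_simps)
    moreover have "((\<lambda>u. F_of f u + ln u) has_real_derivative - (1 / f u) + 1 / u) (at u)"
      using \<open>u > 0\<close> by (intro DERIV_add F_of_has_derivative DERIV_ln_divide)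
    ultimately show "\<exists>d. ((\<lambda>u. F_of f u + ln u) has_real_derivative d) (at u) \<and> d \<le> 0" by blast
  qed
  define x where "x = Min {x0, 1, exp (F_of f x0 + ln x0 - t)}"
  have x: "0 < x" "x \<le> x0" "x \<le> 1" "x \<le> exp (F_of f x0 + ln x0 - t)" using \<open>x0 > 0\<close> by (auto simp: x_def)
  have "ln x \<le> F_of f x0 + ln x0 - t" using x(1,4) by (metis ln_exp ln_le_cancel_iff exp_gt_zero)
  then show ?thesis using grow[OF x(1,2)] x by (intro bexI[of _ x]) auto
qed

text \<open>Restricting to \<open>t \<ge> 0\<close> is what makes \<open>t\<close> a value of \<open>F\<close>: it lies between \<open>F(1) = 0\<close> and arbitrarily
large values.\<close>

lemma F_of_F_inv:
  assumes "t \<ge> 0"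
  shows "F_of f (F_inv f t) = t" "F_inv f t > 0"
proof -
  obtain x where x: "x \<in> {0<..1}" "F_of f x \<ge> t" using F_of_unbounded by blast
  have "\<exists>y. x \<le> y \<and> y \<le> 1 \<and> F_of f y = t"
    using x assms F_of_1
    by (intro IVT2) (auto intro!: DERIV_isCont[OF F_of_has_derivative])
  then have *: "t \<in> F_of f ` {0<..}" using x by force
  then show "F_of f (F_inv f t) = t" unfolding F_inv_def by (rule f_the_inv_into_f[OF F_of_inj])
  show "F_inv f t > 0" using the_inv_into_into[OF F_of_inj * order_refl] by (simp add: F_inv_def)
qed

lemma F_inv_F_of: "x > 0 \<Longrightarrow> F_inv f (F_of f x) = x"
  unfolding F_inv_def by (rule the_inv_into_f_f[OF F_of_inj]) simp

lemma F_inv_antimono: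
  assumes "0 \<le> s" "s \<le> t"
  shows "F_inv f t \<le> F_inv f s"
proof (rule ccontr)
  assume "\<not> F_inv f t \<le> F_inv f s"
  then have "F_of f (F_inv f t) < F_of f (F_inv f s)"
    using assms by (intro F_of_strict_decreasing F_of_F_inv) auto
  then show False using assms by (simp add: F_of_F_inv)
qed

lemma F_inv_has_derivative:
  assumes "t > 0"
  shows "(F_inv f has_real_derivative - f (F_inv f t)) (at t)"
proof -
  define x where "x = F_inv f t"
  have x: "x > 0" "F_of f x = t" using F_of_F_inv[of t] assms by (auto simp: x_def)
  have "isCont (F_inv f) (F_of f x)"
  proof (rule isCont_inverse_function[where d="x / 2" and f="F_of f" and x=x])
    show "x / 2 > 0" using x by simp
    fix z assume "\<bar>z - x\<bar> \<le> x / 2"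
    then have "z > 0" using x by linarith
    then show "F_inv f (F_of f z) = z" "isCont (F_of f) z"
      using F_inv_F_of DERIV_isCont[OF F_of_has_derivative] by blast+
  qed
  then have "(F_inv f has_real_derivative inverse (- (1 / f (F_inv f t)))) (at t)"
    using assms x pos[of x] F_of_has_derivative[of x] F_of_F_inv(1)
    by (intro DERIV_inverse_function[where f="F_of f" and a=0 and b="t+1"]) (simp_all add: x_def)
  then show ?thesis using pos[of x] x by (simp add: x_def)
qed

lemma F_inv_tendsto_0: "(F_inv f \<longlongrightarrow> 0) at_top"
proof (rule tendstoI)
  fix e :: real assume "e > 0"
  have "F_inv f t < e" if "t > max 0 (F_of f e)" for t
  proof (rule ccontr)
    assume "\<not> F_inv f t < e"
    then have "F_of f (F_inv f t) \<le> F_of f e"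
      using F_of_strict_decreasing[OF \<open>e > 0\<close>, of "F_inv f t"] by (cases "F_inv f t = e") auto
    then show False using F_of_F_inv(1)[of t] that by auto
  qed
  then show "\<forall>\<^sub>F t in at_top. dist (F_inv f t) 0 < e"
    by (intro eventually_mono[OF eventually_gt_at_top[of "max 0 (F_of f e)"]])
      (simp add: dist_real_def F_of_F_inv(2) less_imp_le abs_of_pos)
qed

end

section \<open>Processes with independent Gaussian increments\<close>

text \<open>The normal law with mean \<open>0\<close> and variance \<open>d\<close>, defined by scaling so that \<open>d = 0\<close> gives the point mass
at \<open>0\<close>: \<open>\<sigma>\<close> may vanish on an interval, and then increments of the noise are degenerate.\<close>

definition centered_normal :: "real \<Rightarrow> real measure" where
  "centered_normal d = distr std_normal_distribution borel (\<lambda>z. sqrt d * z)"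

interpretation std_normal: real_distribution std_normal_distribution
  by (rule real_dist_normal_dist)

lemma real_distribution_centered_normal: "real_distribution (centered_normal d)"
  unfolding centered_normal_def by (intro std_normal.real_distribution_distr) simp

lemma char_centered_normal:
  assumes "d \<ge> 0"
  shows "char (centered_normal d) u = complex_of_real (exp (- u\<^sup>2 * d / 2))"
proof -
  have "char (centered_normal d) u = char std_normal_distribution (u * sqrt d)"
    unfolding centered_normal_def char_def
    by (subst integral_distr) (auto simp: mult_ac)
  also have "\<dots> = complex_of_real (exp (- u\<^sup>2 * d / 2))"
    using assms by (simp add: char_std_normal_distribution power_mult_distrib)
  finally show ?thesis .
qed

lemma measure_centered_normal:
  assumes "S \<in> sets borel"
  shows "measure (centered_normal d) S = measure std_normal_distribution ((\<lambda>z. sqrt d * z) -` S)"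
  unfolding centered_normal_def using assms by (subst measure_distr) auto

lemma std_normal_reflect: "distr std_normal_distribution borel uminus = std_normal_distribution"
proof (rule Levy_uniqueness)
  show "real_distribution (distr std_normal_distribution borel uminus)"
    by (intro std_normal.real_distribution_distr) simp
  have "char (distr std_normal_distribution borel uminus) u = char std_normal_distribution (- u)" for u
    unfolding char_def by (subst integral_distr) auto
  then show "char (distr std_normal_distribution borel uminus) = char std_normal_distribution"
    by (simp add: char_std_normal_distribution fun_eq_iff)
qed (rule real_dist_normal_dist)

lemma std_normal_nonneg_half: "measure std_normal_distribution {0..} \<ge> 1/2"
proof -
  have "measure std_normal_distribution {..0} = measure (distr std_normal_distribution borel uminus) {..0}"
    by (simp add: std_normal_reflect)
  also have "\<dots> = measure std_normal_distribution {0..}"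
    by (subst measure_distr) (auto intro!: arg_cong[where f="measure _"])
  finally have "measure std_normal_distribution {..0} = measure std_normal_distribution {0..}" .
  moreover have "1 \<le> measure std_normal_distribution ({..0} \<union> {0..})"
  proof -
    have "{..0} \<union> {0..} = (UNIV :: real set)" by auto
    then show ?thesis using std_normal.prob_space by simp
  qed
  then have "1 \<le> measure std_normal_distribution {..0} + measure std_normal_distribution {0..}"
    using measure_Un_le[of "{..0}" std_normal_distribution "{0..}"] by auto
  ultimately show ?thesis by simp
qed

lemma centered_normal_nonneg_half:
  assumes "d \<ge> 0"
  shows "measure (centered_normal d) {0..} \<ge> 1/2"
proof -
  have "(\<lambda>z. sqrt d * z) -` {0..} \<in> sets borel"
    using measurable_sets[of "\<lambda>z. sqrt d * z" borel borel "{0..}"] by simp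
  then have "measure std_normal_distribution {0..} \<le> measure std_normal_distribution ((\<lambda>z. sqrt d * z) -` {0..})"
    using assms by (intro std_normal.finite_measure_mono) auto
  then show ?thesis using std_normal_nonneg_half by (simp add: measure_centered_normal)
qed

lemma measure_std_normal:
  assumes "S \<in> sets borel"
  shows "ennreal (measure std_normal_distribution S) = (\<integral>\<^sup>+x. ennreal (std_normal_density x) * indicator S x \<partial>lborel)"
  using assms by (subst std_normal.emeasure_eq_measure[symmetric]) (simp add: emeasure_density)

text \<open>For \<open>z \<ge> x \<ge> 0\<close> one has \<open>z\<^sup>2 \<ge> x\<^sup>2 + (z - x)\<^sup>2\<close>, so the density is at most
\<open>exp (- x\<^sup>2 / 2)\<close> times a normal density centred at \<open>x\<close>.\<close>

lemma std_normal_upper_tail: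
  assumes "x \<ge> 0"
  shows "measure std_normal_distribution {x..} \<le> exp (- x\<^sup>2 / 2)"
proof -
  have "ennreal (measure std_normal_distribution {x..}) \<le> (\<integral>\<^sup>+z. ennreal (exp (- x\<^sup>2 / 2)) * ennreal (normal_density x 1 z) \<partial>lborel)"
    unfolding measure_std_normal[of "{x..}", simplified]
  proof (rule nn_integral_mono)
    fix z :: real
    have "std_normal_density z \<le> exp (- x\<^sup>2 / 2) * normal_density x 1 z" if "z \<ge> x"
    proof -
      have "0 \<le> 2 * x * (z - x)" using assms that by simp
      then have "- z\<^sup>2 / 2 \<le> - x\<^sup>2 / 2 + - (z - x)\<^sup>2 / 2"
        by (simp add: power2_eq_square field_simps)
      then have "exp (- z\<^sup>2 / 2) \<le> exp (- x\<^sup>2 / 2) * exp (- (z - x)\<^sup>2 / 2)"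
        by (simp add: exp_add[symmetric])
      then show ?thesis by (simp add: normal_density_def field_simps)
    qed
    then show "ennreal (std_normal_density z) * indicator {x..} z \<le> ennreal (exp (- x\<^sup>2 / 2)) * ennreal (normal_density x 1 z)"
      by (auto simp: ennreal_mult'[symmetric] split: split_indicator intro!: ennreal_leI)
  qed
  also have "\<dots> = ennreal (exp (- x\<^sup>2 / 2))"
    by (subst nn_integral_cmult) (auto simp: nn_integral_eq_integral)
  finally show ?thesis by simp
qed

text \<open>The density on \<open>[x, x + 1]\<close> is bounded below by its value at \<open>x + 1\<close>, and \<open>(x + 1)\<^sup>2 \<le> 2 x\<^sup>2 + 2\<close>.  The
loss of a factor \<open>2\<close> in the exponent is harmless, as the multiple of the iterated logarithm function that is
reached infinitely often may be small.\<close>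

lemma std_normal_lower_tail:
  assumes "x \<ge> 0"
  shows "exp (- 1 - x\<^sup>2) / sqrt (2 * pi) \<le> measure std_normal_distribution {x..}"
proof -
  have "ennreal (exp (- 1 - x\<^sup>2) / sqrt (2 * pi)) = (\<integral>\<^sup>+z. ennreal (exp (- 1 - x\<^sup>2) / sqrt (2 * pi)) * indicator {x..x+1} z \<partial>lborel)"
    by (subst nn_integral_cmult_indicator) auto
  also have "\<dots> \<le> ennreal (measure std_normal_distribution {x..})"
    unfolding measure_std_normal[of "{x..}", simplified]
  proof (rule nn_integral_mono)
    fix z :: real
    have "exp (- 1 - x\<^sup>2) / sqrt (2 * pi) \<le> std_normal_density z" if "z \<in> {x..x+1}"
    proof -
      have "z\<^sup>2 \<le> (x + 1)\<^sup>2" using assms that by (intro power_mono) auto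
      also have "\<dots> \<le> 2 * x\<^sup>2 + 2" using zero_le_power2[of "x - 1"] by (simp add: power2_eq_square algebra_simps)
      finally have "- 1 - x\<^sup>2 \<le> - z\<^sup>2 / 2" by simp
      then show ?thesis by (simp add: std_normal_density_def divide_right_mono)
    qed
    then show "ennreal (exp (- 1 - x\<^sup>2) / sqrt (2 * pi)) * indicator {x..x+1} z \<le> ennreal (std_normal_density z) * indicator {x..} z"
      by (auto split: split_indicator intro!: ennreal_leI)
  qed
  finally show ?thesis by (subst (asm) ennreal_le_iff) auto
qed

lemma std_normal_small_ball:
  assumes "K \<ge> 0"
  shows "measure std_normal_distribution {-K..K} \<le> 2 * K"
proof -
  have "ennreal (measure std_normal_distribution {-K..K}) \<le> (\<integral>\<^sup>+z. 1 * indicator {-K..K} z \<partial>lborel)"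
    unfolding measure_std_normal[of "{-K..K}", simplified]
  proof (rule nn_integral_mono)
    fix z :: real
    have "1 / sqrt (2 * pi) \<le> 1" using pi_ge_two by (simp add: real_le_rsqrt)
    then have "std_normal_density z \<le> 1 * 1"
      unfolding std_normal_density_def by (intro mult_mono) auto
    then show "ennreal (std_normal_density z) * indicator {-K..K} z \<le> 1 * indicator {-K..K} z"
      by (auto split: split_indicator)
  qed
  also have "\<dots> = ennreal (2 * K)" using assms by (subst nn_integral_cmult_indicator) auto
  finally show ?thesis using assms by simp
qed

lemma centered_normal_tail:
  assumes "d > 0"
  shows "measure (centered_normal d) {x..} = measure std_normal_distribution {x / sqrt d..}"
  using assms by (subst measure_centered_normal) (auto simp: field_simps vimage_def atLeast_def)

lemma set_integral_uniform_measure: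
  fixes g :: "'a \<Rightarrow> complex"
  assumes A: "emeasure M A \<noteq> 0" "emeasure M A \<noteq> \<infinity>" and g: "g \<in> borel_measurable M"
  shows "integral\<^sup>L (uniform_measure M A) g = (LINT x:A|M. g x) / measure M A"
proof -
  have A': "A \<in> sets M" using A by (auto dest: emeasure_neq_0_sets)
  have m: "measure M A > 0" using A by (simp add: measure_def enn2real_positive_iff less_top zero_less_iff_neq_zero)
  have "indicator A x / emeasure M A = ennreal (indicator A x / measure M A)" for x
    using A m by (auto simp: emeasure_eq_ennreal_measure divide_ennreal split: split_indicator)
      (metis divide_ennreal ennreal_1 zero_le_one)
  then have "uniform_measure M A = density M (\<lambda>x. ennreal (indicator A x / measure M A))"
    unfolding uniform_measure_def by simp
  then have "integral\<^sup>L (uniform_measure M A) g = (\<integral>x. (indicator A x / measure M A) *\<^sub>R g x \<partial>M)"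
    using A' g m by (simp add: integral_density)
  also have "\<dots> = (\<integral>x. (indicator A x *\<^sub>R g x) / measure M A \<partial>M)"
    by (intro Bochner_Integration.integral_cong) (auto simp: scaleR_conv_of_real)
  also have "\<dots> = (LINT x:A|M. g x) / measure M A"
    by (simp add: set_lebesgue_integral_def)
  finally show ?thesis .
qed

text \<open>The last assumption encodes two facts at once.  For \<open>A\<close> the whole space it determines the law of the
increment; for general \<open>A\<close> it says that the characteristic function under the conditional probability
given \<open>A\<close> is the same, which is independence of the past.\<close>

locale gaussian_increments = prob_space M for M :: "'a measure" +
  fixes \<F> :: "real \<Rightarrow> 'a measure" and Y :: "real \<Rightarrow> 'a \<Rightarrow> real" and v :: "real \<Rightarrow> real"
  assumes subalg: "t \<ge> 0 \<Longrightarrow> subalgebra M (\<F> t)"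
    and filtration: "0 \<le> s \<Longrightarrow> s \<le> t \<Longrightarrow> sets (\<F> s) \<subseteq> sets (\<F> t)"
    and adapted: "t \<ge> 0 \<Longrightarrow> Y t \<in> borel_measurable (\<F> t)"
    and v_mono: "0 \<le> s \<Longrightarrow> s \<le> t \<Longrightarrow> v s \<le> v t"
    and char_increment: "0 \<le> s \<Longrightarrow> s \<le> t \<Longrightarrow> A \<in> sets (\<F> s) \<Longrightarrow>
      (LINT \<omega>:A|M. iexp (u * (Y t \<omega> - Y s \<omega>))) = complex_of_real (exp (- u\<^sup>2 * (v t - v s) / 2) * prob A)"
begin

lemma events: "t \<ge> 0 \<Longrightarrow> A \<in> sets (\<F> t) \<Longrightarrow> A \<in> sets M"
  using subalg by (auto simp: subalgebra_def)

lemma space_filtration: "t \<ge> 0 \<Longrightarrow> space (\<F> t) = space M"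
  using subalg by (auto simp: subalgebra_def)

lemma adapted_later: "0 \<le> s \<Longrightarrow> s \<le> t \<Longrightarrow> Y s \<in> borel_measurable (\<F> t)"
  using adapted[of s] filtration[of s t] space_filtration[of s] space_filtration[of t]
  by (auto simp: measurable_def)

lemma measurable_Y: "t \<ge> 0 \<Longrightarrow> Y t \<in> borel_measurable M"
  using adapted[of t] subalg[of t] by (auto simp: subalgebra_def measurable_def)

text \<open>Estimates for one sign of the noise thereby hold for the other.\<close>

lemma reflected: "gaussian_increments M \<F> (\<lambda>t \<omega>. - Y t \<omega>) v"
proof unfold_locales
  fix s t u :: real and A assume "0 \<le> s" "s \<le> t" "A \<in> sets (\<F> s)"
  from char_increment[OF this, of "- u"]
  show "(LINT \<omega>:A|M. iexp (u * (- Y t \<omega> - - Y s \<omega>))) = complex_of_real (exp (- u\<^sup>2 * (v t - v s) / 2) * prob A)"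
    by (simp add: algebra_simps)
qed (use subalg filtration adapted v_mono in \<open>auto intro: subsetD\<close>)

text \<open>The laws of the increment under \<open>P\<close> conditioned on \<open>A\<close> and \<open>centered_normal\<close> have the same
characteristic function.\<close>

lemma conditional_law:
  assumes st: "0 \<le> s" "s \<le> t" and A: "A \<in> sets (\<F> s)" and S: "S \<in> sets borel"
  shows "prob ({\<omega> \<in> space M. Y t \<omega> - Y s \<omega> \<in> S} \<inter> A) = measure (centered_normal (v t - v s)) S * prob A"
proof (cases "prob A = 0")
  case True
  have "A \<in> sets M" using events st A by auto
  then have "prob ({\<omega> \<in> space M. Y t \<omega> - Y s \<omega> \<in> S} \<inter> A) \<le> prob A"
    by (intro finite_measure_mono) auto
  then show ?thesis using True measure_nonneg[of M] by (simp add: order_antisym)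
next
  case False
  have AM: "A \<in> sets M" using events st A by auto
  have [measurable]: "Y t \<in> borel_measurable M" "Y s \<in> borel_measurable M" using measurable_Y st by auto
  have eA: "emeasure M A \<noteq> 0" "emeasure M A \<noteq> \<infinity>"
    using False by (auto simp: emeasure_eq_measure)
  let ?D = "\<lambda>\<omega>. Y t \<omega> - Y s \<omega>"
  interpret A: prob_space "uniform_measure M A" by (rule prob_space_uniform_measure[OF eA])
  have [measurable]: "?D \<in> borel_measurable (uniform_measure M A)" by simp
  have "distr (uniform_measure M A) borel ?D = centered_normal (v t - v s)"
  proof (rule Levy_uniqueness)
    show "real_distribution (distr (uniform_measure M A) borel ?D)"
      by (intro A.real_distribution_distr) simp
    show "real_distribution (centered_normal (v t - v s))" by (rule real_distribution_centered_normal)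
    have "char (distr (uniform_measure M A) borel ?D) u = char (centered_normal (v t - v s)) u" for u
    proof -
      have "char (distr (uniform_measure M A) borel ?D) u = integral\<^sup>L (uniform_measure M A) (\<lambda>\<omega>. iexp (u * ?D \<omega>))"
        unfolding char_def by (subst integral_distr) auto
      also have "\<dots> = (LINT \<omega>:A|M. iexp (u * ?D \<omega>)) / prob A"
        by (rule set_integral_uniform_measure[OF eA]) measurable
      also have "\<dots> = exp (- u\<^sup>2 * (v t - v s) / 2)"
        using False by (subst char_increment[OF st A]) simp
      finally show ?thesis using v_mono[OF st] by (simp add: char_centered_normal)
    qed
    then show "char (distr (uniform_measure M A) borel ?D) = char (centered_normal (v t - v s))" by blast
  qed
  then have "measure (centered_normal (v t - v s)) S = measure (distr (uniform_measure M A) borel ?D) S" by simp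
  also have "\<dots> = measure (uniform_measure M A) {\<omega> \<in> space M. ?D \<omega> \<in> S}"
    using S by (subst measure_distr) (auto intro!: arg_cong[where f="measure _"])
  also have "\<dots> = prob (A \<inter> {\<omega> \<in> space M. ?D \<omega> \<in> S}) / prob A"
    using S measurable_sets[of ?D M borel S]
    by (intro measure_uniform_measure eA) (simp add: vimage_def Int_def conj_commute)
  finally show ?thesis using False by (simp add: Int_commute)
qed

lemma increment_law:
  assumes "0 \<le> s" "s \<le> t" "S \<in> sets borel"
  shows "prob {\<omega> \<in> space M. Y t \<omega> - Y s \<omega> \<in> S} = measure (centered_normal (v t - v s)) S"
proof -
  have "space M \<in> sets (\<F> s)" using sets.top[of "\<F> s"] assms space_filtration by simp
  from conditional_law[OF assms(1,2) this assms(3)] show ?thesis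
    by (simp add: prob_space Int_absorb2 Collect_restrict)
qed

lemma independent_increment:
  assumes "0 \<le> s" "s \<le> t" "A \<in> sets (\<F> s)" "S \<in> sets borel"
  shows "prob ({\<omega> \<in> space M. Y t \<omega> - Y s \<omega> \<in> S} \<inter> A) = prob {\<omega> \<in> space M. Y t \<omega> - Y s \<omega> \<in> S} * prob A"
  using conditional_law[OF assms] increment_law[OF assms(1,2,4)] by simp

lemma increment_event:
  assumes "0 \<le> s" "s \<le> r" "r \<le> t" "S \<in> sets borel"
  shows "{\<omega> \<in> space M. Y r \<omega> - Y s \<omega> \<in> S} \<in> sets (\<F> t)"
proof -
  have [measurable]: "Y r \<in> borel_measurable (\<F> t)" "Y s \<in> borel_measurable (\<F> t)"
    using adapted_later assms by auto
  have "(\<lambda>\<omega>. Y r \<omega> - Y s \<omega>) -` S \<inter> space (\<F> t) \<in> sets (\<F> t)"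
    using assms(4) by measurable
  then show ?thesis using space_filtration[of t] assms by (simp add: vimage_def Int_def conj_commute)
qed

text \<open>Levy's argument: decompose according to the first index \<open>k\<close> at which the level is reached.
From there on the process ends no lower than it is with conditional probability at least \<open>1/2\<close>,
because the remaining increment is independent of the past and symmetric.\<close>

lemma levy_maximal_inequality:
  fixes p :: "nat \<Rightarrow> real"
  assumes p: "0 \<le> s" "s \<le> p 0" "mono p"
  shows "prob {\<omega> \<in> space M. \<exists>i\<le>n. Y (p i) \<omega> - Y s \<omega> \<ge> x} \<le> 2 * prob {\<omega> \<in> space M. Y (p n) \<omega> - Y s \<omega> \<ge> x}"
proof -
  have sp: "s \<le> p i" "0 \<le> p i" for i using p monoD[OF p(3), of 0 i] by auto
  define A where "A k = {\<omega> \<in> space M. Y (p k) \<omega> - Y s \<omega> \<ge> x} - (\<Union>j<k. {\<omega> \<in> space M. Y (p j) \<omega> - Y s \<omega> \<ge> x})" for k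
  have A: "A k \<in> sets (\<F> (p k))" for k
  proof -
    have "{\<omega> \<in> space M. Y (p j) \<omega> - Y s \<omega> \<ge> x} \<in> sets (\<F> (p k))" if "j \<le> k" for j
      using increment_event[of s "p j" "p k" "{x..}"] p(1) sp monoD[OF p(3) that] by simp
    then show ?thesis unfolding A_def by (intro sets.Diff sets.finite_UN) auto
  qed
  have AM: "A k \<in> events" for k using events[OF sp(2) A] .
  define C where "C k = {\<omega> \<in> space M. Y (p n) \<omega> - Y (p k) \<omega> \<in> {0..}} \<inter> A k" for k
  have [measurable]: "Y (p k) \<in> borel_measurable M" "Y s \<in> borel_measurable M" for k
    using measurable_Y sp p by auto
  have CM: "C k \<in> events" for k unfolding C_def using AM by (intro sets.Int) measurable
  have disj: "disjoint_family_on A {..n}"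
    unfolding disjoint_family_on_def
  proof safe
    fix i j :: nat assume "i \<noteq> j"
    then have "A i \<inter> A j = {}" by (cases "i < j") (auto simp: A_def)
    then show "\<omega> \<in> {}" if "\<omega> \<in> A i" "\<omega> \<in> A j" for \<omega> using that by blast
  qed
  have "{\<omega> \<in> space M. \<exists>i\<le>n. Y (p i) \<omega> - Y s \<omega> \<ge> x} \<subseteq> (\<Union>k\<le>n. A k)"
  proof safe
    fix \<omega> i assume H: "\<omega> \<in> space M" "i \<le> n" "Y (p i) \<omega> - Y s \<omega> \<ge> x"
    define k where "k = (LEAST i. Y (p i) \<omega> - Y s \<omega> \<ge> x)"
    have "Y (p k) \<omega> - Y s \<omega> \<ge> x" unfolding k_def by (rule LeastI[of _ i]) (fact H(3))
    moreover have "k \<le> i" unfolding k_def by (rule Least_le) (fact H(3))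
    moreover have "\<not> Y (p j) \<omega> - Y s \<omega> \<ge> x" if "j < k" for j
      using not_less_Least[of j] that unfolding k_def by blast
    ultimately show "\<omega> \<in> (\<Union>k\<le>n. A k)" using H by (auto simp: A_def)
  qed
  then have "prob {\<omega> \<in> space M. \<exists>i\<le>n. Y (p i) \<omega> - Y s \<omega> \<ge> x} \<le> prob (\<Union>k\<le>n. A k)"
    using AM by (intro finite_measure_mono) auto
  also have "\<dots> = (\<Sum>k\<le>n. prob (A k))"
    using AM disj by (intro finite_measure_finite_Union) auto
  also have "\<dots> \<le> (\<Sum>k\<le>n. 2 * prob (C k))"
  proof (rule sum_mono)
    fix k assume "k \<in> {..n}"
    then have "p k \<le> p n" using monoD[OF p(3)] by auto
    then have "prob (C k) = measure (centered_normal (v (p n) - v (p k))) {0..} * prob (A k)"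
      unfolding C_def using sp A by (intro conditional_law) auto
    also have "\<dots> \<ge> 1/2 * prob (A k)"
      using sp v_mono[OF _ \<open>p k \<le> p n\<close>] by (intro mult_right_mono centered_normal_nonneg_half) auto
    finally show "prob (A k) \<le> 2 * prob (C k)" by simp
  qed
  also have "\<dots> = 2 * prob (\<Union>k\<le>n. C k)"
  proof -
    have "disjoint_family_on C {..n}"
      using disj by (auto simp: disjoint_family_on_def C_def)
    then have "prob (\<Union>k\<le>n. C k) = (\<Sum>k\<le>n. prob (C k))"
      using CM by (intro finite_measure_finite_Union) auto
    then show ?thesis by (simp add: sum_distrib_left)
  qed
  also have "prob (\<Union>k\<le>n. C k) \<le> prob {\<omega> \<in> space M. Y (p n) \<omega> - Y s \<omega> \<ge> x}"
    by (intro finite_measure_mono) (auto simp: C_def A_def)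
  finally show ?thesis by simp
qed

lemma upper_tail:
  assumes "0 \<le> s" "s \<le> t" "v s < v t" "x \<ge> 0"
  shows "prob {\<omega> \<in> space M. Y t \<omega> - Y s \<omega> \<ge> x} \<le> exp (- x\<^sup>2 / (2 * (v t - v s)))"
proof -
  have "prob {\<omega> \<in> space M. Y t \<omega> - Y s \<omega> \<in> {x..}} = measure std_normal_distribution {x / sqrt (v t - v s)..}"
    using assms by (subst increment_law) (auto simp: centered_normal_tail)
  also have "\<dots> \<le> exp (- (x / sqrt (v t - v s))\<^sup>2 / 2)"
    using assms by (intro std_normal_upper_tail) auto
  also have "(x / sqrt d)\<^sup>2 / 2 = x\<^sup>2 / (2 * d)" if "d > 0" for d
    using that by (simp add: power_divide)
  then have "- (x / sqrt (v t - v s))\<^sup>2 / 2 = - x\<^sup>2 / (2 * (v t - v s))"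
    using assms by (metis diff_gt_0_iff_gt minus_divide_left)
  finally show ?thesis by simp
qed

lemma two_sided_maximal_inequality:
  fixes p :: "nat \<Rightarrow> real"
  assumes p: "0 \<le> s" "s \<le> p 0" "mono p" "p n = t" and st: "v s < v t" and x: "x \<ge> 0"
  shows "prob {\<omega> \<in> space M. \<exists>i\<le>n. \<bar>Y (p i) \<omega> - Y s \<omega>\<bar> \<ge> x} \<le> 4 * exp (- x\<^sup>2 / (2 * (v t - v s)))"
proof -
  interpret neg: gaussian_increments M \<F> "\<lambda>t \<omega>. - Y t \<omega>" v by (rule reflected)
  have sp: "s \<le> p i" "0 \<le> p i" for i
  proof -
    show "s \<le> p i" using p(2) monoD[OF p(3), of 0 i] by simp
    with p(1) show "0 \<le> p i" by (rule order_trans)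
  qed
  have [measurable]: "Y (p k) \<in> borel_measurable M" "Y s \<in> borel_measurable M" for k
    using measurable_Y[OF sp(2)] measurable_Y[OF p(1)] by auto
  have "s \<le> t" using sp[of n] p by simp
  let ?U = "{\<omega> \<in> space M. \<exists>i\<le>n. Y (p i) \<omega> - Y s \<omega> \<ge> x}"
  let ?L = "{\<omega> \<in> space M. \<exists>i\<le>n. - Y (p i) \<omega> - - Y s \<omega> \<ge> x}"
  have "\<bar>a\<bar> \<ge> x \<longleftrightarrow> a \<ge> x \<or> - a \<ge> x" for a by linarith
  then have "{\<omega> \<in> space M. \<exists>i\<le>n. \<bar>Y (p i) \<omega> - Y s \<omega>\<bar> \<ge> x} = ?U \<union> ?L"
    by (simp add: le_diff_eq) blast
  moreover have "?U \<in> events" "?L \<in> events" by measurable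
  ultimately have "prob {\<omega> \<in> space M. \<exists>i\<le>n. \<bar>Y (p i) \<omega> - Y s \<omega>\<bar> \<ge> x} \<le> prob ?U + prob ?L"
    using measure_Un_le[of ?U M ?L] by simp
  moreover have "prob ?U \<le> 2 * exp (- x\<^sup>2 / (2 * (v t - v s)))"
    using levy_maximal_inequality[OF p(1-3), of n x] upper_tail[OF p(1) \<open>s \<le> t\<close> st x] p(4) by simp
  moreover have "prob ?L \<le> 2 * exp (- x\<^sup>2 / (2 * (v t - v s)))"
    using neg.levy_maximal_inequality[OF p(1-3), of n x] neg.upper_tail[OF p(1) \<open>s \<le> t\<close> st x] p(4) by simp
  ultimately show ?thesis by simp
qed

text \<open>Dyadic subdivisions of \<open>[s, t]\<close> give an increasing sequence of events with the same bound; outside their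
union, continuity extends the estimate from dyadic to all times.  The exceptional event is provided as a
witness, since a supremum over uncountably many times is not evidently measurable.\<close>

lemma continuous_maximal_inequality:
  assumes st: "0 \<le> s" "s \<le> t" "v s < v t" and x: "x \<ge> 0"
    and cont: "AE \<omega> in M. continuous_on {0..} (\<lambda>t. Y t \<omega>)"
  shows "\<exists>E\<in>events. prob E \<le> 4 * exp (- x\<^sup>2 / (2 * (v t - v s))) \<and>
           (AE \<omega> in M. \<omega> \<notin> E \<longrightarrow> (\<forall>r\<in>{s..t}. \<bar>Y r \<omega> - Y s \<omega>\<bar> \<le> x))"
proof -
  define q where "q n i = s + (t - s) * (min (real i) (2 ^ n) / 2 ^ n)" for n i
  have q: "0 \<le> s" "s \<le> q n 0" "mono (q n)" "q n (2 ^ n) = t" for n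
    using st by (auto simp: q_def intro!: monoI mult_left_mono divide_right_mono)
  have q0: "q n i \<ge> 0" "q n i \<in> {s..t}" for n i
  proof -
    have "(t - s) * (min (real i) (2 ^ n) / 2 ^ n) \<le> (t - s) * 1" using st by (intro mult_left_mono) auto
    moreover have "(t - s) * (min (real i) (2 ^ n) / 2 ^ n) \<ge> 0" using st by auto
    ultimately show "q n i \<in> {s..t}" by (auto simp: q_def)
    then show "q n i \<ge> 0" using st by auto
  qed
  have [measurable]: "Y (q n k) \<in> borel_measurable M" "Y s \<in> borel_measurable M" for n k
    using measurable_Y q0 st by auto
  define E where "E n = {\<omega> \<in> space M. \<exists>i\<le>2^n. \<bar>Y (q n i) \<omega> - Y s \<omega>\<bar> \<ge> x}" for n :: nat
  have E: "E n \<in> events" for n unfolding E_def by measurable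
  have "incseq E"
  proof (rule incseq_SucI, rule subsetI)
    fix n \<omega> assume "\<omega> \<in> E n"
    then obtain i where i: "\<omega> \<in> space M" "i \<le> 2^n" "\<bar>Y (q n i) \<omega> - Y s \<omega>\<bar> \<ge> x" by (auto simp: E_def)
    have "min (real (2 * i)) (2 ^ Suc n) = 2 * min (real i) (2 ^ n)" by (simp add: min_def)
    then have "q (Suc n) (2 * i) = q n i" unfolding q_def by simp
    then show "\<omega> \<in> E (Suc n)" using i by (auto simp: E_def intro!: exI[of _ "2 * i"])
  qed
  then have lim: "(\<lambda>n. prob (E n)) \<longlonglongrightarrow> prob (\<Union>n. E n)"
    using E by (intro finite_Lim_measure_incseq) auto
  have "prob (E n) \<le> 4 * exp (- x\<^sup>2 / (2 * (v t - v s)))" for n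
    unfolding E_def by (rule two_sided_maximal_inequality[OF q st(3) x])
  then have "prob (\<Union>n. E n) \<le> 4 * exp (- x\<^sup>2 / (2 * (v t - v s)))"
    by (intro LIMSEQ_le_const2[OF lim]) auto
  moreover have "AE \<omega> in M. \<omega> \<notin> (\<Union>n. E n) \<longrightarrow> (\<forall>r\<in>{s..t}. \<bar>Y r \<omega> - Y s \<omega>\<bar> \<le> x)"
    using cont AE_space
  proof eventually_elim
    case (elim \<omega>)
    show ?case
    proof (intro impI ballI)
      fix r assume nE: "\<omega> \<notin> (\<Union>n. E n)" and r: "r \<in> {s..t}"
      have "s < t" using st by (cases "s = t") auto
      define a where "a = (r - s) / (t - s)"
      have a: "0 \<le> a" "a \<le> 1" "r = s + (t - s) * a" using r \<open>s < t\<close> by (auto simp: a_def field_simps)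
      define i where "i n = nat \<lfloor>a * 2 ^ n\<rfloor>" for n :: nat
      have i: "real (i n) \<le> a * 2 ^ n" "a * 2 ^ n \<le> real (i n) + 1" for n
      proof -
        have "real (i n) = of_int \<lfloor>a * 2 ^ n\<rfloor>" using a by (simp add: i_def)
        then show "real (i n) \<le> a * 2 ^ n" "a * 2 ^ n \<le> real (i n) + 1" by linarith+
      qed
      have i2: "real (i n) \<le> 2 ^ n" for n
      proof -
        have "a * 2 ^ n \<le> 1 * 2 ^ n" using a by (intro mult_right_mono) auto
        then show ?thesis using i(1)[of n] by linarith
      qed
      have "(\<lambda>n. real (i n) / 2 ^ n) \<longlonglongrightarrow> a"
      proof (rule tendsto_sandwich[of "\<lambda>n. a - 1 / 2 ^ n" _ _ "\<lambda>n. a"])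
        have "(\<lambda>n. a - (1/2) ^ n) \<longlonglongrightarrow> a - 0" by (intro tendsto_intros LIMSEQ_realpow_zero) auto
        then show "(\<lambda>n. a - 1 / 2 ^ n) \<longlonglongrightarrow> a" by (simp add: power_divide)
        have "a - 1 / 2 ^ n \<le> real (i n) / 2 ^ n" for n using divide_right_mono[OF i(2)[of n], of "2 ^ n"] by (simp add: add_divide_distrib)
        then show "\<forall>\<^sub>F n in sequentially. a - 1 / 2 ^ n \<le> real (i n) / 2 ^ n" by simp
        have "real (i n) / 2 ^ n \<le> a" for n using i(1)[of n] by (simp add: field_simps)
        then show "\<forall>\<^sub>F n in sequentially. real (i n) / 2 ^ n \<le> a" by simp
      qed auto
      then have "(\<lambda>n. s + (t - s) * (real (i n) / 2 ^ n)) \<longlonglongrightarrow> s + (t - s) * a"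
        by (intro tendsto_intros)
      moreover have "q n (i n) = s + (t - s) * (real (i n) / 2 ^ n)" for n
        using i2[of n] by (simp add: q_def min_def)
      ultimately have "(\<lambda>n. q n (i n)) \<longlonglongrightarrow> r" using a by simp
      then have "(\<lambda>n. Y (q n (i n)) \<omega>) \<longlonglongrightarrow> Y r \<omega>"
        using r st q0 by (intro continuous_on_tendsto_compose[OF elim(1)]) auto
      then have "(\<lambda>n. \<bar>Y (q n (i n)) \<omega> - Y s \<omega>\<bar>) \<longlonglongrightarrow> \<bar>Y r \<omega> - Y s \<omega>\<bar>"
        by (intro tendsto_intros)
      moreover have "\<bar>Y (q n (i n)) \<omega> - Y s \<omega>\<bar> \<le> x" for n
      proof -
        have "i n \<le> 2 ^ n" using i2[of n] by (metis of_nat_le_iff of_nat_numeral of_nat_power)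
        moreover have "\<omega> \<notin> E n" using nE by blast
        ultimately have "\<not> \<bar>Y (q n (i n)) \<omega> - Y s \<omega>\<bar> \<ge> x" using elim(2) by (auto simp: E_def)
        then show ?thesis by simp
      qed
      ultimately show "\<bar>Y r \<omega> - Y s \<omega>\<bar> \<le> x" by (intro LIMSEQ_le_const2) auto
    qed
  qed
  ultimately show ?thesis using E by (intro bexI[of _ "\<Union>n. E n"]) auto
qed

text \<open>The probability that a centred Gaussian variable lies in \<open>[-K, K]\<close> tends to \<open>0\<close> as its variance grows.\<close>

lemma unbounded_variance_imp_unbounded:
  assumes "filterlim v at_top at_top"
  shows "AE \<omega> in M. \<forall>K. \<exists>n::nat. \<bar>Y (real n) \<omega> - Y 0 \<omega>\<bar> > K"
proof -
  have "AE \<omega> in M. \<exists>n::nat. \<bar>Y (real n) \<omega> - Y 0 \<omega>\<bar> > real K" for K :: nat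
  proof (rule AE_I')
    have [measurable]: "Y (real n) \<in> borel_measurable M" "Y 0 \<in> borel_measurable M" for n
      by (intro measurable_Y of_nat_0_le_iff order_refl)+
    define E where "E = {\<omega> \<in> space M. \<forall>n::nat. \<bar>Y (real n) \<omega> - Y 0 \<omega>\<bar> \<le> real K}"
    have E: "E \<in> events" unfolding E_def by measurable
    have bound: "prob E \<le> 2 * (real K / sqrt (v (real n) - v 0))" if "v (real n) > v 0" for n
    proof -
      define d where "d = v (real n) - v 0"
      have "d > 0" using that by (simp add: d_def)
      have "E \<subseteq> {\<omega> \<in> space M. Y (real n) \<omega> - Y 0 \<omega> \<in> {- real K..real K}}"
      proof
        fix \<omega> assume "\<omega> \<in> E"
        then have "\<omega> \<in> space M" "\<bar>Y (real n) \<omega> - Y 0 \<omega>\<bar> \<le> real K" by (auto simp only: E_def mem_Collect_eq)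
        then show "\<omega> \<in> {\<omega> \<in> space M. Y (real n) \<omega> - Y 0 \<omega> \<in> {- real K..real K}}"
          unfolding mem_Collect_eq atLeastAtMost_iff by linarith
      qed
      then have "prob E \<le> prob {\<omega> \<in> space M. Y (real n) \<omega> - Y 0 \<omega> \<in> {- real K..real K}}"
        by (intro finite_measure_mono) auto
      also have "\<dots> = measure std_normal_distribution ((\<lambda>z. sqrt d * z) -` {- real K..real K})"
        by (subst increment_law) (auto simp: measure_centered_normal d_def)
      also have "(\<lambda>z. sqrt d * z) -` {- real K..real K} = {- (real K / sqrt d)..real K / sqrt d}"
        using \<open>d > 0\<close> by (auto simp: field_simps)
      also have "measure std_normal_distribution \<dots> \<le> 2 * (real K / sqrt d)"
        using \<open>d > 0\<close> by (intro std_normal_small_ball) auto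
      finally show ?thesis by (simp add: d_def)
    qed
    have v: "filterlim (\<lambda>n. v (real n)) at_top sequentially"
      by (rule filterlim_compose[OF assms filterlim_real_sequentially])
    then have "filterlim (\<lambda>n. sqrt (v (real n) - v 0)) at_top sequentially"
      by (intro filterlim_compose[OF sqrt_at_top] filterlim_tendsto_add_at_top[of "\<lambda>_. - v 0" "- v 0", simplified])
         auto
    then have "(\<lambda>n. 2 * (real K / sqrt (v (real n) - v 0))) \<longlonglongrightarrow> 2 * 0"
      by (intro tendsto_mult_left real_tendsto_divide_at_top[OF tendsto_const])
    moreover have "\<forall>\<^sub>F n in sequentially. v (real n) > v 0"
      using v by (auto simp: filterlim_at_top_dense)
    then have "\<forall>\<^sub>F n in sequentially. prob E \<le> 2 * (real K / sqrt (v (real n) - v 0))"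
      by eventually_elim (rule bound)
    ultimately have "prob E \<le> 2 * 0"
      by (intro tendsto_lowerbound) auto
    then have "prob E = 0" using measure_nonneg[of M E] by simp
    then show "E \<in> null_sets M" using E by (auto simp: null_sets_def emeasure_eq_measure)
    show "{\<omega> \<in> space M. \<not> (\<exists>n::nat. \<bar>Y (real n) \<omega> - Y 0 \<omega>\<bar> > real K)} \<subseteq> E"
      by (auto simp: E_def not_less)
  qed
  then have "AE \<omega> in M. \<forall>K::nat. \<exists>n::nat. \<bar>Y (real n) \<omega> - Y 0 \<omega>\<bar> > real K"
    by (simp add: AE_all_countable)
  then show ?thesis
  proof eventually_elim
    case (elim \<omega>)
    show ?case
    proof
      fix K :: real
      obtain k :: nat where "K \<le> real k" using real_arch_simple by blast
      then show "\<exists>n::nat. \<bar>Y (real n) \<omega> - Y 0 \<omega>\<bar> > K" using elim by (meson le_less_trans)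
    qed
  qed
qed

text \<open>The divergence half of the Borel-Cantelli lemma.  Independence is used one step at a time: the event that
none of the increments from \<open>m\<close> to \<open>n - 1\<close> hits its set belongs to the past at time \<open>\<tau> n\<close>, so its probability is
\<open>\<Prod> (1 - p k) \<le> exp (- \<Sum> p k)\<close>.\<close>

lemma independent_increments_infinitely_often:
  fixes \<tau> :: "nat \<Rightarrow> real"
  assumes \<tau>: "\<And>n. 0 \<le> \<tau> n" "\<And>n. \<tau> n \<le> \<tau> (Suc n)" and S: "\<And>n. S n \<in> sets borel"
    and div: "\<not> summable (\<lambda>n. prob {\<omega> \<in> space M. Y (\<tau> (Suc n)) \<omega> - Y (\<tau> n) \<omega> \<in> S n})"
  shows "AE \<omega> in M. \<exists>\<^sub>\<infinity>n. Y (\<tau> (Suc n)) \<omega> - Y (\<tau> n) \<omega> \<in> S n"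
proof -
  let ?D = "\<lambda>n \<omega>. Y (\<tau> (Suc n)) \<omega> - Y (\<tau> n) \<omega>"
  define p where "p n = prob {\<omega> \<in> space M. ?D n \<omega> \<in> S n}" for n
  have \<tau>_mono: "\<tau> m \<le> \<tau> n" if "m \<le> n" for m n by (rule lift_Suc_mono_le[of \<tau>, OF \<tau>(2) that])
  define C where "C m n = {\<omega> \<in> space M. \<forall>k\<in>{m..<n}. ?D k \<omega> \<notin> S k}" for m n
  have ev: "{\<omega> \<in> space M. ?D k \<omega> \<in> - S k} \<in> sets (\<F> (\<tau> n))" if "k < n" for k n
    using increment_event[of "\<tau> k" "\<tau> (Suc k)" "\<tau> n" "- S k"] \<tau> \<tau>_mono[of "Suc k" n] S[of k] that
    by auto
  have C: "C m n \<in> sets (\<F> (\<tau> n))" for m n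
  proof -
    have "C m n = space (\<F> (\<tau> n)) \<inter> (\<Inter>k\<in>{m..<n}. {\<omega> \<in> space M. ?D k \<omega> \<in> - S k})"
      using space_filtration[OF \<tau>(1)] by (auto simp: C_def)
    also have "\<dots> \<in> sets (\<F> (\<tau> n))"
    proof (cases "m < n")
      case True
      then show ?thesis using ev by (intro sets.Int sets.top sets.finite_INT) auto
    qed auto
    finally show ?thesis .
  qed
  have CM: "C m n \<in> events" for m n using events[OF \<tau>(1) C] .
  have step: "prob (C m (Suc n)) = (1 - p n) * prob (C m n)" if "m \<le> n" for m n
  proof -
    have "C m (Suc n) = {\<omega> \<in> space M. ?D n \<omega> \<in> - S n} \<inter> C m n"
      using that by (auto simp: C_def less_Suc_eq)
    moreover have "prob \<dots> = prob {\<omega> \<in> space M. ?D n \<omega> \<in> - S n} * prob (C m n)"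
      using \<tau> S[of n] by (intro independent_increment C) auto
    moreover have "prob {\<omega> \<in> space M. ?D n \<omega> \<in> - S n} = 1 - p n"
    proof -
      have "{\<omega> \<in> space M. ?D n \<omega> \<in> S n} \<in> events"
        using events[OF \<tau>(1) increment_event[of "\<tau> n" "\<tau> (Suc n)" "\<tau> (Suc n)" "S n"]] \<tau> S by auto
      moreover have "{\<omega> \<in> space M. ?D n \<omega> \<in> - S n} = space M - {\<omega> \<in> space M. ?D n \<omega> \<in> S n}" by auto
      ultimately show ?thesis unfolding p_def by (simp add: prob_compl)
    qed
    ultimately show ?thesis by simp
  qed
  have p01: "0 \<le> p n" "p n \<le> 1" for n by (auto simp: p_def)
  have exp_bound: "prob (C m n) \<le> exp (- (\<Sum>k\<in>{m..<n}. p k))" if "m \<le> n" for m n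
    using that
  proof (induction n rule: dec_induct)
    case base
    show ?case by simp
  next
    case (step n)
    have "prob (C m (Suc n)) \<le> exp (- p n) * exp (- (\<Sum>k\<in>{m..<n}. p k))"
      unfolding \<open>m \<le> n\<close>[THEN \<open>\<And>m n. m \<le> n \<Longrightarrow> prob (C m (Suc n)) = (1 - p n) * prob (C m n)\<close>]
      using exp_ge_add_one_self[of "- p n"] step p01[of n] by (intro mult_mono) auto
    then show ?case using step by (simp add: exp_add[symmetric] add.commute)
  qed
  have null: "(\<Inter>n. C m n) \<in> null_sets M" for m
  proof -
    have "prob (\<Inter>n. C m n) \<le> e" if "e > 0" for e
    proof -
      have "\<exists>n\<ge>m. (\<Sum>k\<in>{m..<n}. p k) \<ge> - ln e"
      proof (rule ccontr)
        assume "\<not> ?thesis"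
        then have less: "(\<Sum>k\<in>{m..<n}. p k) \<le> - ln e" if "n \<ge> m" for n using that by force
        have "summable (\<lambda>k. p (k + m))"
        proof (rule bounded_imp_summable[where B="- ln e"])
          fix n
          have "(\<Sum>k\<le>n. p (k + m)) = (\<Sum>k\<in>{m..<Suc n + m}. p k)"
            using sum.shift_bounds_nat_ivl[of p 0 m "Suc n"] by (simp add: atLeast0LessThan lessThan_Suc_atMost)
          then show "(\<Sum>k\<le>n. p (k + m)) \<le> - ln e" using less[of "Suc n + m"] by simp
        qed (use p01 in auto)
        then have "summable p" by (simp only: summable_iff_shift)
        then show False using div by (simp add: p_def[abs_def])
      qed
      then obtain n where n: "n \<ge> m" "(\<Sum>k\<in>{m..<n}. p k) \<ge> - ln e" by blast
      have "prob (\<Inter>n. C m n) \<le> prob (C m n)" using CM by (intro finite_measure_mono) auto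
      also have "\<dots> \<le> exp (- (\<Sum>k\<in>{m..<n}. p k))" by (rule exp_bound[OF n(1)])
      also have "\<dots> \<le> exp (ln e)" using n by (subst exp_le_cancel_iff) simp
      finally show ?thesis using that by simp
    qed
    then have "prob (\<Inter>n. C m n) \<le> 0" by (rule field_le_epsilon) simp
    then have "prob (\<Inter>n. C m n) = 0" by (rule antisym) simp
    then show ?thesis using CM by (auto simp: null_sets_def emeasure_eq_measure)
  qed
  have "AE \<omega> in M. \<omega> \<notin> (\<Inter>n. C m n)" for m by (rule AE_not_in[OF null])
  then have "AE \<omega> in M. \<forall>m. \<omega> \<notin> (\<Inter>n. C m n)" by (simp add: AE_all_countable)
  then show ?thesis using AE_space
  proof eventually_elim
    case (elim \<omega>)
    show ?case unfolding INFM_nat_le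
    proof
      fix m
      obtain n where "\<omega> \<notin> C m n" using elim by auto
      then show "\<exists>n\<ge>m. ?D n \<omega> \<in> S n" using elim by (auto simp: C_def)
    qed
  qed
qed

end

section \<open>Oscillation along times that halve the remaining variance\<close>

text \<open>The normalising function of the law of the iterated logarithm for Brownian motion at \<open>0\<close>.
  It is meant for small \<open>x\<close>: the iterated logarithm is positive for \<open>0 < x < exp (-1)\<close>.\<close>

definition lil :: "real \<Rightarrow> real" where
  "lil x = sqrt (2 * x * ln (ln (1 / x)))"

lemma log_of_halving:
  assumes "c > 0"
  shows "ln (1 / (c / 2 ^ n)) = real n * ln 2 - ln c"
  using assms by (simp add: ln_div ln_mult ln_realpow)

lemma log_of_halving_bounds:
  assumes "c > 0"
  shows "\<forall>\<^sub>F n in sequentially. ln (1 / (c / 2 ^ n)) \<ge> real n / 2"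
    and "\<forall>\<^sub>F n in sequentially. ln (1 / (c / 2 ^ n)) \<le> real n"
    and "\<forall>\<^sub>F n in sequentially. ln (1 / (c / 2 ^ n)) \<ge> C"
proof -
  have 1: "\<forall>\<^sub>F n in sequentially. real n \<ge> a" for a
    by (rule eventually_sequentiallyI[of "nat \<lceil>a\<rceil>"]) linarith
  have l2: "2/3 \<le> ln (2::real)" "ln (2::real) \<le> 25/36"
    using ln2_ge_two_thirds ln2_le_25_over_36 by auto
  have e1: "real n * (2/3) \<le> real n * ln 2" "real n * ln 2 \<le> real n * (25/36)" for n
    by (intro mult_left_mono l2 of_nat_0_le_iff)+
  show "\<forall>\<^sub>F n in sequentially. ln (1 / (c / 2 ^ n)) \<ge> real n / 2"
    using 1[of "6 * \<bar>ln c\<bar>"]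
  proof eventually_elim
    case (elim n)
    then show ?case unfolding log_of_halving[OF assms] using e1[of n] by linarith
  qed
  show "\<forall>\<^sub>F n in sequentially. ln (1 / (c / 2 ^ n)) \<le> real n"
    using 1[of "6 * \<bar>ln c\<bar>"]
  proof eventually_elim
    case (elim n)
    then show ?case unfolding log_of_halving[OF assms] using e1[of n] by linarith
  qed
  show "\<forall>\<^sub>F n in sequentially. ln (1 / (c / 2 ^ n)) \<ge> C"
    using 1[of "6 * \<bar>ln c\<bar> + 6 * \<bar>C\<bar>"]
  proof eventually_elim
    case (elim n)
    then show ?case unfolding log_of_halving[OF assms] using e1[of n] by linarith
  qed
qed

text \<open>Halving the argument multiplies \<open>lil\<close> by a factor that tends to \<open>1 / sqrt 2\<close>, since the iterated logarithm
hardly changes; \<open>4/5\<close> and \<open>1/2\<close> are convenient numbers on either side.\<close>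

lemma lil_halving_steps:
  assumes "c > 0"
  shows "\<forall>\<^sub>F n in sequentially. lil (c / 2 ^ Suc n) \<le> 4/5 * lil (c / 2 ^ n)"
    and "\<forall>\<^sub>F n in sequentially. lil (c / 2 ^ n) \<le> 2 * lil (c / 2 ^ Suc n)"
    and "\<forall>\<^sub>F n in sequentially. lil (c / 2 ^ n) > 0"
proof -
  define L where "L n = ln (1 / (c / 2 ^ n))" for n :: nat
  have L_Suc: "L (Suc n) = L n + ln 2" for n
    unfolding L_def log_of_halving[OF assms] by (simp add: algebra_simps)
  have big: "\<forall>\<^sub>F n in sequentially. L n \<ge> exp 1" unfolding L_def by (rule log_of_halving_bounds[OF assms])
  have l2: "0 \<le> ln (2::real)" "ln (2::real) \<le> 7/10"
    using ln2_ge_two_thirds ln2_le_25_over_36 by auto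
  have e: "exp (1::real) \<ge> 5/2" using exp_lower_Taylor_quadratic[of "1::real"] by simp
  have main: "lil (c / 2 ^ Suc n) \<le> 4/5 * lil (c / 2 ^ n) \<and> lil (c / 2 ^ n) \<le> 2 * lil (c / 2 ^ Suc n)
      \<and> lil (c / 2 ^ n) > 0" if n: "L n \<ge> exp 1" for n
  proof -
    define x where "x = c / 2 ^ n"
    have x: "x > 0" "c / 2 ^ Suc n = x / 2" using assms by (auto simp: x_def)
    have Lp: "L n > 0" "L n \<ge> 5/2" using n e by (auto intro: less_le_trans[OF exp_gt_zero])
    have ll: "ln (L n) \<ge> 1" using n Lp by (metis ln_exp ln_le_cancel_iff exp_gt_zero)
    have ll': "ln (L n) \<le> ln (L (Suc n))" unfolding L_Suc using Lp l2 by (intro ln_mono) auto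
    have "ln (L (Suc n)) - ln (L n) \<le> ln 2 / L n"
      using ln_diff_le[of "L n + ln 2" "L n"] Lp l2 by (simp add: L_Suc)
    also have "\<dots> \<le> (7/10) / (5/2)" using Lp l2 by (intro frac_le) auto
    finally have "ln (L (Suc n)) \<le> 32/25 * ln (L n)" using ll by simp
    then have "x * ln (L (Suc n)) \<le> x * (32/25 * ln (L n))" using x by (intro mult_left_mono) auto
    then have "sqrt (2 * (x/2) * ln (L (Suc n))) \<le> sqrt ((4/5)\<^sup>2 * (2 * x * ln (L n)))"
      by (intro real_sqrt_le_mono) (simp add: power2_eq_square)
    also have "\<dots> = 4/5 * sqrt (2 * x * ln (L n))"
      unfolding real_sqrt_mult[of "(4/5)\<^sup>2"] real_sqrt_abs by simp
    finally have 1: "lil (c / 2 ^ Suc n) \<le> 4/5 * lil (c / 2 ^ n)"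
      unfolding lil_def L_def[symmetric] x(2)[symmetric] by (simp add: x_def)
    have "x * ln (L n) \<le> x * ln (L (Suc n))" using x ll' by (intro mult_left_mono) auto
    moreover have "0 \<le> x * ln (L (Suc n))" using x ll ll' by auto
    ultimately have "sqrt (2 * x * ln (L n)) \<le> sqrt (2\<^sup>2 * (2 * (x/2) * ln (L (Suc n))))"
      by (intro real_sqrt_le_mono) (simp add: power2_eq_square)
    also have "\<dots> = 2 * sqrt (2 * (x/2) * ln (L (Suc n)))"
      unfolding real_sqrt_mult[of "2\<^sup>2"] real_sqrt_abs by simp
    finally have 2: "lil (c / 2 ^ n) \<le> 2 * lil (c / 2 ^ Suc n)"
      unfolding lil_def L_def[symmetric] x(2)[symmetric] by (simp add: x_def)
    have "lil (c / 2 ^ n) = sqrt (2 * x * ln (L n))" by (simp add: lil_def L_def x_def)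
    then have "lil (c / 2 ^ n) > 0" using x ll by simp
    with 1 2 show ?thesis by blast
  qed
  show "\<forall>\<^sub>F n in sequentially. lil (c / 2 ^ Suc n) \<le> 4/5 * lil (c / 2 ^ n)"
    using main by (auto intro: eventually_mono[OF big])
  show "\<forall>\<^sub>F n in sequentially. lil (c / 2 ^ n) \<le> 2 * lil (c / 2 ^ Suc n)"
    using main by (auto intro: eventually_mono[OF big])
  show "\<forall>\<^sub>F n in sequentially. lil (c / 2 ^ n) > 0"
    using main by (auto intro: eventually_mono[OF big])
qed

text \<open>When \<open>c\<close> is the total remaining variance at \<open>\<tau> 0\<close>, the variance remaining at \<open>\<tau> n\<close> is \<open>c / 2 ^ n\<close>, half of
which is used up between \<open>\<tau> n\<close> and \<open>\<tau> (n + 1)\<close>.\<close>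

locale variance_halving = gaussian_increments +
  fixes \<tau> :: "nat \<Rightarrow> real" and c :: real
  assumes c_pos: "c > 0"
    and times: "0 \<le> \<tau> n" "\<tau> n \<le> \<tau> (Suc n)"
    and halving: "v (\<tau> (Suc n)) - v (\<tau> n) = c / 2 ^ n / 2"
begin

text \<open>With \<open>L = ln (2\<^sup>n / c)\<close>, which is of order \<open>n\<close>, the threshold is \<open>sqrt (ln L)\<close> standard deviations.  It is exceeded
with probability at least a multiple of \<open>exp (- ln L) = 1 / L\<close>, and the harmonic series diverges.\<close>

lemma increments_infinitely_often_large:
  "AE \<omega> in M. \<exists>\<^sub>\<infinity>n. Y (\<tau> (Suc n)) \<omega> - Y (\<tau> n) \<omega> \<ge> lil (c / 2 ^ n) / 2"
proof -
  define p where "p n = prob {\<omega> \<in> space M. Y (\<tau> (Suc n)) \<omega> - Y (\<tau> n) \<omega> \<in> {lil (c / 2 ^ n) / 2..}}" for n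
  define C where "C = exp (- 1) / sqrt (2 * pi)"
  have "C > 0" by (simp add: C_def)
  have "\<forall>\<^sub>F n in sequentially. norm (C * (1 / real n)) \<le> p n"
    using log_of_halving_bounds(2)[OF c_pos] log_of_halving_bounds(3)[OF c_pos, of "exp 1"]
  proof eventually_elim
    case (elim n)
    define X where "X = c / 2 ^ n"
    define L where "L = ln (1 / X)"
    have L: "exp 1 \<le> L" "L \<le> real n" using elim by (auto simp: L_def X_def)
    then have "L > 0" by (auto intro: less_le_trans[OF exp_gt_zero])
    then have ll: "ln L \<ge> 1" using L(1) by (metis ln_exp ln_le_cancel_iff exp_gt_zero)
    have X: "X > 0" using c_pos by (simp add: X_def)
    have "lil X / 2 / sqrt (X / 2) = sqrt (2 * X * ln L) / (sqrt 4 * sqrt (X / 2))"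
      by (simp add: lil_def L_def)
    also have "\<dots> = sqrt (2 * X * ln L / (4 * (X / 2)))"
      by (simp only: real_sqrt_mult[symmetric] real_sqrt_divide[symmetric])
    also have "2 * X * ln L / (4 * (X / 2)) = ln L" using X by simp
    finally have y: "lil X / 2 / sqrt (X / 2) = sqrt (ln L)" .
    have "v (\<tau> (Suc n)) - v (\<tau> n) = X / 2" by (simp add: halving X_def)
    then have "p n = measure (centered_normal (X / 2)) {lil X / 2..}"
      unfolding p_def using times by (subst increment_law) (auto simp: X_def)
    also have "\<dots> = measure std_normal_distribution {sqrt (ln L)..}"
      using X by (subst centered_normal_tail) (simp_all only: y half_gt_zero)
    also have "\<dots> \<ge> exp (- 1 - (sqrt (ln L))\<^sup>2) / sqrt (2 * pi)"
      using ll by (intro std_normal_lower_tail) simp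
    finally have "p n \<ge> exp (- 1 - (sqrt (ln L))\<^sup>2) / sqrt (2 * pi)" .
    also have "exp (- 1 - (sqrt (ln L))\<^sup>2) / sqrt (2 * pi) = C * (1 / L)"
    proof -
      have "(sqrt (ln L))\<^sup>2 = ln L" using ll by (intro real_sqrt_pow2) simp
      then show ?thesis using \<open>L > 0\<close> by (simp add: C_def exp_diff exp_minus field_simps)
    qed
    finally have "C * (1 / L) \<le> p n" .
    moreover have "C * (1 / real n) \<le> C * (1 / L)"
      using \<open>C > 0\<close> \<open>L > 0\<close> L by (intro mult_left_mono divide_left_mono) auto
    ultimately show ?case using \<open>C > 0\<close> by simp
  qed
  then have "summable (\<lambda>n. C * (1 / real n))" if "summable p"
    using that by (rule summable_comparison_test_ev)
  moreover have "\<not> summable (\<lambda>n. C * (1 / real n))"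
    using \<open>C > 0\<close> not_summable_harmonic[where 'a=real]
      summable_cmult_iff[of C "\<lambda>n. 1 / real n"] by (simp add: inverse_eq_divide)
  ultimately have "\<not> summable p" by blast
  then have "AE \<omega> in M. \<exists>\<^sub>\<infinity>n. Y (\<tau> (Suc n)) \<omega> - Y (\<tau> n) \<omega> \<in> {lil (c / 2 ^ n) / 2..}"
    unfolding p_def by (intro independent_increments_infinitely_often times) auto
  then show ?thesis by simp
qed

text \<open>The level \<open>lil (c / 2 ^ n)\<close> is \<open>2 sqrt (ln L)\<close> standard deviations of the increment, so the maximal inequality
bounds the probability of exceeding it by \<open>4 exp (- 2 ln L) = 4 / L\<^sup>2\<close>, which is summable as \<open>L\<close> is of order \<open>n\<close>.\<close>

lemma oscillations_eventually_small:
  assumes cont: "AE \<omega> in M. continuous_on {0..} (\<lambda>t. Y t \<omega>)"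
  shows "AE \<omega> in M. \<forall>\<^sub>F n in sequentially. \<forall>r\<in>{\<tau> n..\<tau> (Suc n)}. \<bar>Y r \<omega> - Y (\<tau> n) \<omega>\<bar> \<le> lil (c / 2 ^ n)"
proof -
  define L where "L n = ln (1 / (c / 2 ^ n))" for n :: nat
  \<comment> \<open>For the finitely many \<open>n\<close> at which \<open>lil (c / 2 ^ n)\<close> may be negative, the exceptional event is the whole space.\<close>
  define good where "good n E \<longleftrightarrow> (L n \<ge> exp 1 \<longrightarrow> prob E \<le> 4 / (L n)\<^sup>2) \<and>
      (AE \<omega> in M. \<omega> \<notin> E \<longrightarrow> (\<forall>r\<in>{\<tau> n..\<tau> (Suc n)}. \<bar>Y r \<omega> - Y (\<tau> n) \<omega>\<bar> \<le> lil (c / 2 ^ n)))" for n E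
  have "\<exists>E. E \<in> events \<and> good n E" for n
  proof (cases "L n \<ge> exp 1")
    case True
    define X where "X = c / 2 ^ n"
    have X: "X > 0" using c_pos by (simp add: X_def)
    have "L n > 0" using True by (auto intro: less_le_trans[OF exp_gt_zero])
    then have ll: "ln (L n) \<ge> 1" using True by (metis ln_exp ln_le_cancel_iff exp_gt_zero)
    have d: "v (\<tau> (Suc n)) - v (\<tau> n) = X / 2" by (simp add: halving X_def)
    have lil: "lil X = sqrt (2 * X * ln (L n))" by (simp add: lil_def L_def X_def)
    have "lil X \<ge> 0" unfolding lil using X ll by simp
    moreover have "v (\<tau> n) < v (\<tau> (Suc n))" using d X by linarith
    ultimately obtain E where E: "E \<in> events" "prob E \<le> 4 * exp (- (lil X)\<^sup>2 / (2 * (v (\<tau> (Suc n)) - v (\<tau> n))))"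
      "AE \<omega> in M. \<omega> \<notin> E \<longrightarrow> (\<forall>r\<in>{\<tau> n..\<tau> (Suc n)}. \<bar>Y r \<omega> - Y (\<tau> n) \<omega>\<bar> \<le> lil X)"
      using continuous_maximal_inequality[OF times _ _ cont] by blast
    have "(lil X)\<^sup>2 = 2 * X * ln (L n)" unfolding lil using X ll by simp
    then have "- (lil X)\<^sup>2 / (2 * (v (\<tau> (Suc n)) - v (\<tau> n))) = - (2 * ln (L n))"
      using X by (simp add: d)
    also have "exp \<dots> = 1 / (L n)\<^sup>2"
      using \<open>L n > 0\<close> by (simp add: exp_minus inverse_eq_divide exp_double)
    finally have "prob E \<le> 4 / (L n)\<^sup>2" using E(2) by simp
    then show ?thesis using E by (auto simp: X_def good_def)
  next
    case False
    then show ?thesis by (intro exI[of _ "space M"]) (auto simp: good_def)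
  qed
  then obtain E where E_good: "\<And>n. E n \<in> events" "\<And>n. good n (E n)" by metis
  have E: "E n \<in> events" "L n \<ge> exp 1 \<Longrightarrow> prob (E n) \<le> 4 / (L n)\<^sup>2"
    "AE \<omega> in M. \<omega> \<notin> E n \<longrightarrow> (\<forall>r\<in>{\<tau> n..\<tau> (Suc n)}. \<bar>Y r \<omega> - Y (\<tau> n) \<omega>\<bar> \<le> lil (c / 2 ^ n))" for n
    using E_good[of n] by (auto simp only: good_def)
  have "\<forall>\<^sub>F n in sequentially. norm (prob (E n)) \<le> 16 * (1 / (real n)\<^sup>2)"
    using log_of_halving_bounds(1)[OF c_pos] log_of_halving_bounds(3)[OF c_pos, of "exp 1"] eventually_gt_at_top[of 0]
  proof eventually_elim
    case (elim n)
    have "prob (E n) \<le> 4 / (L n)\<^sup>2" using elim by (intro E) (auto simp: L_def)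
    also have "\<dots> \<le> 4 / (real n / 2)\<^sup>2"
      using elim by (intro divide_left_mono power_mono mult_pos_pos zero_less_power) (auto simp: L_def intro: less_le_trans)
    also have "\<dots> = 16 * (1 / (real n)\<^sup>2)" by (simp add: power_divide)
    finally show ?case by simp
  qed
  moreover have "summable (\<lambda>n. 16 * (1 / (real n)\<^sup>2))"
    using inverse_power_summable[of 2, where 'a=real] by (intro summable_mult) (simp add: inverse_eq_divide)
  ultimately have "summable (\<lambda>n. prob (E n))" by (rule summable_comparison_test_ev)
  then have "AE \<omega> in M. \<forall>\<^sub>F n in sequentially. \<omega> \<in> space M - E n"
    using E by (intro borel_cantelli_AE1) (auto simp: emeasure_eq_measure)
  moreover have "AE \<omega> in M. \<forall>n. \<omega> \<notin> E n \<longrightarrow> (\<forall>r\<in>{\<tau> n..\<tau> (Suc n)}. \<bar>Y r \<omega> - Y (\<tau> n) \<omega>\<bar> \<le> lil (c / 2 ^ n))"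
    using E(3) by (simp add: AE_all_countable)
  ultimately show ?thesis
  proof eventually_elim
    case (elim \<omega>)
    from elim(1) show ?case by eventually_elim (use elim(2) in auto)
  qed
qed

end

text \<open>The oscillation after \<open>\<tau> n\<close> is at most the geometric sum \<open>h n (1 + 4/5 + \<dots>) = 5 h n\<close>.  A time in
\<open>[\<tau> n, \<tau> (n + 1)]\<close> is compared with \<open>\<tau> (n + 1)\<close>, where \<open>G\<close> is smaller; the comparability of \<open>h n\<close> and \<open>h (n + 1)\<close>
pays for this shift.\<close>

lemma geometric_oscillations_imp_small_tail:
  fixes y G :: "real \<Rightarrow> real" and \<tau> h :: "nat \<Rightarrow> real"
  assumes \<tau>: "\<And>n. 0 \<le> \<tau> n" "\<And>n. \<tau> n \<le> \<tau> (Suc n)" "filterlim \<tau> at_top sequentially"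
    and G: "\<And>t. t \<ge> 0 \<Longrightarrow> G t > 0" "\<And>s t. 0 \<le> s \<Longrightarrow> s \<le> t \<Longrightarrow> G t \<le> G s"
    and osc: "\<forall>\<^sub>F n in sequentially. \<forall>r\<in>{\<tau> n..\<tau> (Suc n)}. \<bar>y r - y (\<tau> n)\<bar> \<le> h n"
    and h: "\<forall>\<^sub>F n in sequentially. h (Suc n) \<le> 4/5 * h n" "\<forall>\<^sub>F n in sequentially. h n \<le> 2 * h (Suc n)"
      "\<forall>\<^sub>F n in sequentially. h n > 0"
    and hG: "(\<lambda>n. h n / G (\<tau> n)) \<longlonglongrightarrow> 0"
  shows "\<exists>l. ((\<lambda>t. (l - y t) / G t) \<longlongrightarrow> 0) at_top"
proof -
  have \<tau>_mono: "\<tau> m \<le> \<tau> n" if "m \<le> n" for m n by (rule lift_Suc_mono_le[of \<tau>, OF \<tau>(2) that])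
  have "\<forall>\<^sub>F n in sequentially. (\<forall>r\<in>{\<tau> n..\<tau> (Suc n)}. \<bar>y r - y (\<tau> n)\<bar> \<le> h n) \<and>
      h (Suc n) \<le> 4/5 * h n \<and> h n \<le> 2 * h (Suc n) \<and> h n > 0"
    by (intro eventually_conj osc h)
  then obtain N where N: "\<And>n r. n \<ge> N \<Longrightarrow> r \<in> {\<tau> n..\<tau> (Suc n)} \<Longrightarrow> \<bar>y r - y (\<tau> n)\<bar> \<le> h n"
    "\<And>n. n \<ge> N \<Longrightarrow> h (Suc n) \<le> 4/5 * h n" "\<And>n. n \<ge> N \<Longrightarrow> h n \<le> 2 * h (Suc n)" "\<And>n. n \<ge> N \<Longrightarrow> h n > 0"
    unfolding eventually_sequentially by blast
  have block: "\<exists>n\<ge>N'. s \<in> {\<tau> n..\<tau> (Suc n)}" if "s \<ge> \<tau> N'" for s N'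
  proof -
    have "\<exists>m. m \<ge> N' \<and> s \<le> \<tau> (Suc m)"
    proof -
      have "\<forall>\<^sub>F n in sequentially. s \<le> \<tau> n" using \<tau>(3) by (simp add: filterlim_at_top)
      then obtain k where "\<And>n. n \<ge> k \<Longrightarrow> s \<le> \<tau> n" by (auto simp: eventually_sequentially)
      then show ?thesis by (intro exI[of _ "max k N'"]) auto
    qed
    then obtain m where m: "m \<ge> N'" "s \<le> \<tau> (Suc m)" and least: "\<And>k. k < m \<Longrightarrow> \<not> (k \<ge> N' \<and> s \<le> \<tau> (Suc k))"
      using exists_least_iff[of "\<lambda>m. m \<ge> N' \<and> s \<le> \<tau> (Suc m)"] by blast
    have "s \<ge> \<tau> m"
    proof (cases "m = N'")
      case False
      then obtain k where "m = Suc k" "k \<ge> N'" using m by (cases m) auto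
      then show ?thesis using least[of k] by auto
    qed (use that in simp)
    then show ?thesis using m by auto
  qed
  have far: "\<bar>y s - y (\<tau> n)\<bar> \<le> 5 * h n" if "n \<ge> N" "s \<in> {\<tau> (n + j)..\<tau> (Suc (n + j))}" for n j s
    using that
  proof (induction j arbitrary: n)
    case 0
    then show ?case using N(1)[of n s] N(4)[of n] by simp
  next
    case (Suc j)
    have "\<bar>y s - y (\<tau> (Suc n))\<bar> \<le> 5 * h (Suc n)" using Suc.IH[of "Suc n"] Suc.prems by auto
    moreover have "\<bar>y (\<tau> (Suc n)) - y (\<tau> n)\<bar> \<le> h n" using N(1)[of n "\<tau> (Suc n)"] \<tau>(2)[of n] Suc.prems by auto
    ultimately show ?case using N(2)[of n] Suc.prems by linarith
  qed
  have cauchy: "\<exists>T\<ge>0. \<forall>r\<ge>T. \<forall>s\<ge>r. \<bar>y s - y r\<bar> \<le> \<epsilon> * G r" if "\<epsilon> > 0" for \<epsilon>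
  proof -
    have "\<forall>\<^sub>F n in sequentially. h n / G (\<tau> n) < \<epsilon> / 12" using hG that by (intro order_tendstoD) auto
    then obtain N' where N': "\<And>n. n \<ge> N' \<Longrightarrow> h n / G (\<tau> n) < \<epsilon> / 12" by (auto simp: eventually_sequentially)
    have "\<bar>y s - y r\<bar> \<le> \<epsilon> * G r" if r: "r \<ge> \<tau> (max N N')" and s: "s \<ge> r" for r s
    proof -
      obtain n where n: "n \<ge> max N N'" "r \<in> {\<tau> n..\<tau> (Suc n)}" using block[OF r] by blast
      have "s \<ge> \<tau> n" using n s by auto
      from block[OF this] obtain m where m: "m \<ge> n" "s \<in> {\<tau> m..\<tau> (Suc m)}" by blast
      have "\<bar>y s - y (\<tau> n)\<bar> \<le> 5 * h n" using far[of n s "m - n"] m n by auto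
      moreover have "\<bar>y r - y (\<tau> n)\<bar> \<le> h n" using N(1)[of n r] n by auto
      ultimately have "\<bar>y s - y r\<bar> \<le> 6 * h n" by linarith
      also have "\<dots> \<le> 12 * h (Suc n)" using N(3)[of n] n by auto
      also have "\<dots> \<le> \<epsilon> * G (\<tau> (Suc n))"
        using N'[of "Suc n"] n G(1)[OF \<tau>(1), of "Suc n"] by (auto simp: field_simps)
      also have "\<dots> \<le> \<epsilon> * G r"
        using n G(2)[of r "\<tau> (Suc n)"] \<tau>(1)[of n] \<open>\<epsilon> > 0\<close> by (intro mult_left_mono) auto
      finally show ?thesis .
    qed
    then show ?thesis using \<tau>(1) by blast
  qed
  have "Cauchy (\<lambda>n. y (real n))"
  proof (rule metric_CauchyI)
    fix e :: real assume "e > 0"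
    then have "e / (2 * G 0) > 0" using G(1)[of 0] by simp
    from cauchy[OF this] obtain T where T: "T \<ge> 0" "\<And>r s. r \<ge> T \<Longrightarrow> s \<ge> r \<Longrightarrow> \<bar>y s - y r\<bar> \<le> e / (2 * G 0) * G r"
      by blast
    have *: "\<bar>y s - y r\<bar> < e" if "r \<ge> T" "s \<ge> r" for r s
    proof -
      have "e / (2 * G 0) * G r \<le> e / (2 * G 0) * G 0"
        using \<open>e / (2 * G 0) > 0\<close> T that G(2)[of 0 r] by (intro mult_left_mono) auto
      also have "\<dots> = e / 2" using G(1)[of 0] by simp
      finally have "\<bar>y s - y r\<bar> \<le> e / 2" using T(2)[OF that] by linarith
      then show ?thesis using \<open>e > 0\<close> by simp
    qed
    obtain k :: nat where k: "T \<le> real k" using real_arch_simple by blast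
    have "dist (y (real m)) (y (real n)) < e" if "m \<ge> k" "n \<ge> k" for m n
    proof (cases "m \<le> n")
      case True
      then show ?thesis using *[of "real m" "real n"] k that by (simp add: dist_real_def abs_minus_commute)
    next
      case False
      then show ?thesis using *[of "real n" "real m"] k that by (simp add: dist_real_def)
    qed
    then show "\<exists>k. \<forall>m\<ge>k. \<forall>n\<ge>k. dist (y (real m)) (y (real n)) < e" by blast
  qed
  then obtain l where l: "(\<lambda>n. y (real n)) \<longlonglongrightarrow> l" using Cauchy_convergent convergent_def by blast
  have "((\<lambda>t. (l - y t) / G t) \<longlongrightarrow> 0) at_top"
  proof (rule tendstoI)
    fix e :: real assume "e > 0"
    then have "e/2 > 0" by simp
    from cauchy[OF this] obtain T where T: "T \<ge> 0" "\<And>r s. r \<ge> T \<Longrightarrow> s \<ge> r \<Longrightarrow> \<bar>y s - y r\<bar> \<le> e/2 * G r" by blast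
    have "dist ((l - y r) / G r) 0 < e" if "r \<ge> T" for r
    proof -
      have "(\<lambda>n. \<bar>y (real n) - y r\<bar>) \<longlonglongrightarrow> \<bar>l - y r\<bar>" by (intro tendsto_intros l)
      moreover have "\<forall>\<^sub>F n in sequentially. \<bar>y (real n) - y r\<bar> \<le> e/2 * G r"
        by (rule eventually_sequentiallyI[of "nat \<lceil>r\<rceil>"]) (rule T(2)[OF that], linarith)
      ultimately have "\<bar>l - y r\<bar> \<le> e/2 * G r" by (intro tendsto_upperbound) auto
      then have "\<bar>l - y r\<bar> / G r \<le> e/2" using G(1)[of r] that T(1) by (simp add: field_simps)
      then have "\<bar>l - y r\<bar> / G r < e" using \<open>e > 0\<close> by linarith
      then show ?thesis using G(1)[of r] that T(1) by (simp add: abs_of_pos)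
    qed
    then show "\<forall>\<^sub>F t in at_top. dist ((l - y t) / G t) 0 < e"
      by (auto simp: eventually_at_top_linorder)
  qed
  then show ?thesis by blast
qed

section \<open>Filtrations and increments of Brownian motion\<close>

text \<open>Identities for events of the natural filtration thus extend to the completed one.\<close>

lemma completed_sets_representative:
  assumes "subalgebra M F" "A \<in> sigma_sets (space M) (sets F \<union> null_sets M)"
  shows "\<exists>A'\<in>sets F. AE \<omega> in M. \<omega> \<in> A \<longleftrightarrow> \<omega> \<in> A'"
  using assms(2)
proof induction
  case (Basic A)
  then show ?case
  proof
    assume "A \<in> null_sets M"
    then show ?thesis by (intro bexI[of _ "{}"]) (auto dest: AE_not_in)
  qed auto
next
  case Empty
  then show ?case by (intro bexI[of _ "{}"]) auto
next
  case (Compl A)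
  then obtain A' where A': "A' \<in> sets F" "AE \<omega> in M. \<omega> \<in> A \<longleftrightarrow> \<omega> \<in> A'" by blast
  have "AE \<omega> in M. \<omega> \<in> space M - A \<longleftrightarrow> \<omega> \<in> space F - A'"
    using A'(2) AE_space by eventually_elim (use assms(1) in \<open>auto simp: subalgebra_def\<close>)
  then show ?case using A' by (intro bexI[of _ "space F - A'"]) auto
next
  case (Union A)
  then obtain A' where A': "\<And>i. A' i \<in> sets F" "\<And>i. AE \<omega> in M. \<omega> \<in> A i \<longleftrightarrow> \<omega> \<in> A' i" by metis
  have "AE \<omega> in M. \<forall>i::nat. \<omega> \<in> A i \<longleftrightarrow> \<omega> \<in> A' i" using A'(2) by (simp add: AE_all_countable)
  then have "AE \<omega> in M. \<omega> \<in> (\<Union>i. A i) \<longleftrightarrow> \<omega> \<in> (\<Union>i. A' i)" by eventually_elim auto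
  then show ?case using A' by (intro bexI[of _ "\<Union>i. A' i"]) auto
qed

lemma L2_limit_AE_subseq:
  fixes X :: "nat \<Rightarrow> 'a \<Rightarrow> real"
  assumes [measurable]: "\<And>k. X k \<in> borel_measurable M" "D \<in> borel_measurable M"
    and lim: "(\<lambda>k. \<integral>\<^sup>+\<omega>. ennreal ((X k \<omega> - D \<omega>)\<^sup>2) \<partial>M) \<longlonglongrightarrow> 0"
  shows "\<exists>r :: nat \<Rightarrow> nat. strict_mono r \<and> (AE \<omega> in M. (\<lambda>k. X (r k) \<omega>) \<longlonglongrightarrow> D \<omega>)"
proof -
  have "\<forall>\<^sub>F k in sequentially. (\<integral>\<^sup>+\<omega>. ennreal ((X k \<omega> - D \<omega>)\<^sup>2) \<partial>M) < 1"
    using lim by (rule order_tendstoD) simp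
  then obtain N where N: "\<And>k. k \<ge> N \<Longrightarrow> (\<integral>\<^sup>+\<omega>. ennreal ((X k \<omega> - D \<omega>)\<^sup>2) \<partial>M) < 1"
    by (auto simp: eventually_sequentially)
  define u where "u k \<omega> = (X (k + N) \<omega> - D \<omega>)\<^sup>2" for k \<omega>
  have int: "integrable M (u k)" for k
  proof (rule integrableI_bounded)
    have "(\<integral>\<^sup>+\<omega>. ennreal (norm (u k \<omega>)) \<partial>M) < 1" using N[of "k + N"] by (simp add: u_def)
    also have "(1::ennreal) < \<infinity>" by simp
    finally show "(\<integral>\<^sup>+\<omega>. ennreal (norm (u k \<omega>)) \<partial>M) < \<infinity>" .
  qed (unfold u_def, measurable)
  have "(\<lambda>k. \<integral>\<^sup>+\<omega>. ennreal ((X (k + N) \<omega> - D \<omega>)\<^sup>2) \<partial>M) \<longlonglongrightarrow> 0"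
    using lim by (rule LIMSEQ_ignore_initial_segment)
  then have "(\<lambda>k. enn2real (\<integral>\<^sup>+\<omega>. ennreal (u k \<omega>) \<partial>M)) \<longlonglongrightarrow> enn2real 0"
    unfolding u_def by (intro tendsto_enn2real) auto
  moreover have "enn2real (\<integral>\<^sup>+\<omega>. ennreal (u k \<omega>) \<partial>M) = (\<integral>\<omega>. norm (u k \<omega>) \<partial>M)" for k
    using int[of k] by (subst nn_integral_eq_integral) (auto simp: u_def[abs_def])
  ultimately have "(\<lambda>k. \<integral>\<omega>. norm (u k \<omega>) \<partial>M) \<longlonglongrightarrow> 0" by simp
  from tendsto_L1_AE_subseq[OF int this] obtain r :: "nat \<Rightarrow> nat"
    where r_mono: "strict_mono r" and r: "AE \<omega> in M. (\<lambda>k. u (r k) \<omega>) \<longlonglongrightarrow> 0" by blast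
  have "AE \<omega> in M. (\<lambda>k. X (r k + N) \<omega>) \<longlonglongrightarrow> D \<omega>"
    using r
  proof eventually_elim
    case (elim \<omega>)
    have "(\<lambda>k. sqrt (u (r k) \<omega>)) \<longlonglongrightarrow> sqrt 0" by (intro tendsto_real_sqrt elim)
    then have "(\<lambda>k. X (r k + N) \<omega> - D \<omega>) \<longlonglongrightarrow> 0" by (simp add: u_def tendsto_rabs_zero_iff)
    then show ?case by (simp add: LIM_zero_iff)
  qed
  moreover have "strict_mono (\<lambda>k. r k + N)" using r_mono by (simp add: strict_mono_def)
  ultimately show ?thesis by blast
qed

locale brownian = prob_space M for M :: "'a measure" +
  fixes B :: "real \<Rightarrow> 'a \<Rightarrow> real"
  assumes complete: "complete_measure M" and bm: "standard_brownian_motion M B"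
begin

abbreviation "\<N> \<equiv> natural_filtration M B"
abbreviation "\<C> \<equiv> completed_natural_filtration M B"

lemma measurable_B [measurable (raw)]: "t \<ge> 0 \<Longrightarrow> B t \<in> borel_measurable M"
  using bm by (simp add: standard_brownian_motion_def)

lemma sets_natural: "sets (\<N> t) = sigma_sets (space M) (\<Union>s\<in>{0..t}. {B s -` A \<inter> space M | A. A \<in> sets borel})"
  unfolding natural_filtration_def by (rule sets_measure_of) auto

lemma space_natural [simp]: "space (\<N> t) = space M"
  unfolding natural_filtration_def by (rule space_measure_of) auto

lemma natural_subalgebra: "subalgebra M (\<N> t)"
proof -
  have "(\<Union>s\<in>{0..t}. {B s -` A \<inter> space M | A. A \<in> sets borel}) \<subseteq> sets M"
    by (auto intro: measurable_sets measurable_B)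
  then have "sets (\<N> t) \<subseteq> sets M" unfolding sets_natural by (rule sets.sigma_sets_subset)
  then show ?thesis by (simp add: subalgebra_def)
qed

lemma natural_mono: "s \<le> t \<Longrightarrow> sets (\<N> s) \<subseteq> sets (\<N> t)"
  unfolding sets_natural by (intro sigma_sets_mono') force

lemma B_adapted: "0 \<le> s \<Longrightarrow> s \<le> t \<Longrightarrow> B s \<in> borel_measurable (\<N> t)"
proof (rule measurableI)
  fix A :: "real set" assume "0 \<le> s" "s \<le> t" "A \<in> sets borel"
  then have "B s -` A \<inter> space M \<in> (\<Union>s\<in>{0..t}. {B s -` A \<inter> space M | A. A \<in> sets borel})"
    by (intro UN_I[of s]) auto
  then show "B s -` A \<inter> space (\<N> t) \<in> sets (\<N> t)" by (simp add: sets_natural sigma_sets.Basic)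
qed simp

lemma measurable_natural: "f \<in> borel_measurable (\<N> t) \<Longrightarrow> f \<in> borel_measurable M"
  using natural_subalgebra[of t] by (auto simp: measurable_def subalgebra_def)

lemma sets_completed: "sets (\<C> t) = sigma_sets (space M) (sets (\<N> t) \<union> null_sets M)"
  unfolding completed_natural_filtration_def
  using sets.sets_into_space[of _ "\<N> t"] sets.sets_into_space[of _ M]
  by (intro sets_measure_of) (auto simp: null_sets_def)

lemma space_completed [simp]: "space (\<C> t) = space M"
  unfolding completed_natural_filtration_def
  using sets.sets_into_space[of _ "\<N> t"] sets.sets_into_space[of _ M]
  by (intro space_measure_of) (auto simp: null_sets_def)

lemma completed_subalgebra: "subalgebra M (\<C> t)"
proof -
  have "sets (\<N> t) \<union> null_sets M \<subseteq> sets M" using natural_subalgebra[of t] by (auto simp: subalgebra_def)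
  then have "sets (\<C> t) \<subseteq> sets M" unfolding sets_completed by (rule sets.sigma_sets_subset)
  then show ?thesis by (simp add: subalgebra_def)
qed

lemma completed_mono: "s \<le> t \<Longrightarrow> sets (\<C> s) \<subseteq> sets (\<C> t)"
  unfolding sets_completed using natural_mono[of s t] by (intro sigma_sets_mono') auto

text \<open>The limit of the \<open>X k\<close> where it exists is measurable for the completed filtration and differs from \<open>Y\<close> on a
null set only; every subset of that null set belongs to the completed filtration, as \<open>M\<close> is complete.\<close>

lemma AE_limit_adapted:
  assumes X: "\<And>k. X k \<in> borel_measurable (\<N> t)" and Y: "Y \<in> borel_measurable M"
    and lim: "AE \<omega> in M. (\<lambda>k. X k \<omega>) \<longlonglongrightarrow> (Y \<omega> :: real)"
  shows "Y \<in> borel_measurable (\<C> t)"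
proof -
  have [measurable]: "X k \<in> borel_measurable (\<C> t)" for k
    using X[of k] by (auto simp: measurable_def sets_completed intro: sigma_sets.Basic)
  define g where "g \<omega> = lim (\<lambda>k. X k \<omega>)" for \<omega>
  have g: "g \<in> borel_measurable (\<C> t)" unfolding g_def by measurable
  then have gM [measurable]: "g \<in> borel_measurable M"
    using completed_subalgebra[of t] by (auto simp: measurable_def subalgebra_def)
  note Y [measurable]
  define N where "N = {\<omega> \<in> space M. g \<omega> \<noteq> Y \<omega>}"
  have "AE \<omega> in M. g \<omega> = Y \<omega>"
    using lim by eventually_elim (simp add: g_def limI)
  then have N: "N \<in> null_sets M" unfolding N_def by (subst (asm) AE_iff_null) auto
  show ?thesis
  proof (rule measurableI)
    fix S :: "real set" assume S: "S \<in> sets borel"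
    have "Y -` S \<inter> space M = (g -` S \<inter> space M - N) \<union> (Y -` S \<inter> N)" by (auto simp: N_def)
    moreover have "Y -` S \<inter> N \<in> null_sets M"
      using complete_measure.complete2[OF complete, of "Y -` S \<inter> N" N] N by auto
    then have "Y -` S \<inter> N \<in> sets (\<C> t)" by (auto simp: sets_completed intro: sigma_sets.Basic)
    moreover have "N \<in> sets (\<C> t)" using N by (auto simp: sets_completed intro: sigma_sets.Basic)
    moreover have "g -` S \<inter> space M \<in> sets (\<C> t)" using measurable_sets[OF g S] by simp
    ultimately show "Y -` S \<inter> space (\<C> t) \<in> sets (\<C> t)" by auto
  qed simp
qed

lemma increment_distributed:
  assumes "0 \<le> s" "s < t"
  shows "distributed M lborel (\<lambda>\<omega>. B t \<omega> - B s \<omega>) (normal_density 0 (sqrt (t - s)))"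
  using bm assms by (simp add: standard_brownian_motion_def)

text \<open>Both variables must have the same type, so the real increment enters through a function \<open>h\<close>; this allows
a complex \<open>W\<close> together with \<open>h\<close> a complex exponential.\<close>

lemma increment_independent:
  fixes W :: "'a \<Rightarrow> 'b :: topological_space" and h :: "real \<Rightarrow> 'b"
  assumes st: "0 \<le> s" "s < t" and W: "W \<in> borel_measurable (\<N> s)" and h: "h \<in> borel_measurable borel"
  shows "indep_var borel W borel (\<lambda>\<omega>. h (B t \<omega> - B s \<omega>))"
proof -
  let ?D = "\<lambda>\<omega>. B t \<omega> - B s \<omega>"
  let ?GW = "{W -` A \<inter> space M | A. A \<in> sets borel}" and ?GD = "{?D -` A \<inter> space M | A. A \<in> sets borel}"
  let ?GH = "{(\<lambda>\<omega>. h (?D \<omega>)) -` A \<inter> space M | A. A \<in> sets borel}"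
  have "?GH \<subseteq> ?GD"
  proof safe
    fix A :: "'b set" assume "A \<in> sets borel"
    then have "h -` A \<in> sets borel" using measurable_sets[OF h, of A] by simp
    then show "\<exists>A'. (\<lambda>\<omega>. h (?D \<omega>)) -` A \<inter> space M = ?D -` A' \<inter> space M \<and> A' \<in> sets borel"
      by (intro exI[of _ "h -` A"]) auto
  qed
  have base: "indep_set (sets (\<N> s)) ?GD"
    using bm st by (simp add: standard_brownian_motion_def)
  have GW: "?GW \<subseteq> sets (\<N> s)" using measurable_sets[OF W] by auto
  have ind: "indep_set ?GW ?GH"
  proof (rule indep_setI)
    show "?GW \<subseteq> events" using GW indep_setD_ev1[OF base] by (rule subset_trans)
    show "?GH \<subseteq> events" using \<open>?GH \<subseteq> ?GD\<close> indep_setD_ev2[OF base] by (rule subset_trans)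
    fix a b assume "a \<in> ?GW" "b \<in> ?GH"
    then show "prob (a \<inter> b) = prob a * prob b"
      by (intro indep_setD[OF base] subsetD[OF GW] subsetD[OF \<open>?GH \<subseteq> ?GD\<close>])
  qed
  have stable: "Int_stable {Z -` A \<inter> space M | A. A \<in> sets borel}" for Z :: "'a \<Rightarrow> 'b"
  proof (rule Int_stableI)
    fix a b assume a: "a \<in> {Z -` A \<inter> space M | A. A \<in> sets borel}" and b: "b \<in> {Z -` A \<inter> space M | A. A \<in> sets borel}"
    from a obtain A where A: "a = Z -` A \<inter> space M" "A \<in> sets borel" by auto
    from b obtain A' where A': "b = Z -` A' \<inter> space M" "A' \<in> sets borel" by auto
    have "a \<inter> b = Z -` (A \<inter> A') \<inter> space M" using A A' by auto
    moreover have "A \<inter> A' \<in> sets borel" using A A' by auto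
    ultimately show "a \<inter> b \<in> {Z -` A \<inter> space M | A. A \<in> sets borel}" by blast
  qed
  have "indep_set (sigma_sets (space M) ?GW) (sigma_sets (space M) ?GH)"
    by (rule indep_set_sigma_sets[OF ind stable stable])
  moreover have "W \<in> borel_measurable M" by (rule measurable_natural[OF W])
  moreover have "?D \<in> borel_measurable M" using st by (intro borel_measurable_diff measurable_B) auto
  then have "(\<lambda>\<omega>. h (?D \<omega>)) \<in> borel_measurable M" by (rule measurable_compose[OF _ h])
  ultimately show ?thesis unfolding indep_var_eq by blast
qed

lemma char_Brownian_increment:
  assumes "0 \<le> s" "s \<le> t"
  shows "(\<integral>\<omega>. iexp (u * (B t \<omega> - B s \<omega>)) \<partial>M) = complex_of_real (exp (- u\<^sup>2 * (t - s) / 2))"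
proof (cases "s = t")
  case True
  then show ?thesis by (simp add: prob_space)
next
  case False
  define d where "d = sqrt (t - s)"
  have d: "d > 0" "d\<^sup>2 = t - s" using assms False by (auto simp: d_def)
  let ?Z = "\<lambda>\<omega>. (B t \<omega> - B s \<omega> - 0) / d"
  have [measurable]: "B t \<in> borel_measurable M" "B s \<in> borel_measurable M" using assms by auto
  have "distributed M lborel ?Z std_normal_density"
    using normal_standard_normal_convert[OF d(1), of "\<lambda>\<omega>. B t \<omega> - B s \<omega>" 0]
      increment_distributed[of s t] assms False by (auto simp: d_def)
  then have Z: "distr M lborel ?Z = std_normal_distribution" by (auto simp: distributed_def)
  have "(\<integral>\<omega>. iexp (u * (B t \<omega> - B s \<omega>)) \<partial>M) = (\<integral>\<omega>. iexp (u * d * ?Z \<omega>) \<partial>M)"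
    using d by (intro Bochner_Integration.integral_cong) auto
  also have "\<dots> = (\<integral>z. iexp (u * d * z) \<partial>distr M lborel ?Z)"
    by (subst integral_distr) auto
  also have "\<dots> = char std_normal_distribution (u * d)" unfolding Z char_def ..
  finally show ?thesis by (simp add: char_std_normal_distribution power_mult_distrib d(2))
qed

lemma expectation_times_iexp_increment:
  fixes W :: "'a \<Rightarrow> complex"
  assumes st: "0 \<le> s" "s \<le> t" and W: "W \<in> borel_measurable (\<N> s)" and bounded: "\<And>\<omega>. cmod (W \<omega>) \<le> K"
  shows "(\<integral>\<omega>. W \<omega> * iexp (u * (B t \<omega> - B s \<omega>)) \<partial>M) = (\<integral>\<omega>. W \<omega> \<partial>M) * complex_of_real (exp (- u\<^sup>2 * (t - s) / 2))"
proof (cases "s = t")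
  case True
  then show ?thesis by simp
next
  case False
  then have "s < t" using st by simp
  have [measurable]: "B t \<in> borel_measurable M" "B s \<in> borel_measurable M" "W \<in> borel_measurable M"
    using st measurable_natural[OF W] by auto
  let ?E = "\<lambda>x::real. iexp (u * x)"
  have iv: "indep_var borel W borel (\<lambda>\<omega>. ?E (B t \<omega> - B s \<omega>))"
    by (rule increment_independent[OF st(1) \<open>s < t\<close> W]) measurable
  have "integrable M W" using bounded by (intro integrable_const_bound[of _ K]) auto
  moreover have "integrable M (\<lambda>\<omega>. ?E (B t \<omega> - B s \<omega>))" by (intro integrable_const_bound[of _ 1]) auto
  ultimately show ?thesis
    using indep_var_lebesgue_integral[OF iv] char_Brownian_increment[OF st, of u] by simp
qed

lemma increment_moments:
  assumes "0 \<le> s" "s < t"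
  shows "integrable M (\<lambda>\<omega>. B t \<omega> - B s \<omega>)" "(\<integral>\<omega>. B t \<omega> - B s \<omega> \<partial>M) = 0"
    "integrable M (\<lambda>\<omega>. (B t \<omega> - B s \<omega>)\<^sup>2)" "(\<integral>\<omega>. (B t \<omega> - B s \<omega>)\<^sup>2 \<partial>M) = t - s"
proof -
  note D = increment_distributed[OF assms]
  have d: "sqrt (t - s) > 0" using assms by simp
  have "integrable lborel (\<lambda>x. normal_density 0 (sqrt (t - s)) x * x ^ k)" for k
    using integrable_normal_moment[OF d, of 0 k] by simp
  then have int: "integrable M (\<lambda>\<omega>. (B t \<omega> - B s \<omega>) ^ k)" for k
    by (subst distributed_integrable[OF D, symmetric]) auto
  show "integrable M (\<lambda>\<omega>. B t \<omega> - B s \<omega>)" using int[of 1] by simp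
  show "integrable M (\<lambda>\<omega>. (B t \<omega> - B s \<omega>)\<^sup>2)" by (rule int)
  show exp0: "(\<integral>\<omega>. B t \<omega> - B s \<omega> \<partial>M) = 0" using normal_distributed_expectation[OF d D] .
  show "(\<integral>\<omega>. (B t \<omega> - B s \<omega>)\<^sup>2 \<partial>M) = t - s"
    using normal_distributed_variance[OF d D] assms by (simp add: exp0)
qed

lemma B_0: "AE \<omega> in M. B 0 \<omega> = 0"
  using bm by (simp add: standard_brownian_motion_def)

lemma second_moment:
  assumes "t \<ge> 0"
  shows "integrable M (B t)" "(\<integral>\<omega>. B t \<omega> \<partial>M) = 0" "integrable M (\<lambda>\<omega>. (B t \<omega>)\<^sup>2)" "(\<integral>\<omega>. (B t \<omega>)\<^sup>2 \<partial>M) = t"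
proof -
  have [measurable]: "B t \<in> borel_measurable M" "B 0 \<in> borel_measurable M" using assms by auto
  have "integrable M (B t) \<and> (\<integral>\<omega>. B t \<omega> \<partial>M) = 0 \<and> integrable M (\<lambda>\<omega>. (B t \<omega>)\<^sup>2) \<and> (\<integral>\<omega>. (B t \<omega>)\<^sup>2 \<partial>M) = t"
  proof (cases "t = 0")
    case True
    have "AE \<omega> in M. (B 0 \<omega>)\<^sup>2 = 0" using B_0 by eventually_elim simp
    then have "integrable M (B 0)" "(\<integral>\<omega>. B 0 \<omega> \<partial>M) = 0" "integrable M (\<lambda>\<omega>. (B 0 \<omega>)\<^sup>2)" "(\<integral>\<omega>. (B 0 \<omega>)\<^sup>2 \<partial>M) = 0"
      using B_0 by (auto simp: integral_eq_zero_AE cong: integrable_cong_AE)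
        (simp_all add: integrable_cong_AE[where g="\<lambda>_. 0"])
    then show ?thesis using True by simp
  next
    case False
    then have t: "0 \<le> (0::real)" "0 < t" using assms by auto
    have ae1: "AE \<omega> in M. B t \<omega> = B t \<omega> - B 0 \<omega>" using B_0 by eventually_elim simp
    then have ae2: "AE \<omega> in M. (B t \<omega>)\<^sup>2 = (B t \<omega> - B 0 \<omega>)\<^sup>2" by eventually_elim simp
    have "integrable M (B t) \<longleftrightarrow> integrable M (\<lambda>\<omega>. B t \<omega> - B 0 \<omega>)"
      by (rule integrable_cong_AE[OF _ _ ae1]) simp_all
    moreover have "(\<integral>\<omega>. B t \<omega> \<partial>M) = (\<integral>\<omega>. B t \<omega> - B 0 \<omega> \<partial>M)"
      by (rule integral_cong_AE[OF _ _ ae1]) simp_all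
    moreover have "integrable M (\<lambda>\<omega>. (B t \<omega>)\<^sup>2) \<longleftrightarrow> integrable M (\<lambda>\<omega>. (B t \<omega> - B 0 \<omega>)\<^sup>2)"
      by (rule integrable_cong_AE[OF _ _ ae2]) simp_all
    moreover have "(\<integral>\<omega>. (B t \<omega>)\<^sup>2 \<partial>M) = (\<integral>\<omega>. (B t \<omega> - B 0 \<omega>)\<^sup>2 \<partial>M)"
      by (rule integral_cong_AE[OF _ _ ae2]) simp_all
    ultimately have *: "integrable M (B t) \<longleftrightarrow> integrable M (\<lambda>\<omega>. B t \<omega> - B 0 \<omega>)"
      "(\<integral>\<omega>. B t \<omega> \<partial>M) = (\<integral>\<omega>. B t \<omega> - B 0 \<omega> \<partial>M)"
      "integrable M (\<lambda>\<omega>. (B t \<omega>)\<^sup>2) \<longleftrightarrow> integrable M (\<lambda>\<omega>. (B t \<omega> - B 0 \<omega>)\<^sup>2)"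
      "(\<integral>\<omega>. (B t \<omega>)\<^sup>2 \<partial>M) = (\<integral>\<omega>. (B t \<omega> - B 0 \<omega>)\<^sup>2 \<partial>M)" by blast+
    show ?thesis unfolding * using increment_moments[OF t] by simp
  qed
  then show "integrable M (B t)" "(\<integral>\<omega>. B t \<omega> \<partial>M) = 0" "integrable M (\<lambda>\<omega>. (B t \<omega>)\<^sup>2)" "(\<integral>\<omega>. (B t \<omega>)\<^sup>2 \<partial>M) = t" by auto
qed

text \<open>This is the statement that \<open>B t\<close> corresponds to the indicator of \<open>(0, t]\<close> under the isometry from
the linear span of the \<open>B t\<close> into \<open>L\<^sup>2\<close> of the half-line.\<close>

lemma covariance:
  assumes "s \<ge> 0" "t \<ge> 0"
  shows "integrable M (\<lambda>\<omega>. B s \<omega> * B t \<omega>) \<and> (\<integral>\<omega>. B s \<omega> * B t \<omega> \<partial>M) = min s t"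
proof -
  have *: "integrable M (\<lambda>\<omega>. B s \<omega> * B t \<omega>) \<and> (\<integral>\<omega>. B s \<omega> * B t \<omega> \<partial>M) = s" if st: "0 \<le> s" "s < t" for s t
  proof -
    note iv = increment_independent[OF st B_adapted[OF st(1) order_refl] measurable_ident_sets[OF refl]]
    note m = second_moment[OF st(1)] increment_moments[OF st]
    have "integrable M (\<lambda>\<omega>. B s \<omega> * (B t \<omega> - B s \<omega>))" "(\<integral>\<omega>. B s \<omega> * (B t \<omega> - B s \<omega>) \<partial>M) = 0"
      using indep_var_integrable[OF iv m(1) m(5)] indep_var_lebesgue_integral[OF iv m(1) m(5)] m(2) by auto
    moreover have "B s \<omega> * B t \<omega> = B s \<omega> * (B t \<omega> - B s \<omega>) + (B s \<omega>)\<^sup>2" for \<omega>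
      by (simp add: power2_eq_square algebra_simps)
    ultimately show ?thesis using m(3,4) by simp
  qed
  consider "s < t" | "t < s" | "s = t" by linarith
  then show ?thesis
  proof cases
    case 1
    then show ?thesis using *[of s t] assms by simp
  next
    case 2
    then show ?thesis using *[of t s] assms by (simp add: mult.commute)
  next
    case 3
    then show ?thesis using second_moment(3,4)[of s] assms by (simp add: power2_eq_square)
  qed
qed

end

section \<open>Wiener integrals of step functions\<close>

text \<open>Formal linear combinations of points in time.  Evaluated at \<open>\<lambda>t. B t \<omega>\<close> they are stochastic integrals of
step functions, evaluated at indicators of \<open>(0, t]\<close> the step functions themselves.  The isometry is then
bilinearity, and two step functions need no common refinement of their partitions.\<close>

definition lin_comb :: "(real \<times> real) list \<Rightarrow> (real \<Rightarrow> real) \<Rightarrow> real" where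
  "lin_comb xs g = (\<Sum>(a, t)\<leftarrow>xs. a * g t)"

lemma lin_comb_Nil [simp]: "lin_comb [] g = 0"
  and lin_comb_Cons [simp]: "lin_comb ((a, t) # xs) g = a * g t + lin_comb xs g"
  and lin_comb_append [simp]: "lin_comb (xs @ ys) g = lin_comb xs g + lin_comb ys g"
  by (simp_all add: lin_comb_def)

lemma lin_comb_neg: "lin_comb (map (\<lambda>(a, t). (- a, t)) xs) g = - lin_comb xs g"
  by (induction xs) auto

abbreviation unit_step :: "real \<Rightarrow> real \<Rightarrow> real" where
  "unit_step x t \<equiv> indicator {0<..t} x"

lemma step_representation:
  assumes "\<And>i. i \<le> n \<Longrightarrow> 0 \<le> p i" "\<And>i. i < n \<Longrightarrow> p i \<le> p (Suc i)"
  shows "\<exists>xs. (\<forall>(a, t)\<in>set xs. 0 \<le> t) \<and> (\<forall>B. \<forall>\<omega>::'a. step_integral B n p c \<omega> = lin_comb xs (\<lambda>t. B t \<omega>)) \<and>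
           (\<forall>x. step_fun n p c x = lin_comb xs (unit_step x))"
  using assms
proof (induction n)
  case 0
  show ?case by (intro exI[of _ "[]"]) (simp add: step_integral_def step_fun_def)
next
  case (Suc n)
  then obtain xs where xs: "\<forall>(a, t)\<in>set xs. 0 \<le> t" "\<And>B (\<omega>::'a). step_integral B n p c \<omega> = lin_comb xs (\<lambda>t. B t \<omega>)"
    "\<And>x. step_fun n p c x = lin_comb xs (unit_step x)" by auto
  have ind: "indicator {p n<..p (Suc n)} x = unit_step x (p (Suc n)) - unit_step x (p n)" for x
    using Suc.prems(1)[of n] Suc.prems(2)[of n] by (auto simp: indicator_def)
  have "step_fun (Suc n) p c x = step_fun n p c x + c n * indicator {p n<..p (Suc n)} x" for x
    by (simp only: step_fun_def sum.lessThan_Suc)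
  then have "step_fun (Suc n) p c x = lin_comb ((c n, p (Suc n)) # (- c n, p n) # xs) (unit_step x)" for x
    unfolding ind xs(3) lin_comb_Cons right_diff_distrib by simp
  moreover have "step_integral B (Suc n) p c \<omega> = lin_comb ((c n, p (Suc n)) # (- c n, p n) # xs) (\<lambda>t. B t \<omega>)" for B and \<omega> :: 'a
    using xs(2)[of B \<omega>] by (simp add: step_integral_def algebra_simps)
  ultimately show ?case using xs(1) Suc.prems(1)
    by (intro exI[of _ "(c n, p (Suc n)) # (- c n, p n) # xs"]) auto
qed

lemma unit_step_inner:
  assumes "s \<ge> 0" "t \<ge> 0"
  shows "integrable lborel (\<lambda>x. unit_step x s * unit_step x t) \<and> (\<integral>x. unit_step x s * unit_step x t \<partial>lborel) = min s t"
proof -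
  have "(\<lambda>x. unit_step x s * unit_step x t) = indicator {0<..min s t}" by (auto simp: indicator_def fun_eq_iff)
  then show ?thesis using assms by (simp add: measure_def)
qed

lemma mono_upto:
  fixes p :: "nat \<Rightarrow> real"
  assumes "\<And>i. i < n \<Longrightarrow> p i \<le> p (Suc i)" "j \<le> k" "k \<le> n"
  shows "p j \<le> p k"
  using assms(2,3)
proof (induction k rule: dec_induct)
  case (step m)
  then have "p j \<le> p m" by simp
  also have "p m \<le> p (Suc m)" using step by (intro assms(1)) simp
  finally show ?case .
qed simp

lemma partition_of_nonneg:
  assumes "partition_of t n p" "i \<le> n"
  shows "0 \<le> p i" "p 0 \<le> p i" "p i \<le> t"
proof -
  have p: "0 \<le> p 0" "p n \<le> t" "\<And>i. i < n \<Longrightarrow> p i \<le> p (Suc i)" using assms by (auto simp: partition_of_def)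
  show "p 0 \<le> p i" using mono_upto[of n p 0 i] p(3) assms(2) by simp
  then show "0 \<le> p i" using p(1) by linarith
  show "p i \<le> t" using mono_upto[of n p i n] p(2,3) assms(2) by fastforce
qed

lemma step_fun_outside:
  assumes "\<And>i. i < n \<Longrightarrow> p i \<le> p (Suc i)" "x \<le> p 0 \<or> p n < x"
  shows "step_fun n p c x = 0"
proof -
  note mono = mono_upto[of n p, OF assms(1)]
  have "x \<notin> {p i<..p (Suc i)}" if "i < n" for i
    using mono[of 0 i] mono[of "Suc i" n] that assms(2) by auto
  then show ?thesis by (simp add: step_fun_def)
qed

lemma step_fun_squared:
  assumes "\<And>i. i < n \<Longrightarrow> p i \<le> p (Suc i)"
  shows "(step_fun n p c x)\<^sup>2 = (\<Sum>i<n. (c i)\<^sup>2 * indicator {p i<..p (Suc i)} x)"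
  using assms
proof (induction n)
  case 0
  then show ?case by (simp add: step_fun_def)
next
  case (Suc n)
  have "step_fun n p c x * indicator {p n<..p (Suc n)} x = 0"
    using step_fun_outside[of n p x c] Suc.prems by (cases "p n < x") auto
  then have "(step_fun n p c x + c n * indicator {p n<..p (Suc n)} x)\<^sup>2
      = (step_fun n p c x)\<^sup>2 + (c n)\<^sup>2 * indicator {p n<..p (Suc n)} x"
    by (auto simp: power2_eq_square algebra_simps indicator_def)
  then show ?case using Suc by (simp add: step_fun_def)
qed

lemma integral_step_fun_squared:
  assumes "\<And>i. i < n \<Longrightarrow> p i \<le> p (Suc i)"
  shows "integrable lborel (\<lambda>x. (step_fun n p c x)\<^sup>2)"
    and "(\<integral>x. (step_fun n p c x)\<^sup>2 \<partial>lborel) = (\<Sum>i<n. (c i)\<^sup>2 * (p (Suc i) - p i))"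
proof -
  have eq: "(\<lambda>x. (step_fun n p c x)\<^sup>2) = (\<lambda>x. \<Sum>i<n. (c i)\<^sup>2 * indicator {p i<..p (Suc i)} x)"
    using step_fun_squared[of n p, OF assms] by blast
  have 1: "integrable lborel (\<lambda>x. (c i)\<^sup>2 * indicator {p i<..p (Suc i)} x)"
    "(\<integral>x. (c i)\<^sup>2 * indicator {p i<..p (Suc i)} x \<partial>lborel) = (c i)\<^sup>2 * (p (Suc i) - p i)" if "i < n" for i
    using assms[OF that] by (auto simp: measure_def)
  show "integrable lborel (\<lambda>x. (step_fun n p c x)\<^sup>2)"
    unfolding eq using 1 by (intro Bochner_Integration.integrable_sum) auto
  show "(\<integral>x. (step_fun n p c x)\<^sup>2 \<partial>lborel) = (\<Sum>i<n. (c i)\<^sup>2 * (p (Suc i) - p i))"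
  proof -
    have "(\<integral>x. (step_fun n p c x)\<^sup>2 \<partial>lborel) = (\<Sum>i<n. \<integral>x. (c i)\<^sup>2 * indicator {p i<..p (Suc i)} x \<partial>lborel)"
      unfolding eq by (rule Bochner_Integration.integral_sum) (use 1(1) in auto)
    also have "\<dots> = (\<Sum>i<n. (c i)\<^sup>2 * (p (Suc i) - p i))"
      by (intro sum.cong refl 1(2)) auto
    finally show ?thesis .
  qed
qed

lemma step_fun_measurable [measurable]: "step_fun n p c \<in> borel_measurable borel"
  unfolding step_fun_def[abs_def] by measurable

text \<open>Cutting a partition at \<open>s\<close> separates the integral into the parts after and before \<open>s\<close>, because
\<open>max s a\<close> and \<open>min s a\<close> are \<open>s\<close> and \<open>a\<close> in some order.\<close>

lemma step_split_at:
  assumes "\<And>i. i < n \<Longrightarrow> p i \<le> p (Suc i)"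
  shows "step_integral B n p c \<omega> = step_integral B n (\<lambda>i. max s (p i)) c \<omega> + step_integral B n (\<lambda>i. min s (p i)) c \<omega>"
    and "step_fun n (\<lambda>i. max s (p i)) c x = step_fun n p c x * indicator {s<..} x"
    and "step_fun n (\<lambda>i. min s (p i)) c x = step_fun n p c x * indicator {..s} x"
proof -
  have "B (max s a) \<omega> + B (min s a) \<omega> = B s \<omega> + B a \<omega>" for a by (simp add: max_def min_def)
  then have "B (p (Suc i)) \<omega> - B (p i) \<omega> = (B (max s (p (Suc i))) \<omega> - B (max s (p i)) \<omega>) + (B (min s (p (Suc i))) \<omega> - B (min s (p i)) \<omega>)" for i
    by (smt (verit))
  then show "step_integral B n p c \<omega> = step_integral B n (\<lambda>i. max s (p i)) c \<omega> + step_integral B n (\<lambda>i. min s (p i)) c \<omega>"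
    unfolding step_integral_def by (simp add: sum.distrib[symmetric] distrib_left[symmetric])
  show "step_fun n (\<lambda>i. max s (p i)) c x = step_fun n p c x * indicator {s<..} x"
    unfolding step_fun_def sum_distrib_right
    by (intro sum.cong) (auto simp: indicator_def)
  show "step_fun n (\<lambda>i. min s (p i)) c x = step_fun n p c x * indicator {..s} x"
    unfolding step_fun_def sum_distrib_right
    by (intro sum.cong) (use assms in \<open>auto simp: indicator_def\<close>)
qed

context brownian
begin

lemma lin_comb_inner_B:
  assumes "s \<ge> 0" "\<forall>(a, t)\<in>set ys. 0 \<le> t"
  shows "integrable M (\<lambda>\<omega>. B s \<omega> * lin_comb ys (\<lambda>t. B t \<omega>)) \<and> integrable lborel (\<lambda>x. unit_step x s * lin_comb ys (unit_step x)) \<and>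
    (\<integral>\<omega>. B s \<omega> * lin_comb ys (\<lambda>t. B t \<omega>) \<partial>M) = (\<integral>x. unit_step x s * lin_comb ys (unit_step x) \<partial>lborel)"
  using assms(2)
proof (induction ys)
  case (Cons y ys)
  obtain b t where y: "y = (b, t)" by (cases y)
  have t: "t \<ge> 0" using Cons.prems by (auto simp: y)
  have "B s \<omega> * lin_comb (y # ys) (\<lambda>t. B t \<omega>) = b * (B s \<omega> * B t \<omega>) + B s \<omega> * lin_comb ys (\<lambda>t. B t \<omega>)" for \<omega>
    by (simp add: y algebra_simps)
  moreover have "unit_step x s * lin_comb (y # ys) (unit_step x) = b * (unit_step x s * unit_step x t) + unit_step x s * lin_comb ys (unit_step x)" for x
    by (simp only: y lin_comb_Cons distrib_left mult_ac)
  ultimately show ?case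
    using Cons covariance[OF assms(1) t] unit_step_inner[OF assms(1) t]
    by (simp only: Bochner_Integration.integrable_add integrable_mult_right Bochner_Integration.integral_add integral_mult_right list.set_intros ball_simps) simp
qed simp

lemma lin_comb_inner:
  assumes "\<forall>(a, t)\<in>set xs. 0 \<le> t" "\<forall>(a, t)\<in>set ys. 0 \<le> t"
  shows "integrable M (\<lambda>\<omega>. lin_comb xs (\<lambda>t. B t \<omega>) * lin_comb ys (\<lambda>t. B t \<omega>)) \<and>
    integrable lborel (\<lambda>x. lin_comb xs (unit_step x) * lin_comb ys (unit_step x)) \<and>
    (\<integral>\<omega>. lin_comb xs (\<lambda>t. B t \<omega>) * lin_comb ys (\<lambda>t. B t \<omega>) \<partial>M) = (\<integral>x. lin_comb xs (unit_step x) * lin_comb ys (unit_step x) \<partial>lborel)"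
  using assms(1)
proof (induction xs)
  case (Cons y xs)
  obtain b t where y: "y = (b, t)" by (cases y)
  have t: "t \<ge> 0" using Cons.prems by (auto simp: y)
  have "lin_comb (y # xs) (\<lambda>t. B t \<omega>) * lin_comb ys (\<lambda>t. B t \<omega>)
      = b * (B t \<omega> * lin_comb ys (\<lambda>t. B t \<omega>)) + lin_comb xs (\<lambda>t. B t \<omega>) * lin_comb ys (\<lambda>t. B t \<omega>)" for \<omega>
    by (simp add: y algebra_simps)
  moreover have "lin_comb (y # xs) (unit_step x) * lin_comb ys (unit_step x)
      = b * (unit_step x t * lin_comb ys (unit_step x)) + lin_comb xs (unit_step x) * lin_comb ys (unit_step x)" for x
    by (simp only: y lin_comb_Cons distrib_right mult.assoc)
  ultimately show ?case
    using Cons lin_comb_inner_B[OF t assms(2)]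
    by (simp only: Bochner_Integration.integrable_add integrable_mult_right Bochner_Integration.integral_add integral_mult_right list.set_intros ball_simps) simp
qed simp

lemma step_isometry:
  assumes p: "\<And>i. i \<le> n \<Longrightarrow> 0 \<le> p i" "\<And>i. i < n \<Longrightarrow> p i \<le> p (Suc i)"
    and q: "\<And>i. i \<le> m \<Longrightarrow> 0 \<le> q i" "\<And>i. i < m \<Longrightarrow> q i \<le> q (Suc i)"
  shows "(\<integral>\<^sup>+\<omega>. ennreal ((step_integral B n p c \<omega> - step_integral B m q d \<omega>)\<^sup>2) \<partial>M)
    = (\<integral>\<^sup>+x. ennreal ((step_fun n p c x - step_fun m q d x)\<^sup>2) \<partial>lborel)"
proof -
  obtain xs where "(\<forall>(a, t)\<in>set xs. 0 \<le> t) \<and> (\<forall>B. \<forall>\<omega>::'a. step_integral B n p c \<omega> = lin_comb xs (\<lambda>t. B t \<omega>)) \<and> (\<forall>x. step_fun n p c x = lin_comb xs (unit_step x))"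
    using step_representation[of n p c, OF p, where 'a='a] ..
  then have xs: "\<forall>(a, t)\<in>set xs. 0 \<le> t" "\<And>\<omega>. step_integral B n p c \<omega> = lin_comb xs (\<lambda>t. B t \<omega>)" "\<And>x. step_fun n p c x = lin_comb xs (unit_step x)" by simp_all
  obtain ys where "(\<forall>(a, t)\<in>set ys. 0 \<le> t) \<and> (\<forall>B. \<forall>\<omega>::'a. step_integral B m q d \<omega> = lin_comb ys (\<lambda>t. B t \<omega>)) \<and> (\<forall>x. step_fun m q d x = lin_comb ys (unit_step x))"
    using step_representation[of m q d, OF q, where 'a='a] ..
  then have ys: "\<forall>(a, t)\<in>set ys. 0 \<le> t" "\<And>\<omega>. step_integral B m q d \<omega> = lin_comb ys (\<lambda>t. B t \<omega>)" "\<And>x. step_fun m q d x = lin_comb ys (unit_step x)" by simp_all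
  define zs where "zs = xs @ map (\<lambda>(a, t). (- a, t)) ys"
  have zs: "\<forall>(a, t)\<in>set zs. 0 \<le> t" using xs(1) ys(1) by (auto simp: zs_def)
  have 1: "step_integral B n p c \<omega> - step_integral B m q d \<omega> = lin_comb zs (\<lambda>t. B t \<omega>)" for \<omega>
    by (simp add: zs_def xs ys lin_comb_neg)
  have 2: "step_fun n p c x - step_fun m q d x = lin_comb zs (unit_step x)" for x
    by (simp add: zs_def xs ys lin_comb_neg)
  have "integrable M (\<lambda>\<omega>. (lin_comb zs (\<lambda>t. B t \<omega>))\<^sup>2)" "integrable lborel (\<lambda>x. (lin_comb zs (unit_step x))\<^sup>2)"
    "(\<integral>\<omega>. (lin_comb zs (\<lambda>t. B t \<omega>))\<^sup>2 \<partial>M) = (\<integral>x. (lin_comb zs (unit_step x))\<^sup>2 \<partial>lborel)"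
    using lin_comb_inner[OF zs zs] by (simp_all add: power2_eq_square)
  then show ?thesis unfolding 1 2 by (simp add: nn_integral_eq_integral)
qed

lemma step_integral_adapted:
  assumes "\<And>i. i \<le> n \<Longrightarrow> 0 \<le> p i" "\<And>i. i \<le> n \<Longrightarrow> p i \<le> t"
  shows "step_integral B n p c \<in> borel_measurable (\<N> t)"
  unfolding step_integral_def[abs_def]
  by (intro borel_measurable_sum borel_measurable_times borel_measurable_diff borel_measurable_const B_adapted) (use assms in auto)

text \<open>Induction over the partition: the last Brownian increment is independent of the product of the indicator of
\<open>A\<close> with the exponential of the integral up to the last partition point.\<close>

lemma char_step_integral:
  assumes s: "0 \<le> s" "s \<le> p 0" and p: "\<And>i. i < n \<Longrightarrow> p i \<le> p (Suc i)" and A: "A \<in> sets (\<N> s)"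
  shows "(LINT \<omega>:A|M. iexp (u * step_integral B n p c \<omega>))
    = complex_of_real (exp (- u\<^sup>2 * (\<Sum>i<n. (c i)\<^sup>2 * (p (Suc i) - p i)) / 2) * prob A)"
  using p
proof (induction n)
  case 0
  have "A \<in> sets M" using A natural_subalgebra[of s] by (auto simp: subalgebra_def)
  then have "(\<integral>\<omega>. indicator A \<omega> *\<^sub>R (1 :: complex) \<partial>M) = (\<integral>\<omega>. indicator A \<omega> \<partial>M) *\<^sub>R 1"
    by (intro integral_scaleR_left integrable_real_indicator) (auto simp: emeasure_eq_measure)
  then show ?case using \<open>A \<in> sets M\<close>
    by (simp add: step_integral_def set_lebesgue_integral_def scaleR_conv_of_real)
next
  case (Suc n)
  have mono: "p 0 \<le> p i" "p i \<le> p n" if "i \<le> n" for i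
    using mono_upto[of n p 0 i] mono_upto[of n p i n] that Suc.prems by simp_all
  let ?W = "\<lambda>\<omega>. indicator A \<omega> *\<^sub>R iexp (u * step_integral B n p c \<omega>)"
  have "A \<in> sets (\<N> (p n))" using A natural_mono[of s "p n"] s mono[of n] by auto
  moreover have "step_integral B n p c \<in> borel_measurable (\<N> (p n))"
    using mono s by (intro step_integral_adapted) (auto intro: order_trans[OF order_trans[OF s]])
  ultimately have W: "?W \<in> borel_measurable (\<N> (p n))" by measurable
  have "iexp (u * step_integral B (Suc n) p c \<omega>)
      = iexp (u * step_integral B n p c \<omega>) * iexp (u * c n * (B (p (Suc n)) \<omega> - B (p n) \<omega>))" for \<omega>
    by (simp add: step_integral_def exp_add[symmetric] algebra_simps)
  then have "(LINT \<omega>:A|M. iexp (u * step_integral B (Suc n) p c \<omega>))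
      = (\<integral>\<omega>. ?W \<omega> * iexp (u * c n * (B (p (Suc n)) \<omega> - B (p n) \<omega>)) \<partial>M)"
    unfolding set_lebesgue_integral_def by (intro Bochner_Integration.integral_cong) auto
  also have "\<dots> = (\<integral>\<omega>. ?W \<omega> \<partial>M) * complex_of_real (exp (- (u * c n)\<^sup>2 * (p (Suc n) - p n) / 2))"
    using s mono[of n] Suc.prems by (intro expectation_times_iexp_increment[OF _ _ W, where K=1]) (auto split: split_indicator)
  also have "(\<integral>\<omega>. ?W \<omega> \<partial>M) = complex_of_real (exp (- u\<^sup>2 * (\<Sum>i<n. (c i)\<^sup>2 * (p (Suc i) - p i)) / 2) * prob A)"
    using Suc unfolding set_lebesgue_integral_def by simp
  also have "\<dots> * complex_of_real (exp (- (u * c n)\<^sup>2 * (p (Suc n) - p n) / 2))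
      = complex_of_real (exp (- u\<^sup>2 * (\<Sum>i<n. (c i)\<^sup>2 * (p (Suc i) - p i)) / 2 + - (u * c n)\<^sup>2 * (p (Suc n) - p n) / 2) * prob A)"
    by (simp only: exp_add of_real_mult mult_ac)
  also have "- u\<^sup>2 * (\<Sum>i<n. (c i)\<^sup>2 * (p (Suc i) - p i)) / 2 + - (u * c n)\<^sup>2 * (p (Suc n) - p n) / 2
      = - u\<^sup>2 * (\<Sum>i<Suc n. (c i)\<^sup>2 * (p (Suc i) - p i)) / 2"
    by (simp add: power_mult_distrib field_simps)
  finally show ?case .
qed

end

section \<open>Stochastic integrals as Gaussian processes\<close>

lemma sum3_squared_le: "(a - b - c :: real)\<^sup>2 \<le> 3 * a\<^sup>2 + 3 * b\<^sup>2 + 3 * c\<^sup>2"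
proof -
  have "0 \<le> (a + b)\<^sup>2 + (a + c)\<^sup>2 + (b - c)\<^sup>2" by simp
  then show ?thesis by (simp add: power2_eq_square algebra_simps)
qed

lemma diff_squared_le: "(a - b :: real)\<^sup>2 \<le> 2 * (a - c)\<^sup>2 + 2 * (b - c)\<^sup>2"
proof -
  have "0 \<le> (a + b - 2 * c)\<^sup>2" by simp
  then show ?thesis by (simp add: power2_eq_square algebra_simps)
qed

lemma squares_close:
  assumes "e > 0"
  shows "\<bar>(a::real)\<^sup>2 - b\<^sup>2\<bar> \<le> (1 + 1 / e) * (a - b)\<^sup>2 + e * b\<^sup>2"
proof -
  define d where "d = a - b"
  have ab: "a = b + d" by (simp add: d_def)
  have "2 * \<bar>d\<bar> * \<bar>b\<bar> \<le> d\<^sup>2 / e + e * b\<^sup>2"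
  proof -
    have "0 \<le> (\<bar>d\<bar> / sqrt e - sqrt e * \<bar>b\<bar>)\<^sup>2" by simp
    also have "\<dots> = d\<^sup>2 / e + e * b\<^sup>2 - 2 * \<bar>d\<bar> * \<bar>b\<bar>"
      using assms by (simp add: power2_diff power_divide power_mult_distrib)
    finally show ?thesis by simp
  qed
  moreover have "\<bar>a\<^sup>2 - b\<^sup>2\<bar> = \<bar>d\<^sup>2 + 2 * (d * b)\<bar>" by (simp add: ab power2_eq_square algebra_simps)
  moreover have "\<dots> \<le> d\<^sup>2 + 2 * \<bar>d\<bar> * \<bar>b\<bar>"
    using abs_triangle_ineq[of "d\<^sup>2" "2 * (d * b)"] by (simp add: abs_mult)
  ultimately show ?thesis by (simp add: d_def[symmetric] algebra_simps)
qed

definition variance_of :: "(real \<Rightarrow> real) \<Rightarrow> real \<Rightarrow> real" where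
  "variance_of \<sigma> t = (LINT x:{0..t}|lborel. (\<sigma> x)\<^sup>2)"

lemma square_integrable_Icc:
  fixes \<sigma> :: "real \<Rightarrow> real"
  assumes "0 \<le> s" "continuous_on {0..} \<sigma>"
  shows "set_integrable lborel {s..t} (\<lambda>x. (\<sigma> x)\<^sup>2)"
  using assms by (intro borel_integrable_atLeastAtMost' continuous_intros continuous_on_subset[OF assms(2)]) auto

lemma variance_increment:
  assumes "0 \<le> s" "s \<le> t" "continuous_on {0..} \<sigma>"
  shows "variance_of \<sigma> t - variance_of \<sigma> s = (LINT x:{s<..t}|lborel. (\<sigma> x)\<^sup>2)"
proof -
  have "{0..t} = {0..s} \<union> {s<..t}" using assms by auto
  moreover have "set_integrable lborel {0..s} (\<lambda>x. (\<sigma> x)\<^sup>2)" using assms by (intro square_integrable_Icc) auto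
  moreover have "set_integrable lborel {s<..t} (\<lambda>x. (\<sigma> x)\<^sup>2)"
    using square_integrable_Icc[OF assms(1,3), of t] by (rule set_integrable_subset) auto
  ultimately have "variance_of \<sigma> t = variance_of \<sigma> s + (LINT x:{s<..t}|lborel. (\<sigma> x)\<^sup>2)"
    unfolding variance_of_def by (simp only:) (rule set_integral_Un, auto)
  then show ?thesis by simp
qed

context brownian
begin

text \<open>The approximating sequences for times \<open>s\<close> and \<open>t\<close> are unrelated.  Cut the one for \<open>t\<close> at \<open>s\<close>: its part before
\<open>s\<close> is close, by the isometry, to the sequence for \<open>s\<close>, because both step functions approximate \<open>\<sigma>\<close> on
\<open>[0, s]\<close>.  The part after \<open>s\<close> therefore approximates the increment, and its partition points lie
in \<open>[s, t]\<close>.\<close>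

lemma increment_approximation:
  assumes st: "0 \<le> s" "s \<le> t" and \<sigma>: "continuous_on {0..} \<sigma>"
    and Yt: "has_stochastic_integral M B \<sigma> t Yt" and Ys: "has_stochastic_integral M B \<sigma> s Ys"
  shows "\<exists>(n :: nat \<Rightarrow> nat) p c. (\<forall>k. s \<le> p k 0 \<and> p k (n k) \<le> t \<and> (\<forall>i<n k. p k i \<le> p k (Suc i))) \<and>
    (\<lambda>k. \<integral>\<^sup>+x\<in>{s<..t}. ennreal ((step_fun (n k) (p k) (c k) x - \<sigma> x)\<^sup>2) \<partial>lborel) \<longlonglongrightarrow> 0 \<and>
    (\<lambda>k. \<integral>\<^sup>+\<omega>. ennreal ((step_integral B (n k) (p k) (c k) \<omega> - (Yt \<omega> - Ys \<omega>))\<^sup>2) \<partial>M) \<longlonglongrightarrow> 0"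
proof -
  from Yt obtain n :: "nat \<Rightarrow> nat" and p c where Yt_meas: "Yt \<in> borel_measurable M"
    and p: "\<And>k. partition_of t (n k) (p k)"
    and a1: "(\<lambda>k. \<integral>\<^sup>+x\<in>{0..t}. ennreal ((step_fun (n k) (p k) (c k) x - \<sigma> x)\<^sup>2) \<partial>lborel) \<longlonglongrightarrow> 0"
    and e1: "(\<lambda>k. \<integral>\<^sup>+\<omega>. ennreal ((step_integral B (n k) (p k) (c k) \<omega> - Yt \<omega>)\<^sup>2) \<partial>M) \<longlonglongrightarrow> 0"
    unfolding has_stochastic_integral_def by blast
  from Ys obtain m :: "nat \<Rightarrow> nat" and q d where Ys_meas: "Ys \<in> borel_measurable M"
    and q: "\<And>k. partition_of s (m k) (q k)"
    and a2: "(\<lambda>k. \<integral>\<^sup>+x\<in>{0..s}. ennreal ((step_fun (m k) (q k) (d k) x - \<sigma> x)\<^sup>2) \<partial>lborel) \<longlonglongrightarrow> 0"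
    and e2: "(\<lambda>k. \<integral>\<^sup>+\<omega>. ennreal ((step_integral B (m k) (q k) (d k) \<omega> - Ys \<omega>)\<^sup>2) \<partial>M) \<longlonglongrightarrow> 0"
    unfolding has_stochastic_integral_def by blast
  note p_props = partition_of_nonneg[OF p] and q_props = partition_of_nonneg[OF q]
  have p_mono: "p k i \<le> p k (Suc i)" if "i < n k" for k i using p[of k] that by (auto simp: partition_of_def)
  have q_mono: "q k i \<le> q k (Suc i)" if "i < m k" for k i using q[of k] that by (auto simp: partition_of_def)
  let ?p1 = "\<lambda>k i. max s (p k i)" and ?p2 = "\<lambda>k i. min s (p k i)"
  have p1_mono: "?p1 k i \<le> ?p1 k (Suc i)" and p2_mono: "?p2 k i \<le> ?p2 k (Suc i)" if "i < n k" for k i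
    using p_mono[OF that] by auto
  define \<sigma>' where "\<sigma>' x = indicator {0..} x *\<^sub>R \<sigma> x" for x
  have [measurable]: "\<sigma>' \<in> borel_measurable borel"
    unfolding \<sigma>'_def[abs_def] by (rule borel_measurable_continuous_on_indicator[OF _ \<sigma>]) simp
  have \<sigma>': "\<sigma>' x = \<sigma> x" if "x \<ge> 0" for x using that by (simp add: \<sigma>'_def)
  have step_meas [measurable]: "step_integral B (n k) (p k) (c k) \<in> borel_measurable M"
    "step_integral B (m k) (q k) (d k) \<in> borel_measurable M"
    "step_integral B (n k) (?p1 k) (c k) \<in> borel_measurable M"
    "step_integral B (n k) (?p2 k) (c k) \<in> borel_measurable M" for k
  proof -
    have np: "0 \<le> p k i" "p k i \<le> t" if "i \<le> n k" for i using p_props[OF that] by auto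
    have mq: "0 \<le> q k i" "q k i \<le> t" if "i \<le> m k" for i using q_props[OF that] st by auto
    show "step_integral B (n k) (p k) (c k) \<in> borel_measurable M"
      by (rule measurable_natural[OF step_integral_adapted[where t=t]]) (use np in auto)
    show "step_integral B (m k) (q k) (d k) \<in> borel_measurable M"
      by (rule measurable_natural[OF step_integral_adapted[where t=t]]) (use mq in auto)
    show "step_integral B (n k) (?p1 k) (c k) \<in> borel_measurable M"
      by (rule measurable_natural[OF step_integral_adapted[where t=t]]) (use np st in \<open>auto simp: le_max_iff_disj\<close>)
    show "step_integral B (n k) (?p2 k) (c k) \<in> borel_measurable M"
      by (rule measurable_natural[OF step_integral_adapted[where t=t]]) (use np st in \<open>auto simp: min_le_iff_disj\<close>)
  qed
  note [measurable] = Yt_meas Ys_meas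
  define a1' where "a1' k = (\<integral>\<^sup>+x\<in>{0..t}. ennreal ((step_fun (n k) (p k) (c k) x - \<sigma> x)\<^sup>2) \<partial>lborel)" for k
  define a2' where "a2' k = (\<integral>\<^sup>+x\<in>{0..s}. ennreal ((step_fun (m k) (q k) (d k) x - \<sigma> x)\<^sup>2) \<partial>lborel)" for k
  define e1' where "e1' k = (\<integral>\<^sup>+\<omega>. ennreal ((step_integral B (n k) (p k) (c k) \<omega> - Yt \<omega>)\<^sup>2) \<partial>M)" for k
  define e2' where "e2' k = (\<integral>\<^sup>+\<omega>. ennreal ((step_integral B (m k) (q k) (d k) \<omega> - Ys \<omega>)\<^sup>2) \<partial>M)" for k
  \<comment> \<open>The parts of the two approximations before time \<open>s\<close> are close, by the isometry.\<close>
  have before: "(\<integral>\<^sup>+\<omega>. ennreal ((step_integral B (n k) (?p2 k) (c k) \<omega> - step_integral B (m k) (q k) (d k) \<omega>)\<^sup>2) \<partial>M)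
      \<le> 2 * a1' k + 2 * a2' k" for k
  proof -
    have "(\<integral>\<^sup>+\<omega>. ennreal ((step_integral B (n k) (?p2 k) (c k) \<omega> - step_integral B (m k) (q k) (d k) \<omega>)\<^sup>2) \<partial>M)
      = (\<integral>\<^sup>+x. ennreal ((step_fun (n k) (?p2 k) (c k) x - step_fun (m k) (q k) (d k) x)\<^sup>2) \<partial>lborel)"
      using p_props[of _ k] q_props[of _ k] st by (intro step_isometry p2_mono q_mono) auto
    also have "\<dots> \<le> (\<integral>\<^sup>+x. 2 * (ennreal ((step_fun (n k) (p k) (c k) x - \<sigma>' x)\<^sup>2) * indicator {0..t} x)
        + 2 * (ennreal ((step_fun (m k) (q k) (d k) x - \<sigma>' x)\<^sup>2) * indicator {0..s} x) \<partial>lborel)"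
    proof (rule nn_integral_mono)
      fix x
      let ?P = "step_fun (n k) (p k) (c k) x" and ?Q = "step_fun (m k) (q k) (d k) x"
      have P2: "step_fun (n k) (?p2 k) (c k) x = ?P * indicator {..s} x"
        by (rule step_split_at(3)[of "n k" "p k", OF p_mono])
      show "ennreal ((step_fun (n k) (?p2 k) (c k) x - ?Q)\<^sup>2) \<le> 2 * (ennreal ((?P - \<sigma>' x)\<^sup>2) * indicator {0..t} x)
          + 2 * (ennreal ((?Q - \<sigma>' x)\<^sup>2) * indicator {0..s} x)"
      proof (cases "x \<in> {0..s}")
        case True
        have "ennreal ((?P - ?Q)\<^sup>2) \<le> ennreal (2 * (?P - \<sigma>' x)\<^sup>2 + 2 * (?Q - \<sigma>' x)\<^sup>2)"
          by (intro ennreal_leI diff_squared_le)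
        then show ?thesis using True st unfolding P2 by (simp add: ennreal_plus ennreal_mult)
      next
        case False
        have Q0: "?Q = 0"
          using False q_props[of 0 k] q_props[of "m k" k]
          by (intro step_fun_outside q_mono) auto
        have P0: "?P * indicator {..s} x = 0"
          using False p_props[of 0 k] step_fun_outside[of "n k" "p k" x "c k", OF p_mono] by (cases "x < 0") auto
        show ?thesis unfolding P2 P0 Q0 by simp
      qed
    qed
    also have "\<dots> = 2 * (\<integral>\<^sup>+x. ennreal ((step_fun (n k) (p k) (c k) x - \<sigma>' x)\<^sup>2) * indicator {0..t} x \<partial>lborel)
        + 2 * (\<integral>\<^sup>+x. ennreal ((step_fun (m k) (q k) (d k) x - \<sigma>' x)\<^sup>2) * indicator {0..s} x \<partial>lborel)"
      by (subst nn_integral_add) (simp_all add: nn_integral_cmult)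
    also have "\<dots> = 2 * a1' k + 2 * a2' k"
    proof -
      have "(ennreal ((g x - \<sigma>' x)\<^sup>2) * indicator {0..r} x) = (ennreal ((g x - \<sigma> x)\<^sup>2) * indicator {0..r} x)"
        for g r x by (cases "x \<ge> 0") (simp_all add: \<sigma>')
      then show ?thesis by (simp only: a1'_def a2'_def)
    qed
    finally show ?thesis .
  qed
  have bound: "(\<integral>\<^sup>+\<omega>. ennreal ((step_integral B (n k) (?p1 k) (c k) \<omega> - (Yt \<omega> - Ys \<omega>))\<^sup>2) \<partial>M)
      \<le> 3 * e1' k + 3 * (2 * a1' k + 2 * a2' k) + 3 * e2' k" for k
  proof -
    let ?I = "step_integral B (n k) (p k) (c k)" and ?J = "step_integral B (m k) (q k) (d k)"
    let ?I2 = "step_integral B (n k) (?p2 k) (c k)"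
    have "(\<integral>\<^sup>+\<omega>. ennreal ((step_integral B (n k) (?p1 k) (c k) \<omega> - (Yt \<omega> - Ys \<omega>))\<^sup>2) \<partial>M)
      \<le> (\<integral>\<^sup>+\<omega>. 3 * ennreal ((?I \<omega> - Yt \<omega>)\<^sup>2) + 3 * ennreal ((?I2 \<omega> - ?J \<omega>)\<^sup>2) + 3 * ennreal ((?J \<omega> - Ys \<omega>)\<^sup>2) \<partial>M)"
    proof (rule nn_integral_mono)
      fix \<omega>
      have eq: "step_integral B (n k) (?p1 k) (c k) \<omega> - (Yt \<omega> - Ys \<omega>) = (?I \<omega> - Yt \<omega>) - (?I2 \<omega> - ?J \<omega>) - (?J \<omega> - Ys \<omega>)"
        using step_split_at(1)[of "n k" "p k" B "c k" \<omega> s, OF p_mono] by linarith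
      have "ennreal ((step_integral B (n k) (?p1 k) (c k) \<omega> - (Yt \<omega> - Ys \<omega>))\<^sup>2)
        \<le> ennreal (3 * (?I \<omega> - Yt \<omega>)\<^sup>2 + 3 * (?I2 \<omega> - ?J \<omega>)\<^sup>2 + 3 * (?J \<omega> - Ys \<omega>)\<^sup>2)"
        unfolding eq by (intro ennreal_leI sum3_squared_le)
      then show "ennreal ((step_integral B (n k) (?p1 k) (c k) \<omega> - (Yt \<omega> - Ys \<omega>))\<^sup>2)
        \<le> 3 * ennreal ((?I \<omega> - Yt \<omega>)\<^sup>2) + 3 * ennreal ((?I2 \<omega> - ?J \<omega>)\<^sup>2) + 3 * ennreal ((?J \<omega> - Ys \<omega>)\<^sup>2)"
        by (simp add: ennreal_plus ennreal_mult)
    qed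
    also have "\<dots> = 3 * e1' k + 3 * (\<integral>\<^sup>+\<omega>. ennreal ((?I2 \<omega> - ?J \<omega>)\<^sup>2) \<partial>M) + 3 * e2' k"
      unfolding e1'_def e2'_def by (simp add: nn_integral_add nn_integral_cmult)
    also have "\<dots> \<le> 3 * e1' k + 3 * (2 * a1' k + 2 * a2' k) + 3 * e2' k"
      by (intro add_mono mult_left_mono before) auto
    finally show ?thesis .
  qed
  have "(\<lambda>k. 3 * e1' k + 3 * (2 * a1' k + 2 * a2' k) + 3 * e2' k) \<longlonglongrightarrow> 3 * 0 + 3 * (2 * 0 + 2 * 0) + 3 * 0"
    unfolding a1'_def a2'_def e1'_def e2'_def
    by (intro tendsto_add ennreal_tendsto_cmult a1 a2 e1 e2) auto
  then have lim: "(\<lambda>k. 3 * e1' k + 3 * (2 * a1' k + 2 * a2' k) + 3 * e2' k) \<longlonglongrightarrow> 0" by simp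
  have 1: "(\<lambda>k. \<integral>\<^sup>+\<omega>. ennreal ((step_integral B (n k) (?p1 k) (c k) \<omega> - (Yt \<omega> - Ys \<omega>))\<^sup>2) \<partial>M) \<longlonglongrightarrow> 0"
    by (rule tendsto_sandwich[OF _ _ tendsto_const lim]) (use bound in auto)
  have 2: "(\<lambda>k. \<integral>\<^sup>+x\<in>{s<..t}. ennreal ((step_fun (n k) (?p1 k) (c k) x - \<sigma> x)\<^sup>2) \<partial>lborel) \<longlonglongrightarrow> 0"
  proof (rule tendsto_sandwich[OF _ _ tendsto_const a1])
    show "\<forall>\<^sub>F k in sequentially. (\<integral>\<^sup>+x\<in>{s<..t}. ennreal ((step_fun (n k) (?p1 k) (c k) x - \<sigma> x)\<^sup>2) \<partial>lborel)
        \<le> (\<integral>\<^sup>+x\<in>{0..t}. ennreal ((step_fun (n k) (p k) (c k) x - \<sigma> x)\<^sup>2) \<partial>lborel)"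
      using st by (intro always_eventually allI nn_integral_mono)
        (auto simp: step_split_at(2)[of "n _" "p _", OF p_mono] split: split_indicator)
  qed simp
  show ?thesis
  proof (rule exI[of _ n], rule exI[of _ ?p1], rule exI[of _ c], intro conjI allI impI)
    show "?p1 k (n k) \<le> t" for k using p_props[of "n k" k] st by simp
    show "?p1 k i \<le> ?p1 k (Suc i)" if "i < n k" for k i using p1_mono[OF that] .
  qed (use 1 2 in auto)
qed

lemma step_norms_converge:
  assumes st: "0 \<le> s" "s \<le> t" and \<sigma>: "continuous_on {0..} \<sigma>"
    and p: "\<And>k. s \<le> p k 0" "\<And>k. p k (n k) \<le> t" "\<And>k i. i < n k \<Longrightarrow> p k i \<le> p k (Suc i)"
    and lim: "(\<lambda>k. \<integral>\<^sup>+x\<in>{s<..t}. ennreal ((step_fun (n k) (p k) (c k) x - \<sigma> x)\<^sup>2) \<partial>lborel) \<longlonglongrightarrow> 0"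
  shows "(\<lambda>k. \<Sum>i<n k. (c k i)\<^sup>2 * (p k (Suc i) - p k i)) \<longlonglongrightarrow> (LINT x:{s<..t}|lborel. (\<sigma> x)\<^sup>2)"
proof -
  define h where "h k = step_fun (n k) (p k) (c k)" for k
  define S where "S = (indicator {s<..t} :: real \<Rightarrow> real)"
  have "set_integrable lborel {s..t} (\<lambda>x. (\<sigma> x)\<^sup>2)"
    using st by (intro borel_integrable_atLeastAtMost' continuous_intros continuous_on_subset[OF \<sigma>]) auto
  then have "set_integrable lborel {s<..t} (\<lambda>x. (\<sigma> x)\<^sup>2)" by (rule set_integrable_subset) auto
  then have int\<sigma>: "integrable lborel (\<lambda>x. S x * (\<sigma> x)\<^sup>2)" by (simp add: set_integrable_def S_def)
  define v where "v = (\<integral>x. S x * (\<sigma> x)\<^sup>2 \<partial>lborel)"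
  have v: "v = (LINT x:{s<..t}|lborel. (\<sigma> x)\<^sup>2)" by (simp add: v_def S_def set_lebesgue_integral_def)
  have "v \<ge> 0" unfolding v_def by (intro integral_nonneg_AE) (auto simp: S_def)
  have hS: "(h k x)\<^sup>2 = S x * (h k x)\<^sup>2" for k x
    using step_fun_outside[of "n k" "p k" x "c k", OF p(3)] p(1,2)[of k]
    by (cases "x \<le> s \<or> x > t") (auto simp: S_def h_def intro: order_trans)
  note norm_h = integral_step_fun_squared[of "n k" "p k" "c k" for k, OF p(3), folded h_def]
  have inth: "integrable lborel (\<lambda>x. S x * (h k x)\<^sup>2)" for k
    using norm_h(1)[of k] by (subst hS[symmetric])
  have meas: "(\<lambda>x. S x * (h k x - \<sigma> x)\<^sup>2) \<in> borel_measurable lborel" for k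
  proof -
    have "(\<lambda>x. indicator {s<..t} x *\<^sub>R \<sigma> x) \<in> borel_measurable borel"
      using st by (intro borel_measurable_continuous_on_indicator continuous_on_subset[OF \<sigma>]) auto
    then have [measurable]: "(\<lambda>x. S x * \<sigma> x) \<in> borel_measurable borel" by (simp add: S_def)
    have [measurable]: "S \<in> borel_measurable borel" "h k \<in> borel_measurable borel" by (simp_all add: S_def h_def)
    have "S x * (h k x - \<sigma> x)\<^sup>2 = (S x * h k x - S x * \<sigma> x)\<^sup>2" for x
      by (auto simp: S_def split: split_indicator)
    then show ?thesis by simp
  qed
  have intd: "integrable lborel (\<lambda>x. S x * (h k x - \<sigma> x)\<^sup>2)" for k
  proof (rule Bochner_Integration.integrable_bound)
    show "integrable lborel (\<lambda>x. 2 * (S x * (h k x)\<^sup>2) + 2 * (S x * (\<sigma> x)\<^sup>2))"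
      by (intro Bochner_Integration.integrable_add integrable_mult_right inth int\<sigma>)
    show "AE x in lborel. norm (S x * (h k x - \<sigma> x)\<^sup>2) \<le> norm (2 * (S x * (h k x)\<^sup>2) + 2 * (S x * (\<sigma> x)\<^sup>2))"
      using diff_squared_le[of "h k x" "\<sigma> x" 0 for x] by (auto simp: S_def split: split_indicator)
  qed (rule meas)
  define e where "e k = (\<integral>x. S x * (h k x - \<sigma> x)\<^sup>2 \<partial>lborel)" for k
  have e_eq: "e k = enn2real (\<integral>\<^sup>+x\<in>{s<..t}. ennreal ((step_fun (n k) (p k) (c k) x - \<sigma> x)\<^sup>2) \<partial>lborel)" for k
  proof -
    have "(\<integral>\<^sup>+x\<in>{s<..t}. ennreal ((step_fun (n k) (p k) (c k) x - \<sigma> x)\<^sup>2) \<partial>lborel) = (\<integral>\<^sup>+x. ennreal (S x * (h k x - \<sigma> x)\<^sup>2) \<partial>lborel)"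
      by (intro nn_integral_cong) (auto simp: S_def h_def split: split_indicator)
    also have "\<dots> = ennreal (e k)"
      unfolding e_def by (intro nn_integral_eq_integral intd) (auto simp: S_def)
    finally show ?thesis by (simp add: e_def integral_nonneg_AE S_def)
  qed
  have lim': "(\<lambda>k. \<integral>\<^sup>+x\<in>{s<..t}. ennreal ((step_fun (n k) (p k) (c k) x - \<sigma> x)\<^sup>2) \<partial>lborel) \<longlonglongrightarrow> ennreal 0"
    using lim by simp
  have e: "e \<longlonglongrightarrow> 0"
    unfolding ext[of e, OF e_eq] by (rule tendsto_enn2real[OF lim']) simp
  have close: "\<bar>(\<integral>x. S x * (h k x)\<^sup>2 \<partial>lborel) - v\<bar> \<le> (1 + 1 / d) * e k + d * v" if "d > 0" for d k
  proof -
    have "\<bar>(\<integral>x. S x * (h k x)\<^sup>2 \<partial>lborel) - v\<bar> = \<bar>\<integral>x. S x * (h k x)\<^sup>2 - S x * (\<sigma> x)\<^sup>2 \<partial>lborel\<bar>"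
      unfolding v_def by (subst Bochner_Integration.integral_diff[OF inth int\<sigma>]) simp
    also have "\<dots> \<le> (\<integral>x. \<bar>S x * (h k x)\<^sup>2 - S x * (\<sigma> x)\<^sup>2\<bar> \<partial>lborel)" by (rule integral_abs_bound)
    also have "\<dots> \<le> (\<integral>x. (1 + 1 / d) * (S x * (h k x - \<sigma> x)\<^sup>2) + d * (S x * (\<sigma> x)\<^sup>2) \<partial>lborel)"
    proof (rule integral_mono)
      show "integrable lborel (\<lambda>x. \<bar>S x * (h k x)\<^sup>2 - S x * (\<sigma> x)\<^sup>2\<bar>)"
        by (intro integrable_abs Bochner_Integration.integrable_diff inth int\<sigma>)
      show "integrable lborel (\<lambda>x. (1 + 1 / d) * (S x * (h k x - \<sigma> x)\<^sup>2) + d * (S x * (\<sigma> x)\<^sup>2))"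
        by (intro Bochner_Integration.integrable_add integrable_mult_right intd int\<sigma>)
      show "\<bar>S x * (h k x)\<^sup>2 - S x * (\<sigma> x)\<^sup>2\<bar> \<le> (1 + 1 / d) * (S x * (h k x - \<sigma> x)\<^sup>2) + d * (S x * (\<sigma> x)\<^sup>2)" for x
        using squares_close[OF that, of "h k x" "\<sigma> x"] by (auto simp: S_def split: split_indicator)
    qed
    also have "\<dots> = (1 + 1 / d) * e k + d * v"
      unfolding e_def v_def using intd int\<sigma> by (subst Bochner_Integration.integral_add) auto
    finally show ?thesis .
  qed
  have "(\<lambda>k. \<integral>x. S x * (h k x)\<^sup>2 \<partial>lborel) \<longlonglongrightarrow> v"
  proof (rule tendstoI)
    fix \<epsilon> :: real assume "\<epsilon> > 0"
    define d where "d = \<epsilon> / (2 * (v + 1))"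
    have d: "d > 0" "d * v < \<epsilon> / 2" using \<open>\<epsilon> > 0\<close> \<open>v \<ge> 0\<close> by (auto simp: d_def field_simps)
    have "(\<lambda>k. (1 + 1 / d) * e k) \<longlonglongrightarrow> (1 + 1 / d) * 0" by (intro tendsto_intros e)
    then have "\<forall>\<^sub>F k in sequentially. (1 + 1 / d) * e k < \<epsilon> / 2"
      using \<open>\<epsilon> > 0\<close> by (intro order_tendstoD) auto
    then show "\<forall>\<^sub>F k in sequentially. dist (\<integral>x. S x * (h k x)\<^sup>2 \<partial>lborel) v < \<epsilon>"
    proof eventually_elim
      case (elim k)
      have "\<bar>(\<integral>x. S x * (h k x)\<^sup>2 \<partial>lborel) - v\<bar> \<le> (1 + 1 / d) * e k + d * v" by (rule close[OF d(1)])
      also have "\<dots> < \<epsilon>" using elim d(2) by linarith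
      finally show ?case unfolding dist_real_def .
    qed
  qed
  moreover have "(\<integral>x. S x * (h k x)\<^sup>2 \<partial>lborel) = (\<Sum>i<n k. (c k i)\<^sup>2 * (p k (Suc i) - p k i))" for k
  proof -
    have "(\<lambda>x. S x * (h k x)\<^sup>2) = (\<lambda>x. (h k x)\<^sup>2)" by (rule ext) (rule hS[symmetric])
    then show ?thesis using norm_h(2)[of k] by (simp only:)
  qed
  ultimately show ?thesis unfolding v by simp
qed

text \<open>Pass to the limit in the identity for step integrals, along a subsequence for which these converge almost
surely.\<close>

lemma char_stochastic_integral_increment:
  assumes st: "0 \<le> s" "s \<le> t" and \<sigma>: "continuous_on {0..} \<sigma>"
    and Yt: "has_stochastic_integral M B \<sigma> t Yt" and Ys: "has_stochastic_integral M B \<sigma> s Ys"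
    and A: "A \<in> sets (\<C> s)"
  shows "(LINT \<omega>:A|M. iexp (u * (Yt \<omega> - Ys \<omega>)))
    = complex_of_real (exp (- u\<^sup>2 * (LINT x:{s<..t}|lborel. (\<sigma> x)\<^sup>2) / 2) * prob A)"
proof -
  have meas [measurable]: "Yt \<in> borel_measurable M" "Ys \<in> borel_measurable M"
    using Yt Ys by (auto simp: has_stochastic_integral_def)
  obtain A' where A': "A' \<in> sets (\<N> s)" "AE \<omega> in M. \<omega> \<in> A \<longleftrightarrow> \<omega> \<in> A'"
    using completed_sets_representative[OF natural_subalgebra[of s]] A by (auto simp: sets_completed)
  have AM [measurable]: "A \<in> sets M" "A' \<in> sets M"
    using A A'(1) completed_subalgebra[of s] natural_subalgebra[of s] by (auto simp: subalgebra_def)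
  obtain n :: "nat \<Rightarrow> nat" and p c where p: "\<And>k. s \<le> p k 0" "\<And>k. p k (n k) \<le> t" "\<And>k i. i < n k \<Longrightarrow> p k i \<le> p k (Suc i)"
    and lim\<sigma>: "(\<lambda>k. \<integral>\<^sup>+x\<in>{s<..t}. ennreal ((step_fun (n k) (p k) (c k) x - \<sigma> x)\<^sup>2) \<partial>lborel) \<longlonglongrightarrow> 0"
    and limY: "(\<lambda>k. \<integral>\<^sup>+\<omega>. ennreal ((step_integral B (n k) (p k) (c k) \<omega> - (Yt \<omega> - Ys \<omega>))\<^sup>2) \<partial>M) \<longlonglongrightarrow> 0"
    using increment_approximation[OF st \<sigma> Yt Ys] by blast
  define J where "J k = step_integral B (n k) (p k) (c k)" for k
  have J [measurable]: "J k \<in> borel_measurable M" for k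
    unfolding J_def
  proof (rule measurable_natural[OF step_integral_adapted])
    fix i assume "i \<le> n k"
    then show "0 \<le> p k i" "p k i \<le> t"
      using mono_upto[of "n k" "p k" 0 i, OF p(3)] mono_upto[of "n k" "p k" i "n k", OF p(3)] p(1,2)[of k] st by simp_all
  qed
  from L2_limit_AE_subseq[OF J _ limY[folded J_def]]
  obtain r :: "nat \<Rightarrow> nat" where r_mono: "strict_mono r"
    and r: "AE \<omega> in M. (\<lambda>k. J (r k) \<omega>) \<longlonglongrightarrow> Yt \<omega> - Ys \<omega>" by auto
  define V where "V k = (\<Sum>i<n k. (c k i)\<^sup>2 * (p k (Suc i) - p k i))" for k
  define v where "v = (LINT x:{s<..t}|lborel. (\<sigma> x)\<^sup>2)"
  have "V \<longlonglongrightarrow> v"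
    unfolding V_def[abs_def] v_def by (rule step_norms_converge[OF st \<sigma> p lim\<sigma>])
  from LIMSEQ_subseq_LIMSEQ[OF this r_mono] have V: "(\<lambda>k. V (r k)) \<longlonglongrightarrow> v" by (simp add: comp_def)
  have "(LINT \<omega>:A'|M. iexp (u * J k \<omega>)) = complex_of_real (exp (- u\<^sup>2 * V k / 2) * prob A')" for k
    unfolding J_def V_def by (rule char_step_integral[OF st(1) p(1) p(3) A'(1)])
  moreover have "(\<lambda>k. complex_of_real (exp (- u\<^sup>2 * V (r k) / 2) * prob A')) \<longlonglongrightarrow> complex_of_real (exp (- u\<^sup>2 * v / 2) * prob A')"
    by (intro tendsto_intros V) simp
  ultimately have 1: "(\<lambda>k. LINT \<omega>:A'|M. iexp (u * J (r k) \<omega>)) \<longlonglongrightarrow> complex_of_real (exp (- u\<^sup>2 * v / 2) * prob A')"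
    by simp
  have 2: "(\<lambda>k. LINT \<omega>:A'|M. iexp (u * J (r k) \<omega>)) \<longlonglongrightarrow> (LINT \<omega>:A'|M. iexp (u * (Yt \<omega> - Ys \<omega>)))"
    unfolding set_lebesgue_integral_def
  proof (rule integral_dominated_convergence[where w="\<lambda>_. 1"])
    show "AE \<omega> in M. (\<lambda>k. indicator A' \<omega> *\<^sub>R iexp (u * J (r k) \<omega>)) \<longlonglongrightarrow> indicator A' \<omega> *\<^sub>R iexp (u * (Yt \<omega> - Ys \<omega>))"
      using r
    proof eventually_elim
      case (elim \<omega>)
      then have "(\<lambda>k. u * J (r k) \<omega>) \<longlonglongrightarrow> u * (Yt \<omega> - Ys \<omega>)" by (intro tendsto_intros)
      then have "(\<lambda>k. iexp (u * J (r k) \<omega>)) \<longlonglongrightarrow> iexp (u * (Yt \<omega> - Ys \<omega>))"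
        by (rule isCont_tendsto_compose[OF isCont_iexp])
      then show ?case by (rule tendsto_scaleR[OF tendsto_const])
    qed
    show "AE \<omega> in M. norm (indicator A' \<omega> *\<^sub>R iexp (u * J (r k) \<omega>)) \<le> 1" for k
      by (auto split: split_indicator)
  qed auto
  have "(LINT \<omega>:A|M. iexp (u * (Yt \<omega> - Ys \<omega>))) = (LINT \<omega>:A'|M. iexp (u * (Yt \<omega> - Ys \<omega>)))"
    unfolding set_lebesgue_integral_def
  proof (rule integral_cong_AE)
    show "AE \<omega> in M. indicator A \<omega> *\<^sub>R iexp (u * (Yt \<omega> - Ys \<omega>)) = indicator A' \<omega> *\<^sub>R iexp (u * (Yt \<omega> - Ys \<omega>))"
      using A'(2) by eventually_elim (simp add: indicator_def)
  qed simp_all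
  also have "\<dots> = complex_of_real (exp (- u\<^sup>2 * v / 2) * prob A')" by (rule LIMSEQ_unique[OF 2 1])
  also have "prob A' = prob A" using A'(2) by (intro finite_measure_eq_AE) auto
  finally show ?thesis by (simp only: v_def)
qed

lemma stochastic_integral_adapted:
  assumes Y: "has_stochastic_integral M B \<sigma> t Y"
  shows "Y \<in> borel_measurable (\<C> t)"
proof -
  from Y obtain n :: "nat \<Rightarrow> nat" and p c where Y_meas: "Y \<in> borel_measurable M"
    and p: "\<And>k. partition_of t (n k) (p k)"
    and e: "(\<lambda>k. \<integral>\<^sup>+\<omega>. ennreal ((step_integral B (n k) (p k) (c k) \<omega> - Y \<omega>)\<^sup>2) \<partial>M) \<longlonglongrightarrow> 0"
    unfolding has_stochastic_integral_def by blast
  have J: "step_integral B (n k) (p k) (c k) \<in> borel_measurable (\<N> t)" for k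
    using partition_of_nonneg[OF p] by (intro step_integral_adapted) auto
  obtain r where "AE \<omega> in M. (\<lambda>k. step_integral B (n (r k)) (p (r k)) (c (r k)) \<omega>) \<longlonglongrightarrow> Y \<omega>"
    using L2_limit_AE_subseq[OF measurable_natural[OF J] Y_meas e] by blast
  then show ?thesis using J by (intro AE_limit_adapted[OF _ Y_meas]) auto
qed

theorem stochastic_integral_gaussian_increments:
  assumes \<sigma>: "continuous_on {0..} \<sigma>" and Y: "\<And>t. t \<ge> 0 \<Longrightarrow> has_stochastic_integral M B \<sigma> t (Y t)"
  shows "gaussian_increments M \<C> Y (variance_of \<sigma>)"
proof unfold_locales
  show "subalgebra M (\<C> t)" for t by (rule completed_subalgebra)
  show "sets (\<C> s) \<subseteq> sets (\<C> t)" if "s \<le> t" for s t using that by (rule completed_mono)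
  show "Y t \<in> borel_measurable (\<C> t)" if "t \<ge> 0" for t using Y[OF that] by (rule stochastic_integral_adapted)
  show "variance_of \<sigma> s \<le> variance_of \<sigma> t" if st: "0 \<le> s" "s \<le> t" for s t
  proof -
    have "0 \<le> (LINT x:{s<..t}|lborel. (\<sigma> x)\<^sup>2)"
      unfolding set_lebesgue_integral_def by (intro integral_nonneg_AE) auto
    then show ?thesis using variance_increment[OF st \<sigma>] by simp
  qed
  show "(LINT \<omega>:A|M. iexp (u * (Y t \<omega> - Y s \<omega>))) = complex_of_real (exp (- u\<^sup>2 * (variance_of \<sigma> t - variance_of \<sigma> s) / 2) * prob A)"
    if st: "0 \<le> s" "s \<le> t" and A: "A \<in> sets (\<C> s)" for s t A u
    unfolding variance_increment[OF st \<sigma>]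
    using st by (intro char_stochastic_integral_increment \<sigma> Y A) auto
qed

end

section \<open>The variance of the noise\<close>

lemma set_integral_Icc_eq_integral:
  fixes g :: "real \<Rightarrow> real"
  assumes "continuous_on {0..} g" "t \<ge> 0"
  shows "(LINT s:{0..t}|lborel. g s) = integral {0..t} g"
  using assms by (intro set_borel_integral_eq_integral(2) borel_integrable_atLeastAtMost' continuous_on_subset[OF assms(1)]) auto

lemma integral_from_0_has_derivative:
  fixes g :: "real \<Rightarrow> real"
  assumes g: "continuous_on {0..} g" and t: "t > 0"
  shows "((\<lambda>t. LINT s:{0..t}|lborel. g s) has_real_derivative g t) (at t)"
proof -
  have "((\<lambda>u. integral {0..u} g) has_real_derivative g t) (at t within {0..t + 1})"
    using t by (intro integral_has_real_derivative continuous_on_subset[OF g]) auto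
  then have *: "((\<lambda>u. integral {0..u} g) has_real_derivative g t) (at t)"
    using t by (subst (asm) at_within_Icc_at) auto
  have "\<forall>\<^sub>F u in nhds t. u \<in> {0<..}" using t by (intro eventually_nhds_in_open) auto
  then have "\<forall>\<^sub>F u in nhds t. integral {0..u} g = (LINT s:{0..u}|lborel. g s)"
    by eventually_elim (simp add: set_integral_Icc_eq_integral[OF g])
  then show ?thesis using * by (subst (asm) DERIV_cong_ev) auto
qed

lemma integral_from_0_continuous:
  fixes g :: "real \<Rightarrow> real"
  assumes g: "continuous_on {0..} g"
  shows "continuous_on {0..T} (\<lambda>t. LINT s:{0..t}|lborel. g s)"
proof -
  have "g integrable_on {0..T}"
    using continuous_on_subset[OF g] by (intro integrable_continuous_real) auto
  then have "continuous_on {0..T} (\<lambda>t. integral {0..t} g)" by (rule indefinite_integral_continuous_1)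
  then show ?thesis
    by (rule continuous_on_eq) (simp add: set_integral_Icc_eq_integral[OF g])
qed

text \<open>If the variance stayed bounded, monotone convergence would make \<open>\<sigma>\<^sup>2\<close> integrable.\<close>

lemma square_not_integrable_imp_variance_at_top:
  fixes \<sigma> :: "real \<Rightarrow> real"
  assumes \<sigma>: "continuous_on {0..} \<sigma>" and not_int: "\<not> set_integrable lborel {0..} (\<lambda>s. (\<sigma> s)\<^sup>2)"
    and mono: "\<And>s t. 0 \<le> s \<Longrightarrow> s \<le> t \<Longrightarrow> variance_of \<sigma> s \<le> variance_of \<sigma> t"
  shows "filterlim (variance_of \<sigma>) at_top at_top"
proof (rule ccontr)
  assume "\<not> filterlim (variance_of \<sigma>) at_top at_top"
  then obtain K where "\<not> (\<forall>\<^sub>F t in at_top. variance_of \<sigma> t \<ge> K)"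
    by (auto simp: filterlim_at_top)
  then have freq: "\<exists>t\<ge>T. variance_of \<sigma> t < K" for T by (auto simp: eventually_at_top_linorder not_le)
  have bounded: "variance_of \<sigma> t \<le> K" if "t \<ge> 0" for t
  proof -
    obtain t' where "t' \<ge> t" "variance_of \<sigma> t' < K" using freq by blast
    then show ?thesis using mono[OF that, of t'] by simp
  qed
  define h where "h x = indicator {0..} x * (\<sigma> x)\<^sup>2" for x
  have trunc: "h x * indicator {..t} x = indicator {0..t} x *\<^sub>R (\<sigma> x)\<^sup>2" for t x
    by (auto simp: h_def indicator_def)
  have int: "integrable lborel (\<lambda>x. h x * indicator {..t} x)" for t
    unfolding trunc using square_integrable_Icc[OF order_refl \<sigma>, of t] by (simp add: set_integrable_def)
  have truncated_integral: "(\<integral>x. h x * indicator {..t} x \<partial>lborel) = variance_of \<sigma> t" for t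
    unfolding trunc by (simp add: variance_of_def set_lebesgue_integral_def)
  define l where "l = (SUP t\<in>{0..}. variance_of \<sigma> t)"
  have bdd: "bdd_above (variance_of \<sigma> ` {0..})" using bounded by (auto intro!: bdd_aboveI[of _ K])
  have "(variance_of \<sigma> \<longlongrightarrow> l) at_top"
  proof (rule order_tendstoI)
    fix a assume "a < l"
    then obtain T where T: "T \<ge> 0" "a < variance_of \<sigma> T"
      unfolding l_def by (subst (asm) less_cSUP_iff[OF _ bdd]) auto
    have "a < variance_of \<sigma> t" if "t \<ge> T" for t using mono[OF T(1) that] T(2) by simp
    then show "\<forall>\<^sub>F t in at_top. a < variance_of \<sigma> t" by (auto simp: eventually_at_top_linorder)
  next
    fix a assume "l < a"
    have "variance_of \<sigma> t < a" if "t \<ge> 0" for t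
      using cSUP_upper[OF _ bdd, of t] that \<open>l < a\<close> by (simp add: l_def)
    then show "\<forall>\<^sub>F t in at_top. variance_of \<sigma> t < a" by (auto simp: eventually_at_top_linorder)
  qed
  then have conv: "((\<lambda>t. \<integral>x. h x * indicator {..t} x \<partial>lborel) \<longlongrightarrow> l) at_top" by (simp only: truncated_integral)
  have "(\<lambda>x. indicator {0..} x *\<^sub>R \<sigma> x) \<in> borel_measurable borel"
    by (intro borel_measurable_continuous_on_indicator \<sigma>) simp
  then have "(\<lambda>x. (indicator {0..} x *\<^sub>R \<sigma> x)\<^sup>2) \<in> borel_measurable borel" by measurable
  moreover have "(indicator {0..} x *\<^sub>R \<sigma> x)\<^sup>2 = h x" for x by (auto simp: h_def indicator_def)
  ultimately have "h \<in> borel_measurable borel" by simp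
  then have "integrable lborel h"
    by (rule integrable_monotone_convergence_at_top[OF _ _ _ int conv, rotated 2]) (simp_all add: h_def)
  then show False using not_int by (simp add: set_integrable_def h_def[abs_def])
qed

lemma tail_var_eq:
  fixes \<sigma> :: "real \<Rightarrow> real"
  assumes int: "set_integrable lborel {0..} (\<lambda>s. (\<sigma> s)\<^sup>2)" and t: "t \<ge> 0"
  shows "tail_var \<sigma> t = tail_var \<sigma> 0 - variance_of \<sigma> t"
proof -
  have sub: "set_integrable lborel S (\<lambda>s. (\<sigma> s)\<^sup>2)" if "S \<subseteq> {0..}" "S \<in> sets borel" for S
    using set_integrable_subset[OF int] that by auto
  have "{0..} = {0..t} \<union> {t<..}" using t by auto
  then have "tail_var \<sigma> 0 = variance_of \<sigma> t + (LINT s:{t<..}|lborel. (\<sigma> s)\<^sup>2)"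
    unfolding tail_var_def variance_of_def by (simp only:) (rule set_integral_Un; use t in \<open>auto intro!: sub\<close>)
  moreover have "(LINT s:{t<..}|lborel. (\<sigma> s)\<^sup>2) = tail_var \<sigma> t"
    unfolding tail_var_def set_lebesgue_integral_def
  proof (rule integral_cong_AE)
    show "(\<lambda>s. indicator {t<..} s *\<^sub>R (\<sigma> s)\<^sup>2) \<in> borel_measurable lborel" "(\<lambda>s. indicator {t..} s *\<^sub>R (\<sigma> s)\<^sup>2) \<in> borel_measurable lborel"
      using sub[of "{t<..}"] sub[of "{t..}"] t by (auto simp: set_integrable_def subset_eq)
    show "AE s in lborel. indicator {t<..} s *\<^sub>R (\<sigma> s)\<^sup>2 = indicator {t..} s *\<^sub>R (\<sigma> s)\<^sup>2"
      using AE_lborel_singleton[of t] by eventually_elim (auto simp: indicator_def)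
  qed
  ultimately show ?thesis by simp
qed

lemma tail_var_positive:
  fixes \<sigma> :: "real \<Rightarrow> real"
  assumes int: "set_integrable lborel {0..} (\<lambda>s. (\<sigma> s)\<^sup>2)" and t: "t \<ge> 0"
    and pos: "(\<integral>\<^sup>+s\<in>{t..}. ennreal ((\<sigma> s)\<^sup>2) \<partial>lborel) > 0"
  shows "tail_var \<sigma> t > 0"
proof -
  have "set_integrable lborel {t..} (\<lambda>s. (\<sigma> s)\<^sup>2)" using set_integrable_subset[OF int] t by auto
  then have "(\<integral>\<^sup>+s. ennreal (indicator {t..} s *\<^sub>R (\<sigma> s)\<^sup>2) \<partial>lborel) = ennreal (tail_var \<sigma> t)"
    unfolding tail_var_def set_lebesgue_integral_def set_integrable_def
    by (intro nn_integral_eq_integral) auto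
  moreover have "(\<integral>\<^sup>+s. ennreal (indicator {t..} s *\<^sub>R (\<sigma> s)\<^sup>2) \<partial>lborel) = (\<integral>\<^sup>+s\<in>{t..}. ennreal ((\<sigma> s)\<^sup>2) \<partial>lborel)"
    by (intro nn_integral_cong) (auto simp: indicator_def)
  ultimately have "0 < ennreal (tail_var \<sigma> t)" using pos by simp
  then show ?thesis by (simp only: ennreal_less_zero_iff)
qed

text \<open>The times exist by the intermediate value theorem and tend to infinity because \<open>v\<close> never reaches
\<open>c\<close>.  They are not unique, as \<open>v\<close> may be constant on intervals.\<close>

lemma halving_times:
  fixes v :: "real \<Rightarrow> real"
  assumes cont: "\<And>T. continuous_on {0..T} v" and mono: "\<And>s t. 0 \<le> s \<Longrightarrow> s \<le> t \<Longrightarrow> v s \<le> v t"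
    and v0: "v 0 = 0" and less: "\<And>t. t \<ge> 0 \<Longrightarrow> v t < c" and lim: "(v \<longlongrightarrow> c) at_top"
  shows "\<exists>\<tau> :: nat \<Rightarrow> real. (\<forall>n. \<tau> n \<ge> 0) \<and> (\<forall>n. \<tau> n \<le> \<tau> (Suc n)) \<and> filterlim \<tau> at_top sequentially \<and>
    (\<forall>n. c - v (\<tau> n) = c / 2 ^ n)"
proof -
  have c: "c > 0" using less[of 0] v0 by simp
  have "\<exists>t\<ge>0. c - v t = c / 2 ^ n" for n :: nat
  proof -
    have "c - c / 2 ^ n < c" using c by simp
    then have "\<forall>\<^sub>F t in at_top. v t > c - c / 2 ^ n \<and> t \<ge> 0"
      using lim by (intro eventually_conj order_tendstoD eventually_ge_at_top)
    then obtain T where T: "v T > c - c / 2 ^ n" "T \<ge> 0"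
      using eventually_happens'[OF trivial_limit_at_top_linorder] by blast
    have "v 0 \<le> c - c / 2 ^ n" using c by (simp add: v0 field_simps)
    with T cont[of T] obtain t where "0 \<le> t" "v t = c - c / 2 ^ n"
      using IVT'[of v 0 "c - c / 2 ^ n" T] by auto
    then show ?thesis by auto
  qed
  then obtain \<tau> :: "nat \<Rightarrow> real" where \<tau>: "\<And>n. \<tau> n \<ge> 0" "\<And>n. c - v (\<tau> n) = c / 2 ^ n" by metis
  have later: "t \<le> \<tau> n" if "c / 2 ^ n < c - v t" for n t
  proof (rule ccontr)
    assume "\<not> t \<le> \<tau> n"
    then have "v (\<tau> n) \<le> v t" using \<tau>(1)[of n] by (intro mono) auto
    then show False using that \<tau>(2)[of n] by linarith
  qed
  show ?thesis
  proof (intro exI[of _ \<tau>] conjI allI)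
    show "\<tau> n \<ge> 0" for n by (rule \<tau>)
    show "c - v (\<tau> n) = c / 2 ^ n" for n by (rule \<tau>)
    show "\<tau> n \<le> \<tau> (Suc n)" for n
      using c by (intro later) (simp add: \<tau>(2) divide_strict_left_mono)
    show "filterlim \<tau> at_top sequentially"
    proof (subst filterlim_at_top_ge[where c=0], intro allI impI)
      fix T :: real assume "T \<ge> 0"
      have "(\<lambda>n. c * (1/2) ^ n) \<longlonglongrightarrow> c * 0" by (intro tendsto_mult_left LIMSEQ_realpow_zero) auto
      then have "\<forall>\<^sub>F n in sequentially. c * (1/2) ^ n < c - v T"
        using less[OF \<open>T \<ge> 0\<close>] by (intro order_tendstoD) auto
      then show "\<forall>\<^sub>F n in sequentially. T \<le> \<tau> n"
        by eventually_elim (rule later, simp add: power_divide)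
    qed
  qed
qed

section \<open>The noise along a path with a finite limiting ratio\<close>

context perturbed_equation
begin

lemma G_antimono:
  assumes "0 < s" "s \<le> t"
  shows "G t \<le> G s"
proof (rule DERIV_nonpos_imp_nonincreasing[OF assms(2)])
  fix x assume "s \<le> x" "x \<le> t"
  then have "x > 0" using assms by simp
  then show "\<exists>y. (G has_real_derivative y) (at x) \<and> y \<le> 0"
    using G_deriv[of x] pos[of "G x"] G_pos[of x] by (intro exI[of _ "- f (G x)"]) auto
qed

text \<open>Since \<open>Y = X - \<xi> + Q\<close>, the increment of the noise is that of \<open>X\<close>, which is \<open>L\<close> times that of \<open>G\<close> up to
\<open>o(G)\<close>, plus that of \<open>Q\<close>, which is \<open>l\<close> times that of \<open>-G\<close>.  So \<open>\<kappa> = l - L\<close>.\<close>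

lemma noise_increments:
  assumes x: "((\<lambda>t. x t / G t) \<longlongrightarrow> L) at_top"
    and Q: "\<And>t. t > 0 \<Longrightarrow> (Q has_real_derivative f (x t)) (at t)"
    and y: "\<And>t. t \<ge> 0 \<Longrightarrow> x t = \<xi> - Q t + y t"
  shows "\<exists>\<kappa>. \<forall>\<epsilon>>0. \<exists>T>0. \<forall>t s. T \<le> t \<longrightarrow> t \<le> s \<longrightarrow> \<bar>y s - y t - \<kappa> * (G t - G s)\<bar> \<le> \<epsilon> * G t"
proof -
  obtain l where l: "((\<lambda>t. f (x t) / f (G t)) \<longlongrightarrow> l) at_top" using drift_ratio_converges[OF x] by blast
  have "\<exists>T>0. \<forall>t s. T \<le> t \<longrightarrow> t \<le> s \<longrightarrow> \<bar>y s - y t - (l - L) * (G t - G s)\<bar> \<le> \<epsilon> * G t" if "\<epsilon> > 0" for \<epsilon>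
  proof -
    define d where "d = \<epsilon> / 3"
    have d: "d > 0" using that by (simp add: d_def)
    obtain T1 where T1: "\<And>t s. T1 \<le> t \<Longrightarrow> t \<le> s \<Longrightarrow> (l - d) * (G t - G s) \<le> Q s - Q t \<and> Q s - Q t \<le> (l + d) * (G t - G s)"
      using drift_increment_bounds[OF Q l d] by blast
    have "\<forall>\<^sub>F t in at_top. dist (x t / G t) L < d" using x d by (auto simp: tendsto_iff)
    then obtain T2 where T2: "\<And>t. t \<ge> T2 \<Longrightarrow> dist (x t / G t) L < d" by (auto simp: eventually_at_top_linorder)
    define T where "T = Max {1, T1, T2}"
    have T: "T \<ge> 1" "T \<ge> T1" "T \<ge> T2" by (auto simp: T_def)
    have close: "\<bar>x t - L * G t\<bar> \<le> d * G t" if "t \<ge> T" for t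
    proof -
      have G: "G t > 0" using G_pos[of t] T that by simp
      have "\<bar>x t / G t - L\<bar> * G t \<le> d * G t" using T2[of t] T that G by (intro mult_right_mono) (auto simp: dist_real_def)
      moreover have "(x t / G t - L) * G t = x t - L * G t" using G by (simp add: left_diff_distrib)
      then have "\<bar>x t / G t - L\<bar> * \<bar>G t\<bar> = \<bar>x t - L * G t\<bar>" by (simp only: abs_mult[symmetric])
      then have "\<bar>x t / G t - L\<bar> * G t = \<bar>x t - L * G t\<bar>" using G by simp
      ultimately show ?thesis by simp
    qed
    have "\<bar>y s - y t - (l - L) * (G t - G s)\<bar> \<le> \<epsilon> * G t" if "T \<le> t" "t \<le> s" for t s
    proof -
      have G: "0 < G s" "G s \<le> G t" using G_pos[of s] G_antimono[of t s] T that by auto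
      have Qb: "\<bar>Q s - Q t - l * (G t - G s)\<bar> \<le> d * (G t - G s)"
        using T1[of t s] T that by (auto simp: abs_le_iff algebra_simps)
      have "y s - y t - (l - L) * (G t - G s) = (x s - L * G s) - (x t - L * G t) + (Q s - Q t - l * (G t - G s))"
        using y[of s] y[of t] T that by (simp add: algebra_simps)
      then have "\<bar>y s - y t - (l - L) * (G t - G s)\<bar> \<le> d * G s + d * G t + d * (G t - G s)"
        using close[of s] close[of t] Qb that by linarith
      also have "\<dots> = 2 * (d * G t)" by (simp add: algebra_simps)
      also have "\<dots> \<le> \<epsilon> * G t" using G that d by (simp add: d_def)
      finally show ?thesis .
    qed
    then show ?thesis using T by (intro exI[of _ T]) auto
  qed
  then show ?thesis by blast
qed

lemma noise_bounded:
  assumes x: "((\<lambda>t. x t / G t) \<longlongrightarrow> L) at_top"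
    and Q: "\<And>t. t > 0 \<Longrightarrow> (Q has_real_derivative f (x t)) (at t)"
    and y: "\<And>t. t \<ge> 0 \<Longrightarrow> x t = \<xi> - Q t + y t" and cont: "continuous_on {0..} y"
  shows "\<exists>K. \<forall>t\<ge>0. \<bar>y t\<bar> \<le> K"
proof -
  obtain \<kappa> where \<kappa>: "\<And>\<epsilon>. \<epsilon> > 0 \<Longrightarrow> \<exists>T>0. \<forall>t s. T \<le> t \<longrightarrow> t \<le> s \<longrightarrow> \<bar>y s - y t - \<kappa> * (G t - G s)\<bar> \<le> \<epsilon> * G t"
    using noise_increments[OF x Q y] by blast
  obtain T where T: "T > 0" "\<And>s. T \<le> s \<Longrightarrow> \<bar>y s - y T - \<kappa> * (G T - G s)\<bar> \<le> 1 * G T"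
    using \<kappa>[of 1] by (metis order_refl zero_less_one)
  have "compact (y ` {0..T})" by (intro compact_continuous_image continuous_on_subset[OF cont]) auto
  from compact_imp_bounded[OF this] obtain K where "\<forall>u\<in>y ` {0..T}. norm u \<le> K"
    unfolding bounded_iff ..
  then have K: "\<bar>y t\<bar> \<le> K" if "t \<in> {0..T}" for t using that by auto
  have "\<bar>y s\<bar> \<le> K + (1 + \<bar>\<kappa>\<bar>) * G T" if "s \<ge> 0" for s
  proof (cases "s \<le> T")
    case True
    then show ?thesis using K[of s] that G_pos[of T] T by (smt (verit) mult_nonneg_nonneg abs_ge_zero atLeastAtMost_iff)
  next
    case False
    then have G: "0 < G s" "G s \<le> G T" using G_pos[of s] G_antimono[of T s] T that by auto
    have "\<bar>\<kappa> * (G T - G s)\<bar> \<le> \<bar>\<kappa>\<bar> * G T" using G by (simp add: abs_mult mult_left_mono)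
    moreover have "\<bar>y T\<bar> \<le> K" using K T by auto
    ultimately show ?thesis using T(2)[of s] False by (simp add: distrib_right)
  qed
  then show ?thesis by blast
qed

text \<open>The alternative is decided by the sign of \<open>\<kappa>\<close>, as \<open>G\<close> is decreasing.\<close>

lemma noise_increments_one_sided:
  assumes x: "((\<lambda>t. x t / G t) \<longlongrightarrow> L) at_top"
    and Q: "\<And>t. t > 0 \<Longrightarrow> (Q has_real_derivative f (x t)) (at t)"
    and y: "\<And>t. t \<ge> 0 \<Longrightarrow> x t = \<xi> - Q t + y t" and "a > 0"
  shows "\<exists>T. (\<forall>t s. T \<le> t \<longrightarrow> t \<le> s \<longrightarrow> y s - y t > - (a * G t)) \<or> (\<forall>t s. T \<le> t \<longrightarrow> t \<le> s \<longrightarrow> y s - y t < a * G t)"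
proof -
  obtain \<kappa> where \<kappa>: "\<And>\<epsilon>. \<epsilon> > 0 \<Longrightarrow> \<exists>T>0. \<forall>t s. T \<le> t \<longrightarrow> t \<le> s \<longrightarrow> \<bar>y s - y t - \<kappa> * (G t - G s)\<bar> \<le> \<epsilon> * G t"
    using noise_increments[OF x Q y] by blast
  have "a/2 > 0" using \<open>a > 0\<close> by simp
  then obtain T where T: "T > 0" "\<And>t s. T \<le> t \<Longrightarrow> t \<le> s \<Longrightarrow> \<bar>y s - y t - \<kappa> * (G t - G s)\<bar> \<le> a/2 * G t"
    using \<kappa> by blast
  have G: "G t > 0" "G t - G s \<ge> 0" if "T \<le> t" "t \<le> s" for t s
    using G_pos[of t] G_antimono[of t s] T that by auto
  show ?thesis
  proof (cases "\<kappa> \<ge> 0")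
    case True
    have "y s - y t > - (a * G t)" if "T \<le> t" "t \<le> s" for t s
    proof -
      have "\<kappa> * (G t - G s) \<ge> 0" using True G[OF that] by simp
      moreover have "a/2 * G t < a * G t" using G[OF that] \<open>a > 0\<close> by simp
      ultimately show ?thesis using T(2)[OF that] by linarith
    qed
    then show ?thesis by blast
  next
    case False
    have "y s - y t < a * G t" if "T \<le> t" "t \<le> s" for t s
    proof -
      have "\<kappa> * (G t - G s) \<le> 0" using False G[OF that] by (simp add: mult_nonpos_nonneg)
      moreover have "a/2 * G t < a * G t" using G[OF that] \<open>a > 0\<close> by simp
      ultimately show ?thesis using T(2)[OF that] by linarith
    qed
    then show ?thesis by blast
  qed
qed

end

section \<open>The limit theorem\<close>

lemma (in prob_space) complete_AE_notin:
  assumes "complete_measure M" "AE \<omega> in M. \<omega> \<notin> S" "S \<subseteq> space M"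
  shows "S \<in> events \<and> prob S = 0"
proof -
  obtain N where N: "{\<omega> \<in> space M. \<not> \<omega> \<notin> S} \<subseteq> N" "N \<in> null_sets M"
    using assms(2) by (auto simp: eventually_ae_filter)
  then have "S \<subseteq> N" using assms(3) by auto
  then have "S \<in> null_sets M" using complete_measure.complete2[OF assms(1) _ N(2)] by blast
  then show ?thesis by (auto simp: null_sets_def measure_def)
qed

lemma (in prob_space) complete_AE_in:
  assumes "complete_measure M" "AE \<omega> in M. \<omega> \<in> S" "S \<subseteq> space M"
  shows "S \<in> events \<and> prob S = 1"
proof -
  have "AE \<omega> in M. \<omega> \<notin> space M - S" using assms(2) by eventually_elim auto
  from complete_AE_notin[OF assms(1) this] have *: "space M - S \<in> events" "prob (space M - S) = 0" by auto
  have "space M - (space M - S) \<in> events" using *(1) by (rule sets.compl_sets)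
  moreover have "space M - (space M - S) = S" using assms(3) by auto
  ultimately have "S \<in> events" by simp
  then show ?thesis using *(2) prob_compl[of S] by simp
qed

lemma asymptotically_odd_ratio:
  fixes f \<phi> :: "real \<Rightarrow> real"
  assumes "\<And>x. \<phi> (- x) = - \<phi> x" "((\<lambda>x. f x / \<phi> x) \<longlongrightarrow> 1) (at 0)"
    and f: "\<And>x. x > 0 \<Longrightarrow> f x > 0"
  shows "((\<lambda>x. - f (- x) / f x) \<longlongrightarrow> 1) (at_right 0)"
proof -
  have r: "((\<lambda>x. f x / \<phi> x) \<longlongrightarrow> 1) (at_right 0)" and l: "((\<lambda>x. f x / \<phi> x) \<longlongrightarrow> 1) (at_left 0)"
    using assms(2) by (auto simp: filterlim_at_split)
  have "filterlim (\<lambda>x::real. - x) (at_left 0) (at_right 0)"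
    by (simp add: filterlim_def at_left_minus[of 0])
  from filterlim_compose[OF l this] have "((\<lambda>x. f (- x) / \<phi> (- x)) \<longlongrightarrow> 1) (at_right 0)" .
  then have "((\<lambda>x. (f (- x) / \<phi> (- x)) / (f x / \<phi> x)) \<longlongrightarrow> 1 / 1) (at_right 0)"
    by (intro tendsto_divide r) auto
  moreover have "\<forall>\<^sub>F x in at_right 0. f x / \<phi> x > 0" using r by (rule order_tendstoD) simp
  then have "\<forall>\<^sub>F x in at_right 0. (f (- x) / \<phi> (- x)) / (f x / \<phi> x) = - f (- x) / f x"
    by eventually_elim (auto simp: assms(1) zero_less_divide_iff)
  ultimately show ?thesis by (simp add: Lim_transform_eventually)
qed

theorem theorem12:
  fixes M :: "'a measure"
    and B X :: "real \<Rightarrow> 'a \<Rightarrow> real"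
    and f \<sigma> :: "real \<Rightarrow> real"
    and \<beta> \<xi> :: real
  assumes "prob_space M"
    and "complete_measure M"
    and "standard_brownian_motion M B"
    and "local_lipschitz (UNIV :: real set) UNIV (\<lambda>_. f)"
    and "f 0 = 0"
    and "\<And>x. x \<noteq> 0 \<Longrightarrow> x * f x > 0"
    and "\<exists>\<phi> :: real \<Rightarrow> real. (\<forall>x. \<phi> (- x) = - \<phi> x) \<and> ((\<lambda>x. f x / \<phi> x) \<longlongrightarrow> 1) (at 0)"
    and "regularly_varying_at_0 f \<beta>"
    and "\<beta> > 1"
    and "((\<lambda>x. f x / x) \<longlongrightarrow> 0) (at_right 0)"
    and "continuous_on {0..} \<sigma>"
    and "\<And>t. t \<ge> 0 \<Longrightarrow> (\<integral>\<^sup>+s\<in>{t..}. ennreal ((\<sigma> s)\<^sup>2) \<partial>lborel) > 0"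
    and "sde_solution M B f \<sigma> \<xi> X"
  shows "(\<not> set_integrable lborel {0..} (\<lambda>s. (\<sigma> s)\<^sup>2) \<longrightarrow>
           limit_in M X (F_inv f) UNIV \<in> sets M \<and>
           measure M (limit_in M X (F_inv f) UNIV) = 0) \<and>
         (\<forall>\<mu> :: ereal.
           set_integrable lborel {0..} (\<lambda>s. (\<sigma> s)\<^sup>2) \<and> 0 \<le> \<mu> \<and>
           ((\<lambda>t. ereal (2 * tail_var \<sigma> t * ln (ln (1 / tail_var \<sigma> t)) / (F_inv f t)\<^sup>2))
              \<longlongrightarrow> \<mu>\<^sup>2) at_top \<longrightarrow>
           (\<mu> = 0 \<longrightarrow>
              limit_in M X (F_inv f) {-1, 0, 1} \<in> sets M \<and>
              measure M (limit_in M X (F_inv f) {-1, 0, 1}) = 1) \<and>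
           (\<mu> > 0 \<longrightarrow>
              limit_in M X (F_inv f) UNIV \<in> sets M \<and>
              measure M (limit_in M X (F_inv f) UNIV) = 0))"
proof -
  interpret prob_space M by fact
  interpret brownian M B
    by (intro brownian.intro brownian_axioms.intro) (fact assms)+
  note \<sigma> = \<open>continuous_on {0..} \<sigma>\<close>
  define G where "G = F_inv f"
  define v where "v = variance_of \<sigma>"
  have pos: "f x > 0" if "x > 0" for x using assms(6)[of x] that by (auto simp: zero_less_mult_iff)
  have f_cont: "continuous_on UNIV f"
    by (rule local_lipschitz_continuous_on[OF assms(4)]) simp
  then have f_cont': "continuous_on {0<..} f" by (rule continuous_on_subset) simp
  have G_facts: "t \<ge> 0 \<Longrightarrow> F_inv f t > 0" "t > 0 \<Longrightarrow> (F_inv f has_real_derivative - f (F_inv f t)) (at t)"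
    "(F_inv f \<longlongrightarrow> 0) at_top" "0 \<le> s \<Longrightarrow> s \<le> t \<Longrightarrow> F_inv f t \<le> F_inv f s" for s t
    by (rule F_of_F_inv(2)[OF _ f_cont' assms(10)] F_inv_has_derivative[OF _ f_cont' assms(10)]
        F_inv_tendsto_0[OF _ f_cont' assms(10)] F_inv_antimono[OF _ f_cont' assms(10)]; use pos in auto)+
  interpret path: perturbed_equation f \<beta> G
  proof unfold_locales
    show "((\<lambda>x. f (l * x) / f x) \<longlongrightarrow> l powr \<beta>) (at_right 0)" if "l > 0" for l
      using assms(8) that by (simp add: regularly_varying_at_0_def)
    obtain \<phi> where \<phi>: "\<And>x. \<phi> (- x) = - \<phi> x" "((\<lambda>x. f x / \<phi> x) \<longlongrightarrow> 1) (at 0)" using assms(7) by blast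
    show "((\<lambda>x. - f (- x) / f x) \<longlongrightarrow> 1) (at_right 0)" by (rule asymptotically_odd_ratio[OF \<phi> pos])
    show "f x > 0" if "x > 0" for x using that by (rule pos)
    show "x * f x > 0" if "x \<noteq> 0" for x using that by (rule assms(6))
    show "G t > 0" if "t \<ge> 0" for t unfolding G_def using that by (rule G_facts(1))
    show "(G has_real_derivative - f (G t)) (at t)" if "t > 0" for t unfolding G_def using that by (rule G_facts(2))
    show "(G \<longlongrightarrow> 0) at_top" unfolding G_def by (rule G_facts(3))
  qed (fact assms f_cont f_cont')+
  obtain Y where Y: "\<And>t. t \<ge> 0 \<Longrightarrow> has_stochastic_integral M B \<sigma> t (Y t)"
    and Y_cont: "AE \<omega> in M. continuous_on {0..} (\<lambda>t. Y t \<omega>)"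
    and X_eq: "AE \<omega> in M. \<forall>t\<ge>0. X t \<omega> = \<xi> - (LBINT s:{0..t}. f (X s \<omega>)) + Y t \<omega>"
    and X_cont: "AE \<omega> in M. continuous_on {0..} (\<lambda>t. X t \<omega>)"
    using assms(13) by (auto simp: sde_solution_def stochastic_integral_process_def as_continuous_def)
  interpret noise: gaussian_increments M \<C> Y v
    unfolding v_def by (rule stochastic_integral_gaussian_increments[OF \<sigma> Y])
  define Q where "Q \<omega> t = (LBINT s:{0..t}. f (X s \<omega>))" for \<omega> t
  have paths: "AE \<omega> in M. continuous_on {0..} (\<lambda>t. Y t \<omega>) \<and> (\<forall>t>0. (Q \<omega> has_real_derivative f (X t \<omega>)) (at t)) \<and>
      (\<forall>t\<ge>0. X t \<omega> = \<xi> - Q \<omega> t + Y t \<omega>) \<and> \<omega> \<in> space M"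
    using Y_cont X_eq X_cont AE_space
  proof eventually_elim
    case (elim \<omega>)
    have "continuous_on {0..} (\<lambda>t. f (X t \<omega>))" by (rule continuous_on_compose2[OF f_cont elim(3)]) simp
    from integral_from_0_has_derivative[OF this] have "\<forall>t>0. (Q \<omega> has_real_derivative f (X t \<omega>)) (at t)"
      by (simp add: Q_def[abs_def])
    then show ?case using elim by (auto simp: Q_def)
  qed
  have v_eq: "v t = (LINT s:{0..t}|lborel. (\<sigma> s)\<^sup>2)" for t by (simp add: v_def variance_of_def)
  have limit_space: "limit_in M X (F_inv f) S \<subseteq> space M" for S by (auto simp: limit_in_def)
  have part_a: "limit_in M X (F_inv f) UNIV \<in> sets M \<and> measure M (limit_in M X (F_inv f) UNIV) = 0"
    if not_int: "\<not> set_integrable lborel {0..} (\<lambda>s. (\<sigma> s)\<^sup>2)"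
  proof -
    have "filterlim v at_top at_top"
      using square_not_integrable_imp_variance_at_top[OF \<sigma> not_int] noise.v_mono by (simp add: v_def)
    from noise.unbounded_variance_imp_unbounded[OF this] paths
    have "AE \<omega> in M. \<omega> \<notin> limit_in M X (F_inv f) UNIV"
    proof eventually_elim
      case (elim \<omega>)
      show ?case
      proof
        assume "\<omega> \<in> limit_in M X (F_inv f) UNIV"
        then obtain L where "((\<lambda>t. X t \<omega> / G t) \<longlongrightarrow> L) at_top" by (auto simp: limit_in_def G_def)
        from path.noise_bounded[OF this, of "Q \<omega>" \<xi> "\<lambda>t. Y t \<omega>"] elim
        obtain K where K: "\<And>t. t \<ge> 0 \<Longrightarrow> \<bar>Y t \<omega>\<bar> \<le> K" by blast
        obtain n :: nat where "\<bar>Y (real n) \<omega> - Y 0 \<omega>\<bar> > 2 * K" using elim(1) by blast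
        then show False using K[of "real n"] K[of 0] by auto
      qed
    qed
    then show ?thesis by (rule complete_AE_notin[OF assms(2) _ limit_space])
  qed
  have part_b: "(\<mu> = 0 \<longrightarrow> limit_in M X (F_inv f) {-1, 0, 1} \<in> sets M \<and> measure M (limit_in M X (F_inv f) {-1, 0, 1}) = 1) \<and>
      (\<mu> > 0 \<longrightarrow> limit_in M X (F_inv f) UNIV \<in> sets M \<and> measure M (limit_in M X (F_inv f) UNIV) = 0)"
    if int: "set_integrable lborel {0..} (\<lambda>s. (\<sigma> s)\<^sup>2)"
      and \<mu>: "((\<lambda>t. ereal (2 * tail_var \<sigma> t * ln (ln (1 / tail_var \<sigma> t)) / (F_inv f t)\<^sup>2)) \<longlongrightarrow> \<mu>\<^sup>2) at_top" for \<mu> :: ereal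
  proof -
    define c where "c = tail_var \<sigma> 0"
    have tail: "tail_var \<sigma> t = c - v t" if "t \<ge> 0" for t
      unfolding c_def v_def by (rule tail_var_eq[OF int that])
    have tail_pos: "tail_var \<sigma> t > 0" if "t \<ge> 0" for t
      by (rule tail_var_positive[OF int that assms(12)[OF that]])
    have v0: "v 0 = 0" using tail[of 0] by (simp add: c_def)
    have v_lim: "(v \<longlongrightarrow> c) at_top"
      using tendsto_set_lebesgue_integral_at_top[of 0 lborel "\<lambda>s. (\<sigma> s)\<^sup>2", OF _ int]
      by (simp add: v_eq[abs_def] c_def tail_var_def)
    have v_cont: "continuous_on {0..T} v" for T
      unfolding v_eq[abs_def] by (intro integral_from_0_continuous continuous_intros \<sigma>)
    have v_less: "v t < c" if "t \<ge> 0" for t using tail[OF that] tail_pos[OF that] by simp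
    have "\<exists>\<tau> :: nat \<Rightarrow> real. (\<forall>n. \<tau> n \<ge> 0) \<and> (\<forall>n. \<tau> n \<le> \<tau> (Suc n)) \<and> filterlim \<tau> at_top sequentially \<and>
        (\<forall>n. c - v (\<tau> n) = c / 2 ^ n)"
      by (rule halving_times) (fact v_cont noise.v_mono v0 v_less v_lim)+
    then obtain \<tau> :: "nat \<Rightarrow> real" where \<tau>: "\<And>n. \<tau> n \<ge> 0" "\<And>n. \<tau> n \<le> \<tau> (Suc n)" "filterlim \<tau> at_top sequentially"
      and c_\<tau>: "\<And>n. c - v (\<tau> n) = c / 2 ^ n"
      by blast
    interpret halving: variance_halving M \<C> Y v \<tau> c
    proof unfold_locales
      show "c > 0" using tail_pos[of 0] by (simp add: c_def)
      show "v (\<tau> (Suc n)) - v (\<tau> n) = c / 2 ^ n / 2" for n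
        using c_\<tau>[of n] c_\<tau>[of "Suc n"] by simp
    qed (use \<tau> in auto)
    define q where "q t = 2 * tail_var \<sigma> t * ln (ln (1 / tail_var \<sigma> t)) / (G t)\<^sup>2" for t
    have q: "((\<lambda>t. ereal (q t)) \<longlongrightarrow> \<mu>\<^sup>2) at_top" using \<mu> by (simp add: q_def G_def)
    have lil_eq: "lil (c / 2 ^ n) = sqrt (q (\<tau> n)) * G (\<tau> n)" for n
    proof -
      have "tail_var \<sigma> (\<tau> n) = c / 2 ^ n" using tail[OF \<tau>(1)] c_\<tau> by simp
      then have "sqrt (q (\<tau> n)) = lil (c / 2 ^ n) / G (\<tau> n)"
        using path.G_pos[OF \<tau>(1)[of n]] by (simp only: q_def lil_def real_sqrt_divide real_sqrt_abs abs_of_pos)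
      then show ?thesis using path.G_pos[OF \<tau>(1)[of n]] by simp
    qed
    have "limit_in M X (F_inv f) {-1, 0, 1} \<in> sets M \<and> measure M (limit_in M X (F_inv f) {-1, 0, 1}) = 1" if "\<mu> = 0"
    proof -
      have "((\<lambda>t. ereal (q t)) \<longlongrightarrow> ereal 0) at_top" using q that by (simp add: power2_eq_square zero_ereal_def)
      then have "(q \<longlongrightarrow> 0) at_top" by simp
      from filterlim_compose[OF this \<tau>(3)] have "(\<lambda>n. q (\<tau> n)) \<longlonglongrightarrow> 0" .
      then have "(\<lambda>n. sqrt (q (\<tau> n))) \<longlonglongrightarrow> sqrt 0" by (rule tendsto_real_sqrt)
      moreover have "lil (c / 2 ^ n) / G (\<tau> n) = sqrt (q (\<tau> n))" for n
        using path.G_pos[OF \<tau>(1)[of n]] by (simp add: lil_eq)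
      ultimately have hG: "(\<lambda>n. lil (c / 2 ^ n) / G (\<tau> n)) \<longlonglongrightarrow> 0" by simp
      have "AE \<omega> in M. \<omega> \<in> limit_in M X (F_inv f) {-1, 0, 1}"
        using halving.oscillations_eventually_small[OF Y_cont] paths
      proof eventually_elim
        case (elim \<omega>)
        have "\<exists>l. ((\<lambda>t. (l - Y t \<omega>) / G t) \<longlongrightarrow> 0) at_top"
          using G_facts(4) by (intro geometric_oscillations_imp_small_tail[OF \<tau> path.G_pos _ elim(1) lil_halving_steps[OF halving.c_pos] hG])
            (auto simp: G_def)
        then obtain l where l: "((\<lambda>t. (l - Y t \<omega>) / G t) \<longlongrightarrow> 0) at_top" by blast
        \<comment> \<open>\<open>l\<close> is the limit of the noise, and \<open>\<xi> + l - Q\<close> is the solution \<open>z\<close> of the perturbed equation.\<close>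
        have zR: "(\<xi> + l - Q \<omega> t) - (l - Y t \<omega>) = X t \<omega>" if "t \<ge> 0" for t
          using elim(2) that by simp
        have "((\<lambda>t. \<xi> + l - Q \<omega> t) has_real_derivative - f ((\<xi> + l - Q \<omega> t) - (l - Y t \<omega>))) (at t)" if "t > 0" for t
        proof -
          have dQ: "(Q \<omega> has_real_derivative f (X t \<omega>)) (at t)" using elim(2) that by blast
          have "((\<lambda>t. \<xi> + l - Q \<omega> t) has_real_derivative 0 - f (X t \<omega>)) (at t)"
            by (intro DERIV_diff DERIV_const dQ)
          then show ?thesis unfolding zR[OF less_imp_le[OF that]] by simp
        qed
        from path.perturbed_solution_trichotomy[OF this l]
        obtain L where L: "L \<in> {-1, 0, 1}" "((\<lambda>t. (\<xi> + l - Q \<omega> t - (l - Y t \<omega>)) / G t) \<longlongrightarrow> L) at_top" by blast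
        have "\<forall>\<^sub>F t in at_top. (\<xi> + l - Q \<omega> t - (l - Y t \<omega>)) / G t = X t \<omega> / G t"
          using eventually_ge_at_top[of 0] by eventually_elim (simp only: zR)
        with L(2) have "((\<lambda>t. X t \<omega> / G t) \<longlongrightarrow> L) at_top" by (rule Lim_transform_eventually)
        then show ?case using L(1) elim(2) unfolding limit_in_def G_def by blast
      qed
      then show ?thesis by (rule complete_AE_in[OF assms(2) _ limit_space])
    qed
    moreover have "limit_in M X (F_inv f) UNIV \<in> sets M \<and> measure M (limit_in M X (F_inv f) UNIV) = 0" if "\<mu> > 0"
    proof -
      have "\<mu>\<^sup>2 > 0" using that by (cases \<mu>) (auto simp: power2_eq_square)
      then obtain r where r: "0 < ereal r" "ereal r < \<mu>\<^sup>2" using ereal_dense2 by blast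
      have "\<forall>\<^sub>F t in at_top. ereal r < ereal (q t)" using q r(2) by (rule order_tendstoD)
      then have "\<forall>\<^sub>F n in sequentially. q (\<tau> n) > r"
        using \<tau>(3) by (auto dest: eventually_compose_filterlim)
      then obtain N where N: "\<And>n. n \<ge> N \<Longrightarrow> q (\<tau> n) > r" by (auto simp: eventually_sequentially)
      \<comment> \<open>As \<open>lil (c / 2 ^ n) = sqrt (q (\<tau> n)) G (\<tau> n)\<close>, half of it is at least \<open>a G (\<tau> n)\<close> for large \<open>n\<close>.\<close>
      define a where "a = sqrt r / 2"
      have "a > 0" using r by (simp add: a_def)
      have large: "lil (c / 2 ^ n) / 2 \<ge> a * G (\<tau> n)" if "n \<ge> N" for n
        using N[OF that] path.G_pos[OF \<tau>(1)[of n]] by (simp add: lil_eq a_def)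
      interpret neg: gaussian_increments M \<C> "\<lambda>t \<omega>. - Y t \<omega>" v by (rule noise.reflected)
      interpret neg: variance_halving M \<C> "\<lambda>t \<omega>. - Y t \<omega>" v \<tau> c
        by unfold_locales (rule halving.c_pos halving.times halving.halving)+
      have "AE \<omega> in M. \<omega> \<notin> limit_in M X (F_inv f) UNIV"
        using halving.increments_infinitely_often_large neg.increments_infinitely_often_large paths
      proof eventually_elim
        case (elim \<omega>)
        show ?case
        proof
          assume "\<omega> \<in> limit_in M X (F_inv f) UNIV"
          then obtain L where "((\<lambda>t. X t \<omega> / G t) \<longlongrightarrow> L) at_top" by (auto simp: limit_in_def G_def)
          from path.noise_increments_one_sided[OF this, of "Q \<omega>" \<xi> "\<lambda>t. Y t \<omega>" a] elim \<open>a > 0\<close>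
          obtain T where T: "(\<forall>t s. T \<le> t \<longrightarrow> t \<le> s \<longrightarrow> Y s \<omega> - Y t \<omega> > - (a * G t)) \<or>
              (\<forall>t s. T \<le> t \<longrightarrow> t \<le> s \<longrightarrow> Y s \<omega> - Y t \<omega> < a * G t)" by blast
          have "\<forall>\<^sub>F n in sequentially. \<tau> n \<ge> T" using \<tau>(3) by (simp add: filterlim_at_top)
          then obtain N' where N': "\<And>n. n \<ge> N' \<Longrightarrow> \<tau> n \<ge> T" by (auto simp: eventually_sequentially)
          obtain n where n: "n \<ge> max N N'" "Y (\<tau> (Suc n)) \<omega> - Y (\<tau> n) \<omega> \<ge> lil (c / 2 ^ n) / 2"
            using elim(1) unfolding INFM_nat_le by blast
          obtain m where m: "m \<ge> max N N'" "- Y (\<tau> (Suc m)) \<omega> - - Y (\<tau> m) \<omega> \<ge> lil (c / 2 ^ m) / 2"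
            using elim(2) unfolding INFM_nat_le by blast
          have "Y (\<tau> (Suc n)) \<omega> - Y (\<tau> n) \<omega> \<ge> a * G (\<tau> n)" "Y (\<tau> (Suc m)) \<omega> - Y (\<tau> m) \<omega> \<le> - (a * G (\<tau> m))"
            using n m large[of n] large[of m] by auto
          moreover have "\<tau> n \<ge> T" "\<tau> m \<ge> T" using N' n m by auto
          ultimately show False using T \<tau>(2)[of n] \<tau>(2)[of m] by (meson linorder_not_less)
        qed
      qed
      then show ?thesis by (rule complete_AE_notin[OF assms(2) _ limit_space])
    qed
    ultimately show ?thesis by blast
  qed
  show ?thesis using part_a part_b by blast
qed

end
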